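(* For any set $A\in 2^\omega$, the following conditions are equivalent: (1) $A$ is low for $1$-randomness; (2) $A$ is low for weak $2$-random tests; (3) $A$ is low for weak $2$-randomness.
   Context: Subsets of $\omega$ are identified with elements of $2^\omega$; $\mu$ is Lebesgue (fair-coin) measure on $2^\omega$. For an oracle $A$, a Martin-Löf test relative to $A$ is an $A$-computable (i.e. uniformly $\Sigma^A_1$) nested sequence of $\Sigma^A_1$ classes $U^A_0\supseteq U^A_1\supseteq\cdots$ in $2^\omega$ with $\mu(U^A_n)\leq 2^{-n}$. A set $R$ is $A$-random (or $1$-random relative to $A$) if $R\notin\bigcap_n U^A_n$ for every such test; $1$-random means $\emptyset$-random. $A$ is low for $1$-randomness if every $1$-random set is $A$-random. A generalized Martin-Löf test relative to $A$ is an $A$-computable (uniformly $\Sigma^A_1$) nested sequence of $\Sigma^A_1$ classes $U_0\supseteq U_1\supseteq\cdots$ with $\mu(\bigcap_i U_i)=0$; an (unrelativized) generalized Martin-Löf test is the case $A=\emptyset$. A set $X$ is weakly $2$-random relative to $A$ if $X\notin\bigcap_i U_i$ for every generalized Martin-Löf test relative to $A$; weakly $2$-random means weakly $2$-random relative to $\emptyset$. $A$ is low for weak $2$-randomness if every weakly $2$-random set is weakly $2$-random relative to $A$. $A$ is low for weak $2$-random tests if for every generalized Martin-Löf test $\{V^A_i\}_{i\in\omega}$ relative to $A$ there is an (unrelativized) generalized Martin-Löf test $\{U_i\}_{i\in\omega}$ such that $\bigcap_i V^A_i\subseteq\bigcap_i U_i$. *)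

theory Defs
  imports "HOL-Probability.Probability" "HOL-Library.Nat_Bijection"
begin

text \<open>Subsets of \<open>\<omega>\<close> are identified with their characteristic functions.\<close>

type_synonym cantor = "nat \<Rightarrow> bool"

abbreviation empty_oracle :: cantor where
  "empty_oracle \<equiv> (\<lambda>_. False)"

definition coin_measure :: "cantor measure" where
  "coin_measure = PiM UNIV (\<lambda>_. measure_pmf (bernoulli_pmf (1 / 2)))"

definition cylinder :: "bool list \<Rightarrow> cantor set" where
  "cylinder \<sigma> = {X. \<forall>i < length \<sigma>. X i = \<sigma> ! i}"

text \<open>
  Kleene's partial recursive functions with an oracle.  Arity is not tracked by the syntax: a
  program is run on a list of arguments and diverges if an argument it needs is missing, while
  superfluous arguments are ignored.
\<close>

datatype prog =
    Zero
  | Succ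
  | Orac
  | Proj nat
  | Comp prog "prog list"
  | PrimRec prog prog
  | Minim prog

inductive computes :: "cantor \<Rightarrow> prog \<Rightarrow> nat list \<Rightarrow> nat \<Rightarrow> bool" for A :: cantor where
  zero: "computes A Zero xs 0"
| succ: "computes A Succ (x # xs) (Suc x)"
| orac: "computes A Orac (x # xs) (of_bool (A x))"
| proj: "i < length xs \<Longrightarrow> computes A (Proj i) xs (xs ! i)"
| comp: "list_all2 (\<lambda>g z. computes A g xs z) gs zs \<Longrightarrow> computes A f zs y
    \<Longrightarrow> computes A (Comp f gs) xs y"
| primrec_0: "computes A f xs y \<Longrightarrow> computes A (PrimRec f g) (0 # xs) y"
| primrec_Suc: "computes A (PrimRec f g) (n # xs) r \<Longrightarrow> computes A g (n # r # xs) y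
    \<Longrightarrow> computes A (PrimRec f g) (Suc n # xs) y"
| minim: "computes A f (n # xs) 0 \<Longrightarrow> (\<And>m. m < n \<Longrightarrow> \<exists>r > 0. computes A f (m # xs) r)
    \<Longrightarrow> computes A (Minim f) xs n"

inductive_cases computes_elims:
  "computes A Zero xs y"
  "computes A Succ xs y"
  "computes A Orac xs y"
  "computes A (Proj i) xs y"
  "computes A (Comp f gs) xs y"
  "computes A (PrimRec f g) (0 # xs) y"
  "computes A (PrimRec f g) (Suc n # xs) y"
  "computes A (Minim f) xs y"

lemma computes_deterministic: "computes A p xs y \<Longrightarrow> computes A p xs z \<Longrightarrow> y = z"
proof (induction arbitrary: z rule: computes.induct)
  case (zero xs)
  then show ?case by (rule computes_elims(1)) simp
next
  case (succ x xs)
  then show ?case by (rule computes_elims(2)) simp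
next
  case (orac x xs)
  then show ?case by (rule computes_elims(3)) simp
next
  case (proj i xs)
  from proj(2) show ?case by (rule computes_elims(4)) simp
next
  case (comp xs gs zs f y)
  from comp.prems obtain ws where ws: "list_all2 (\<lambda>g z. computes A g xs z) gs ws"
    and f: "computes A f ws z"
    by (rule computes_elims(5))
  have "zs = ws"
    using comp.IH(1) ws by (simp add: list_all2_conv_all_nth nth_equalityI)
  with comp.IH(2) f show ?case by simp
next
  case (primrec_0 f xs y g)
  from primrec_0.prems show ?case by (rule computes_elims(6)) (rule primrec_0.IH)
next
  case (primrec_Suc f g n xs r y)
  from primrec_Suc.prems obtain r' where "computes A (PrimRec f g) (n # xs) r'"
    and "computes A g (n # r' # xs) z"
    by (rule computes_elims(7))
  with primrec_Suc.IH show ?case by blast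
next
  case (minim f n xs)
  from minim.prems obtain z0: "computes A f (z # xs) 0"
    and zm: "\<And>m. m < z \<Longrightarrow> \<exists>r > 0. computes A f (m # xs) r"
    by (rule computes_elims(8)) blast
  show ?case
  proof (cases n z rule: linorder_cases)
    case less
    from zm[OF less] obtain r where "r > 0" "computes A f (n # xs) r" by blast
    with minim.IH(1) show ?thesis by blast
  next
    case greater
    from minim.IH(2)[OF greater] z0 show ?thesis by blast
  qed
qed

definition halts :: "cantor \<Rightarrow> prog \<Rightarrow> nat list \<Rightarrow> bool" where
  "halts A p xs \<longleftrightarrow> (\<exists>y. computes A p xs y)"

definition string_code :: "bool list \<Rightarrow> nat" where
  "string_code \<sigma> = list_encode (map of_bool \<sigma>)"

text \<open>
  A sequence of classes is uniformly \<open>\<Sigma>\<^sub>1\<close> relative to \<open>A\<close> if a single \<open>A\<close>-c.e. relation (the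
  domain of one \<open>A\<close>-partial recursive function) enumerates, for each \<open>n\<close>, strings whose cylinders
  have union \<open>U n\<close>.
\<close>

definition uniformly_Sigma1 :: "cantor \<Rightarrow> (nat \<Rightarrow> cantor set) \<Rightarrow> bool" where
  "uniformly_Sigma1 A U \<longleftrightarrow>
    (\<exists>p. \<forall>n. U n = (\<Union>\<sigma> \<in> {\<sigma>. halts A p [n, string_code \<sigma>]}. cylinder \<sigma>))"

lemma cylinder_measurable [measurable]: "cylinder \<sigma> \<in> sets coin_measure"
proof -
  have "cylinder \<sigma> = {X \<in> space coin_measure. \<forall>i < length \<sigma>. X i = \<sigma> ! i}"
    by (simp add: cylinder_def coin_measure_def space_PiM PiE_def)
  also have "\<dots> \<in> sets coin_measure"
    unfolding coin_measure_def by measurable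
  finally show ?thesis .
qed

lemma uniformly_Sigma1_measurable: "uniformly_Sigma1 A U \<Longrightarrow> U n \<in> sets coin_measure"
  by (auto simp: uniformly_Sigma1_def)

definition Martin_Lof_test :: "cantor \<Rightarrow> (nat \<Rightarrow> cantor set) \<Rightarrow> bool" where
  "Martin_Lof_test A U \<longleftrightarrow> uniformly_Sigma1 A U \<and> decseq U \<and>
    (\<forall>n. measure coin_measure (U n) \<le> (1 / 2) ^ n)"

definition generalized_Martin_Lof_test :: "cantor \<Rightarrow> (nat \<Rightarrow> cantor set) \<Rightarrow> bool" where
  "generalized_Martin_Lof_test A U \<longleftrightarrow> uniformly_Sigma1 A U \<and> decseq U \<and>
    measure coin_measure (\<Inter>i. U i) = 0"

definition random_rel :: "cantor \<Rightarrow> cantor \<Rightarrow> bool" where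
  "random_rel A R \<longleftrightarrow> (\<forall>U. Martin_Lof_test A U \<longrightarrow> R \<notin> (\<Inter>n. U n))"

definition weakly_2_random_rel :: "cantor \<Rightarrow> cantor \<Rightarrow> bool" where
  "weakly_2_random_rel A X \<longleftrightarrow> (\<forall>U. generalized_Martin_Lof_test A U \<longrightarrow> X \<notin> (\<Inter>i. U i))"

definition low_for_1_randomness :: "cantor \<Rightarrow> bool" where
  "low_for_1_randomness A \<longleftrightarrow> (\<forall>R. random_rel empty_oracle R \<longrightarrow> random_rel A R)"

definition low_for_weak_2_randomness :: "cantor \<Rightarrow> bool" where
  "low_for_weak_2_randomness A \<longleftrightarrow>
    (\<forall>X. weakly_2_random_rel empty_oracle X \<longrightarrow> weakly_2_random_rel A X)"

definition low_for_weak_2_random_tests :: "cantor \<Rightarrow> bool" where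
  "low_for_weak_2_random_tests A \<longleftrightarrow>
    (\<forall>V. generalized_Martin_Lof_test A V \<longrightarrow>
      (\<exists>U. generalized_Martin_Lof_test empty_oracle U \<and> (\<Inter>i. V i) \<subseteq> (\<Inter>i. U i)))"

end

theory Submission
  imports Defs
begin

text \<open>
  If \<open>A\<close> is low for 1-randomness, then by Kucera's argument every \<open>A\<close>-effectively open class of
  measure less than 1 is contained in an effectively open one of measure less than 1.  Coding
  requests of weight \<open>2\<^sup>-\<^sup>k\<close> by independent events of that measure, it follows that every
  \<open>A\<close>-c.e. set of finite weight is contained in a c.e. set of finite weight.  This is used twice.
  Applied to the initial segments of \<open>A\<close>, weighted optimally, it makes \<open>A\<close> an isolated path of a
  \<open>\<Pi>\<^sub>2\<close> tree of bounded width, so that the set of initial segments of \<open>A\<close> is \<open>\<Pi>\<^sub>2\<close>.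
  Applied to the pairs (minimal string of \<open>V\<^sub>i\<close>, its use) of a generalized test relative to \<open>A\<close>, it
  gives a c.e. set \<open>J\<close> of such pairs; at stage \<open>s\<close> one keeps the strings whose use still
  looks like an initial segment of \<open>A\<close>.  Finitely many wrong pairs are discarded eventually and
  the others have small weight, so the resulting \<open>\<Pi>\<^sub>2\<close> class exceeds \<open>V\<^sub>i\<close> by a null set.

  Conversely, suppose that \<open>T\<close> is 1-random but in some Martin-Lof test relative to \<open>A\<close>.  All tails of
  \<open>T\<close> may be assumed to be in the test, hence no component of it is contained in an effectively open
  class of measure less than 1.  Forcing with effectively closed classes of 1-random sequences
  therefore yields a weakly 2-random sequence with tails in every component of the test.
\<close>

subsection \<open>Computable functions\<close>

text \<open>Lowness speaks of single sequences and has to be turned into a statement about classes.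
  Fix a closed class of 1-random sequences and an \<open>A\<close>-open class \<open>U\<close> with
  \<open>mu U < 1\<close>. If minimal strings of \<open>U\<close> could be appended for ever without
  leaving the closed class, the limit would be 1-random but, by Kucera's argument, not
  \<open>A\<close>-random. So in some cylinder they cannot be appended, and there \<open>U\<close>
  is covered. The optimal weights imitate prefix-free complexity: a c.e. set \<open>Q\<close> of
  requests \<open>(n, k)\<close> assigns \<open>n\<close> a description of length \<open>k\<close>.
  The triples \<open>(n, seg A n, k)\<close> with \<open>(n, k)\<close> in \<open>Q\<close> weigh no
  more than \<open>Q\<close>, and a c.e. cover of finite weight admits boundedly many strings of
  each length. The approximation of \<open>A\<close> is needed because a cover of the pairs (string,
  use) may contain uses that are no initial segments of \<open>A\<close>, and without the oracle
  this shows only in the limit. In the converse the limit must avoid all generalized tests and still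
  fail to be \<open>A\<close>-random. Tails of one fixed \<open>T\<close> serve both ends: being
  1-random they escape the open classes to be avoided, and they lie in the test. The index demanded
  of the test grows with the position of the tail, so that the measures add up.\<close>

named_theorems comp_intros

text \<open>One program serves all oracles and tolerates trailing arguments, so that it can be used
  as a subprogram in an argument list of any length.\<close>

definition raw1 :: "(nat \<Rightarrow> nat) \<Rightarrow> bool" where
  "raw1 f \<longleftrightarrow> (\<exists>p. \<forall>A x xs. computes A p (x # xs) (f x))"

definition raw2 :: "(nat \<Rightarrow> nat \<Rightarrow> nat) \<Rightarrow> bool" where
  "raw2 f \<longleftrightarrow> (\<exists>p. \<forall>A x y xs. computes A p (x # y # xs) (f x y))"

lemma computes_Proj0: "computes A (Proj 0) (x # xs) x"
  using computes.proj[of 0 "x # xs" A] by simp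

lemma computes_Proj1: "computes A (Proj (Suc 0)) (x # y # xs) y"
  using computes.proj[of 1 "x # y # xs" A] by simp

lemma computes_Proj2: "computes A (Proj 2) (x # y # z # xs) z"
  using computes.proj[of 2 "x # y # z # xs" A] by simp

lemma computes_Comp1:
  "computes A g xs z \<Longrightarrow> computes A f [z] y \<Longrightarrow> computes A (Comp f [g]) xs y"
  by (rule computes.comp[of A xs "[g]" "[z]"]) auto

lemma computes_Comp2:
  "computes A g xs z \<Longrightarrow> computes A h xs w \<Longrightarrow> computes A f [z, w] y \<Longrightarrow>
    computes A (Comp f [g, h]) xs y"
  by (rule computes.comp[of A xs "[g, h]" "[z, w]"]) auto

lemma computes_PrimRec:
  assumes "computes A f xs (r 0)"
    and "\<And>n. computes A g (n # r n # xs) (r (Suc n))"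
  shows "computes A (PrimRec f g) (n # xs) (r n)"
  by (induction n) (auto intro: computes.intros assms)

lemma raw1_Suc: "raw1 Suc"
  unfolding raw1_def by (auto intro!: exI[of _ Succ] computes.intros)

lemma raw1_id: "raw1 (\<lambda>x. x)"
  unfolding raw1_def using computes_Proj0 by blast

lemma raw2_fst: "raw2 (\<lambda>x y. x)"
  unfolding raw2_def using computes_Proj0 by blast

lemma raw2_snd: "raw2 (\<lambda>x y. y)"
  unfolding raw2_def using computes_Proj1 by blast

lemma raw1_comp1:
  assumes "raw1 f" "raw1 g"
  shows "raw1 (\<lambda>x. f (g x))"
proof -
  from assms obtain p q where "\<And>A x xs. computes A p (x # xs) (f x)"
    and "\<And>A x xs. computes A q (x # xs) (g x)"
    unfolding raw1_def by metis
  then show ?thesis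
    unfolding raw1_def by (intro exI[of _ "Comp p [q]"] allI computes_Comp1)
qed

lemma raw2_comp1:
  assumes "raw1 f" "raw2 g"
  shows "raw2 (\<lambda>x y. f (g x y))"
proof -
  from assms obtain p q where "\<And>A x xs. computes A p (x # xs) (f x)"
    and "\<And>A x y xs. computes A q (x # y # xs) (g x y)"
    unfolding raw1_def raw2_def by metis
  then show ?thesis
    unfolding raw2_def by (intro exI[of _ "Comp p [q]"] allI computes_Comp1)
qed

lemma raw1_comp2:
  assumes "raw2 f" "raw1 g" "raw1 h"
  shows "raw1 (\<lambda>x. f (g x) (h x))"
proof -
  from assms obtain p q r where "\<And>A x y xs. computes A p (x # y # xs) (f x y)"
    and "\<And>A x xs. computes A q (x # xs) (g x)" and "\<And>A x xs. computes A r (x # xs) (h x)"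
    unfolding raw1_def raw2_def by metis
  then show ?thesis
    unfolding raw1_def by (intro exI[of _ "Comp p [q, r]"] allI computes_Comp2)
qed

lemma raw2_comp2:
  assumes "raw2 f" "raw2 g" "raw2 h"
  shows "raw2 (\<lambda>x y. f (g x y) (h x y))"
proof -
  from assms obtain p q r where "\<And>A x y xs. computes A p (x # y # xs) (f x y)"
    and "\<And>A x y xs. computes A q (x # y # xs) (g x y)"
    and "\<And>A x y xs. computes A r (x # y # xs) (h x y)"
    unfolding raw2_def by metis
  then show ?thesis
    unfolding raw2_def by (intro exI[of _ "Comp p [q, r]"] allI computes_Comp2)
qed

lemma raw1_const: "raw1 (\<lambda>_. c)"
proof (induction c)
  case 0
  show ?case unfolding raw1_def by (auto intro!: exI[of _ Zero] computes.intros)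
next
  case (Suc c)
  from raw1_comp1[OF raw1_Suc Suc] show ?case by simp
qed

lemma raw2_rec:
  assumes "raw1 f" "\<exists>p. \<forall>A n r y xs. computes A p (n # r # y # xs) (g n r y)"
  shows "raw2 (\<lambda>n y. rec_nat (f y) (\<lambda>n r. g n r y) n)"
proof -
  from assms obtain p q where p: "\<And>A y xs. computes A p (y # xs) (f y)"
    and q: "\<And>A n r y xs. computes A q (n # r # y # xs) (g n r y)"
    unfolding raw1_def by metis
  have "computes A (PrimRec p q) (n # y # xs) (rec_nat (f y) (\<lambda>n r. g n r y) n)" for A n y xs
    by (rule computes_PrimRec) (simp_all add: p q)
  then show ?thesis unfolding raw2_def by blast
qed

lemma raw1_rec:
  assumes "raw2 g"
  shows "raw1 (\<lambda>n. rec_nat c g n)"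
proof -
  from raw1_const[of c] assms obtain p q where p: "\<And>A y xs. computes A p (y # xs) c"
    and q: "\<And>A n r xs. computes A q (n # r # xs) (g n r)"
    unfolding raw1_def raw2_def by metis
  have "computes A (Comp (PrimRec p q) [Proj 0, Proj 0]) (n # xs) (rec_nat c g n)" for A n xs
    by (rule computes_Comp2 computes_Proj0)+ (rule computes_PrimRec; simp add: p q)
  then show ?thesis unfolding raw1_def by blast
qed

lemma raw2_add: "raw2 (+)"
proof -
  have "\<exists>p. \<forall>A n r y xs. computes A p (n # r # y # xs) (Suc r)"
    by (auto intro!: exI[of _ "Comp Succ [Proj 1]"] computes_Comp1 computes_Proj1 computes.succ)
  from raw2_rec[OF raw1_id this] show ?thesis
  proof (rule back_subst[of raw2])
    have "rec_nat y (\<lambda>n. Suc) n = n + y" for n y by (induction n) auto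
    then show "(\<lambda>n y. rec_nat y (\<lambda>n r. Suc r) n) = (+)" by (simp add: fun_eq_iff)
  qed
qed

lemma raw2_mult: "raw2 times"
proof -
  from raw2_add obtain p where p: "\<And>A x y xs. computes A p (x # y # xs) (x + y)"
    unfolding raw2_def by blast
  have "\<exists>p. \<forall>A n r y xs. computes A p (n # r # y # xs) (r + y)"
    by (auto intro!: exI[of _ "Comp p [Proj 1, Proj 2]"] computes_Comp2 computes_Proj1
        computes_Proj2 p)
  from raw2_rec[OF raw1_const this, of 0] show ?thesis
  proof (rule back_subst[of raw2])
    have "rec_nat 0 (\<lambda>n r. r + y) n = n * y" for n y by (induction n) auto
    then show "(\<lambda>n y. rec_nat 0 (\<lambda>n r. r + y) n) = times" by (simp add: fun_eq_iff)
  qed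
qed

lemma raw1_pred: "raw1 (\<lambda>n. n - 1)"
proof -
  have "raw1 (\<lambda>n. rec_nat 0 (\<lambda>n r. n) n)" by (rule raw1_rec raw2_fst)+
  moreover have "rec_nat 0 (\<lambda>n r. n) n = n - 1" for n by (cases n) auto
  ultimately show ?thesis by simp
qed

lemma raw2_minus: "raw2 (\<lambda>x y. x - y)"
proof -
  from raw1_pred obtain p where p: "\<And>A x xs. computes A p (x # xs) (x - 1)"
    unfolding raw1_def by blast
  have "\<exists>p. \<forall>A n r y xs. computes A p (n # r # y # xs) (r - 1)"
    by (auto intro!: exI[of _ "Comp p [Proj 1]"] computes_Comp1 computes_Proj1
        p[simplified])
  from raw2_rec[OF raw1_id this] have "raw2 (\<lambda>n y. rec_nat y (\<lambda>n r. r - 1) n)" .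
  moreover have "rec_nat y (\<lambda>n r. r - 1) n = y - n" for n y :: nat by (induction n) auto
  ultimately have "raw2 (\<lambda>n y. y - n)" by simp
  from raw2_comp2[OF this raw2_snd raw2_fst] show ?thesis .
qed

lemma raw1_triangle: "raw1 triangle"
proof -
  have "raw1 (\<lambda>n. rec_nat 0 (\<lambda>n r. r + Suc n) n)"
    by (rule raw1_rec raw2_comp2[OF raw2_add] raw2_snd raw2_comp1[OF raw1_Suc] raw2_fst)+
  moreover have "rec_nat 0 (\<lambda>n r. r + Suc n) n = triangle n" for n by (induction n) auto
  ultimately show ?thesis by (simp add: fun_eq_iff[symmetric])
qed

lemma raw2_pair: "raw2 (\<lambda>x y. prod_encode (x, y))"
  unfolding prod_encode_def split
  by (intro raw2_comp2[OF raw2_add] raw2_comp1[OF raw1_triangle] raw2_fst raw2_snd)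

lemma raw1_Least:
  assumes "raw2 f" "\<And>x. \<exists>n. f n x = 0"
  shows "raw1 (\<lambda>x. LEAST n. f n x = 0)"
proof -
  from assms obtain p where p: "\<And>A x y xs. computes A p (x # y # xs) (f x y)"
    unfolding raw2_def by blast
  have "computes A (Minim p) (x # xs) (LEAST n. f n x = 0)" for A x xs
  proof (rule computes.minim)
    show "computes A p ((LEAST n. f n x = 0) # x # xs) 0"
      using p[of A "LEAST n. f n x = 0" x xs] LeastI_ex[OF assms(2)[of x]] by simp
    show "\<exists>r>0. computes A p (m # x # xs) r" if "m < (LEAST n. f n x = 0)" for m
      using p[of A m x xs] not_less_Least[OF that] by blast
  qed
  then show ?thesis unfolding raw1_def by blast
qed

text \<open>\<open>prod_encode (a, b)\<close> is \<open>triangle (a + b) + a\<close>, so decoding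
  amounts to finding the diagonal \<open>a + b\<close>. The condition is written as a truncated
  difference equal to 0, the form in which \<open>raw1_Least\<close> searches.\<close>

definition triangle_root :: "nat \<Rightarrow> nat" where
  "triangle_root z = (LEAST s. Suc z - triangle (Suc s) = 0)"

lemma triangle_root: "triangle (triangle_root z) \<le> z" "z < triangle (Suc (triangle_root z))"
proof -
  have ex: "\<exists>s. Suc z - triangle (Suc s) = 0" by (rule exI[of _ z]) simp
  show "z < triangle (Suc (triangle_root z))"
    using LeastI_ex[OF ex] unfolding triangle_root_def by linarith
  show "triangle (triangle_root z) \<le> z"
  proof (cases "triangle_root z")
    case (Suc s)
    then have "\<not> Suc z - triangle (Suc s) = 0"
      using not_less_Least[of s "\<lambda>s. Suc z - triangle (Suc s) = 0"]
      unfolding triangle_root_def by linarith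
    with Suc show ?thesis by simp
  qed simp
qed

lemma prod_decode_triangle_root:
  "prod_decode z = (z - triangle (triangle_root z), triangle_root z - (z - triangle (triangle_root z)))"
proof -
  have "z - triangle (triangle_root z) \<le> triangle_root z"
    using triangle_root[of z] by simp
  then have "prod_encode (z - triangle (triangle_root z), triangle_root z - (z - triangle (triangle_root z))) = z"
    using triangle_root(1)[of z] by (simp add: prod_encode_def)
  then show ?thesis by (metis prod_encode_inverse)
qed

lemma raw1_triangle_root: "raw1 triangle_root"
proof -
  have "raw2 (\<lambda>s z. Suc z - triangle (Suc s))"
    by (intro raw2_comp2[OF raw2_minus] raw2_comp1[OF raw1_Suc] raw2_comp1[OF raw1_triangle]
        raw2_snd raw2_fst)
  then have "raw1 (\<lambda>z. LEAST s. Suc z - triangle (Suc s) = 0)"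
    by (rule raw1_Least) (metis diff_is_0_eq triangle_root(2) Suc_leI)
  then show ?thesis by (simp add: triangle_root_def[abs_def])
qed

lemma raw1_unpair: "raw1 (\<lambda>z. fst (prod_decode z))" "raw1 (\<lambda>z. snd (prod_decode z))"
  unfolding prod_decode_triangle_root fst_conv snd_conv
  by (intro raw1_comp2[OF raw2_minus] raw1_comp1[OF raw1_triangle] raw1_triangle_root raw1_id)+

text \<open>Codings are bijective, so that a search through all codes is a search through all objects.\<close>

class cenc =
  fixes enc :: "'a \<Rightarrow> nat" and dec :: "nat \<Rightarrow> 'a"
  assumes dec_enc [simp]: "dec (enc x) = x" and enc_dec [simp]: "enc (dec n) = n"
begin

lemma enc_eq_iff [simp]: "enc x = enc y \<longleftrightarrow> x = y"
  by (metis dec_enc)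

end

instantiation nat :: cenc
begin
definition enc_nat :: "nat \<Rightarrow> nat" where [simp]: "enc_nat n = n"
definition dec_nat :: "nat \<Rightarrow> nat" where [simp]: "dec_nat n = n"
instance by standard simp_all
end

instantiation prod :: (cenc, cenc) cenc
begin
definition enc_prod :: "'a \<times> 'b \<Rightarrow> nat" where "enc_prod x = prod_encode (enc (fst x), enc (snd x))"
definition dec_prod :: "nat \<Rightarrow> 'a \<times> 'b" where "dec_prod n = map_prod dec dec (prod_decode n)"
instance
  by standard (auto simp: enc_prod_def dec_prod_def)
end

instantiation list :: (cenc) cenc
begin
definition enc_list :: "'a list \<Rightarrow> nat" where "enc_list xs = list_encode (map enc xs)"
definition dec_list :: "nat \<Rightarrow> 'a list" where "dec_list n = map dec (list_decode n)"
instance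
  by standard (simp_all add: enc_list_def dec_list_def comp_def)
end

section \<open>Computable functions between coded types\<close>

definition computable :: "('a::cenc \<Rightarrow> 'b::cenc) \<Rightarrow> bool" where
  "computable f \<longleftrightarrow> (\<exists>p. \<forall>A x xs. computes A p (enc x # xs) (enc (f x)))"

lemma computable_iff_raw1: "computable f \<longleftrightarrow> raw1 (\<lambda>n. enc (f (dec n)))"
  unfolding computable_def raw1_def by (metis dec_enc enc_dec)

lemma computable_raw1: "raw1 h \<Longrightarrow> (\<And>x. enc (f x) = h (enc x)) \<Longrightarrow> computable f"
  by (simp add: computable_iff_raw1)

lemma computable_id [comp_intros]: "computable (\<lambda>x. x)"
  by (rule computable_raw1[OF raw1_id]) simp

lemma computable_const [comp_intros]: "computable (\<lambda>x. c)"
  by (rule computable_raw1[OF raw1_const]) simp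

lemma computable_comp: "computable f \<Longrightarrow> computable g \<Longrightarrow> computable (\<lambda>x. f (g x))"
  unfolding computable_def by (meson computes_Comp1)

lemma computable_compose1:
  assumes "raw1 h" "computable f" "\<And>x. enc (g x) = h (enc (f x))"
  shows "computable g"
  using raw1_comp1[OF assms(1)] assms(2,3) by (simp add: computable_iff_raw1)

lemma computable_compose2:
  assumes "raw2 h" "computable f" "computable g" "\<And>x. enc (k x) = h (enc (f x)) (enc (g x))"
  shows "computable k"
  using raw1_comp2[OF assms(1)] assms(2-4) by (simp add: computable_iff_raw1)

lemma computable_pair [comp_intros]: "computable f \<Longrightarrow> computable g \<Longrightarrow> computable (\<lambda>x. (f x, g x))"
  by (rule computable_compose2[OF raw2_pair, of f g]) (auto simp: enc_prod_def)

lemma computable_comp2: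
  assumes "computable (\<lambda>z. f (fst z) (snd z))" "computable g" "computable h"
  shows "computable (\<lambda>x. f (g x) (h x))"
  using computable_comp[OF assms(1) computable_pair[OF assms(2,3)]] by simp

lemma computable_fst [comp_intros]: "computable f \<Longrightarrow> computable (\<lambda>x. fst (f x))"
  by (rule computable_compose1[OF raw1_unpair(1)]) (auto simp: enc_prod_def)

lemma computable_snd [comp_intros]: "computable f \<Longrightarrow> computable (\<lambda>x. snd (f x))"
  by (rule computable_compose1[OF raw1_unpair(2)]) (auto simp: enc_prod_def)

lemma computable_enc [comp_intros]: "computable f \<Longrightarrow> computable (\<lambda>x. enc (f x))"
  by (rule computable_compose1[OF raw1_id]) auto

lemma computable_dec [comp_intros]: "computable f \<Longrightarrow> computable (\<lambda>x. dec (f x))"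
  by (rule computable_compose1[OF raw1_id]) auto

lemma computable_Suc [comp_intros]: "computable f \<Longrightarrow> computable (\<lambda>x. Suc (f x))"
  by (rule computable_compose1[OF raw1_Suc]) auto

lemma computable_add [comp_intros]: "computable f \<Longrightarrow> computable g \<Longrightarrow> computable (\<lambda>x. f x + g x :: nat)"
  by (rule computable_compose2[OF raw2_add, of f g]) auto

lemma computable_mult [comp_intros]: "computable f \<Longrightarrow> computable g \<Longrightarrow> computable (\<lambda>x. f x * g x :: nat)"
  by (rule computable_compose2[OF raw2_mult, of f g]) auto

lemma computable_minus [comp_intros]: "computable f \<Longrightarrow> computable g \<Longrightarrow> computable (\<lambda>x. f x - g x :: nat)"
  by (rule computable_compose2[OF raw2_minus, of f g]) auto

lemma computable_prod_encode [comp_intros]: "computable f \<Longrightarrow> computable (\<lambda>x. prod_encode (f x))"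
  by (rule computable_compose1[OF raw1_id]) (auto simp: enc_prod_def)

lemma computable_rec [comp_intros]:
  fixes g :: "'a::cenc \<Rightarrow> 'b::cenc"
  assumes "computable g" "computable (\<lambda>z. h (fst z) (fst (snd z)) (snd (snd z)))" "computable n"
  shows "computable (\<lambda>x. rec_nat (g x) (h x) (n x))"
proof -
  from assms(1) obtain p where p: "\<And>A x xs. computes A p (enc x # xs) (enc (g x))"
    unfolding computable_def by blast
  from assms(2) obtain q where q: "\<And>A z xs. computes A q (enc (z :: 'a \<times> nat \<times> 'b) # xs)
    (enc (h (fst z) (fst (snd z)) (snd (snd z))))"
    unfolding computable_def by blast
  from raw2_pair obtain s where s: "\<And>A x y xs. computes A s (x # y # xs) (prod_encode (x, y))"
    unfolding raw2_def by blast
  from assms(3) obtain r where r: "\<And>A x xs. computes A r (enc x # xs) (n x)"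
    unfolding computable_def by auto
  \<comment> \<open>\<open>PrimRec\<close> calls its step function with counter, previous value and
    parameter, while \<open>q\<close> expects the code of (parameter, counter, value); hence the
    permuted projections.\<close>
  define t where "t = Comp (PrimRec p (Comp q [Comp s [Proj 2, Comp s [Proj 0, Proj 1]]])) [r, Proj 0]"
  have *: "computes A q [prod_encode (enc x, prod_encode (i, enc y))] (enc (h x i y))" for A x i y
    using q[of A "(x, i, y)" "[]"] by (simp add: enc_prod_def)
  have "computes A (PrimRec p (Comp q [Comp s [Proj 2, Comp s [Proj 0, Proj 1]]])) (i # enc x # xs)
     (enc (rec_nat (g x) (h x) i))" for A i x xs
    by (rule computes_PrimRec[where r = "\<lambda>i. enc (rec_nat (g x) (h x) i)"])
      (auto intro!: computes_Comp1 computes_Comp2 s computes_Proj0 computes_Proj1 computes_Proj2 * p)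
  then have "computes A t (enc x # xs) (enc (rec_nat (g x) (h x) (n x)))" for A x xs
    unfolding t_def by (rule computes_Comp2[OF r computes_Proj0])
  then show ?thesis unfolding computable_def by blast
qed

section \<open>Decidable predicates, bounded quantifiers and unbounded search\<close>

definition decidable :: "('a::cenc \<Rightarrow> bool) \<Rightarrow> bool" where
  "decidable P \<longleftrightarrow> computable (\<lambda>x. of_bool (P x) :: nat)"

lemma computable_of_bool [comp_intros]: "decidable P \<Longrightarrow> computable (\<lambda>x. of_bool (P x) :: nat)"
  by (simp add: decidable_def)

lemma decidableI: "computable f \<Longrightarrow> (\<And>x. P x \<longleftrightarrow> f x = (0::nat)) \<Longrightarrow> decidable P"
  unfolding decidable_def by (rule back_subst[of computable, OF computable_minus[OF computable_const[of 1]]]) (auto simp: fun_eq_iff)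

lemma decidable_const [comp_intros]: "decidable (\<lambda>x. c)"
  unfolding decidable_def by (rule computable_const)

lemma decidable_comp: "decidable P \<Longrightarrow> computable g \<Longrightarrow> decidable (\<lambda>x. P (g x))"
  unfolding decidable_def by (rule computable_comp)

lemma decidable_comp2:
  "decidable (\<lambda>z. P (fst z) (snd z)) \<Longrightarrow> computable g \<Longrightarrow> computable h \<Longrightarrow> decidable (\<lambda>x. P (g x) (h x))"
  unfolding decidable_def by (rule computable_comp2)

lemma decidable_not [comp_intros]: "decidable P \<Longrightarrow> decidable (\<lambda>x. \<not> P x)"
  by (rule decidableI[OF computable_of_bool]) auto

lemma decidable_conj [comp_intros]: "decidable P \<Longrightarrow> decidable Q \<Longrightarrow> decidable (\<lambda>x. P x \<and> Q x)"
  by (rule decidableI[OF computable_minus[OF computable_const[of 1] computable_mult[OF computable_of_bool[of P] computable_of_bool[of Q]]]]) auto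

lemma decidable_disj [comp_intros]: "decidable P \<Longrightarrow> decidable Q \<Longrightarrow> decidable (\<lambda>x. P x \<or> Q x)"
  using decidable_not[OF decidable_conj[OF decidable_not decidable_not], of P Q] by simp

lemma decidable_imp [comp_intros]: "decidable P \<Longrightarrow> decidable Q \<Longrightarrow> decidable (\<lambda>x. P x \<longrightarrow> Q x)"
  unfolding imp_conv_disj by (intro decidable_disj decidable_not)

lemma decidable_le [comp_intros]: "computable f \<Longrightarrow> computable g \<Longrightarrow> decidable (\<lambda>x. f x \<le> (g x :: nat))"
  by (rule decidableI[OF computable_minus]) auto

lemma decidable_less [comp_intros]: "computable f \<Longrightarrow> computable g \<Longrightarrow> decidable (\<lambda>x. f x < (g x :: nat))"
  using decidable_not[OF decidable_le, of g f] by (simp add: not_le)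

lemma decidable_eq [comp_intros]:
  assumes "computable f" "computable g" shows "decidable (\<lambda>x. f x = g x)"
proof -
  have "decidable (\<lambda>x. enc (f x) \<le> enc (g x) \<and> enc (g x) \<le> enc (f x))"
    by (intro comp_intros assms)
  then show ?thesis by (simp add: eq_iff[symmetric])
qed

lemma computable_if [comp_intros]:
  assumes "decidable P" "computable f" "computable g"
  shows "computable (\<lambda>x. if P x then f x else g x)"
proof -
  \<comment> \<open>A conditional is a recursion of length 0 or 1.\<close>
  have "computable (\<lambda>x. rec_nat (g x) (\<lambda>_ _. f x) (of_bool (P x)))"
    by (intro comp_intros assms computable_comp[OF assms(2)])
  moreover have "rec_nat (g x) (\<lambda>_ _. f x) (of_bool (P x)) = (if P x then f x else g x)" for x
    by simp
  ultimately show ?thesis by simp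
qed

lemma computable_sum [comp_intros]:
  fixes n :: "'a::cenc \<Rightarrow> nat" and f :: "'a \<Rightarrow> nat \<Rightarrow> nat"
  assumes "computable (\<lambda>z. f (fst z) (snd z))" "computable n"
  shows "computable (\<lambda>x. \<Sum>i<n x. f x i)"
proof -
  have "computable (\<lambda>x. rec_nat 0 (\<lambda>i r. r + f x i) (n x))"
    by (intro comp_intros assms computable_comp2[OF assms(1)])
  moreover have "rec_nat 0 (\<lambda>i r. r + f x i) n = (\<Sum>i<n. f x i)" for n x
    by (induction n) auto
  ultimately show ?thesis by simp
qed

lemma decidable_ball_less [comp_intros]:
  fixes n :: "'a::cenc \<Rightarrow> nat"
  assumes "decidable (\<lambda>z. P (fst z) (snd z))" "computable n"
  shows "decidable (\<lambda>x. \<forall>i<n x. P x i)"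
  by (rule decidableI[of "\<lambda>x. \<Sum>i<n x. of_bool (\<not> P x i)"]) (intro comp_intros assms, auto simp: sum_eq_0_iff)

lemma decidable_bex_less [comp_intros]:
  fixes n :: "'a::cenc \<Rightarrow> nat"
  assumes "decidable (\<lambda>z. P (fst z) (snd z))" "computable n"
  shows "decidable (\<lambda>x. \<exists>i<n x. P x i)"
  using decidable_not[OF decidable_ball_less[OF decidable_not[OF assms(1)] assms(2)]] by simp

lemma decidable_ball_le [comp_intros]:
  fixes n :: "'a::cenc \<Rightarrow> nat"
  assumes "decidable (\<lambda>z. P (fst z) (snd z))" "computable n"
  shows "decidable (\<lambda>x. \<forall>i\<le>n x. P x i)"
  using decidable_ball_less[OF assms(1) computable_Suc[OF assms(2)]] by (simp add: less_Suc_eq_le)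

lemma decidable_bex_le [comp_intros]:
  fixes n :: "'a::cenc \<Rightarrow> nat"
  assumes "decidable (\<lambda>z. P (fst z) (snd z))" "computable n"
  shows "decidable (\<lambda>x. \<exists>i\<le>n x. P x i)"
  using decidable_bex_less[OF assms(1) computable_Suc[OF assms(2)]] by (simp add: less_Suc_eq_le)

lemma computable_card [comp_intros]:
  fixes n :: "'a::cenc \<Rightarrow> nat"
  assumes "decidable (\<lambda>z. P (fst z) (snd z))" "computable n"
  shows "computable (\<lambda>x. card {i. i < n x \<and> P x i})"
proof -
  have "card {i. i < n x \<and> P x i} = (\<Sum>i<n x. of_bool (P x i))" for x
    by (simp add: of_bool_def sum.If_cases Int_def lessThan_def)
  then show ?thesis using computable_sum[OF computable_of_bool[OF assms(1)] assms(2)] by simp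
qed

text \<open>\<open>Minim\<close> puts the search variable first and looks for the value 0; this
  explains the order of the arguments and the negation.\<close>

lemma decidable_search:
  assumes "decidable (\<lambda>z. P (fst z) (snd z))"
  obtains p where "\<And>A n x xs. computes A p (n # enc x # xs) (of_bool (\<not> P x (n :: nat)))"
proof -
  have "computable (\<lambda>z. of_bool (\<not> P (snd z) (fst z)) :: nat)"
    by (intro comp_intros decidable_comp2[OF assms(1)])
  then obtain p where p: "\<And>A z xs. computes A p (enc z # xs) (of_bool (\<not> P (snd z) (fst z)))"
    unfolding computable_def enc_nat_def by metis
  from raw2_pair obtain s where s: "\<And>A x y xs. computes A s (x # y # xs) (prod_encode (x, y))"
    unfolding raw2_def by metis
  have "computes A (Comp p [s]) (n # enc x # xs) (of_bool (\<not> P x n))" for A n x xs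
    by (rule computes_Comp1[OF s]) (use p[of A "(n, x)" "[]"] in \<open>simp add: enc_prod_def\<close>)
  then show ?thesis by (rule that)
qed

lemma computable_Least:
  assumes "decidable (\<lambda>z. P (fst z) (snd z))" "\<And>x. \<exists>n. P x n"
  shows "computable (\<lambda>x. LEAST n::nat. P x n)"
proof -
  obtain p where p: "\<And>A n x xs. computes A p (n # enc x # xs) (of_bool (\<not> P x n))"
    using decidable_search[OF assms(1)] by metis
  have "raw2 (\<lambda>n x. of_bool (\<not> P (dec x) n))"
    unfolding raw2_def by (metis p enc_dec)
  from raw1_Least[OF this] assms(2) have "raw1 (\<lambda>x. LEAST n. P (dec x) n)" by simp
  then show ?thesis by (simp add: computable_iff_raw1)
qed

text \<open>The search applies a total test, so it diverges only for want of a witness; the program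
  is the same for every oracle.\<close>

lemma halts_ex:
  assumes "decidable (\<lambda>z. P (fst z) (snd z))"
  shows "\<exists>p. \<forall>A x. halts A p [enc x] \<longleftrightarrow> (\<exists>n::nat. P x n)"
proof -
  obtain q where q: "\<And>A n x xs. computes A q (n # enc x # xs) (of_bool (\<not> P x n))"
    using decidable_search[OF assms(1)] by metis
  have "halts A (Minim q) [enc x] \<longleftrightarrow> (\<exists>n. P x n)" for A x
  proof
    assume "halts A (Minim q) [enc x]"
    then obtain n where "computes A (Minim q) [enc x] n" unfolding halts_def by blast
    then have "computes A q [n, enc x] 0" by (rule computes_elims(8)) blast
    with q[of A n x "[]"] have "of_bool (\<not> P x n) = (0::nat)"
      using computes_deterministic by blast
    then show "\<exists>n. P x n" by auto
  next
    assume "\<exists>n. P x n"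
    then have "P x (LEAST n. P x n)" by (rule LeastI_ex)
    then have "computes A (Minim q) [enc x] (LEAST n. P x n)"
      using q[of A _ x "[]"] not_less_Least[of _ "P x"]
      by (intro computes.minim) (metis of_bool_eq_0_iff, metis of_bool_eq(2) zero_less_one)
    then show "halts A (Minim q) [enc x]" unfolding halts_def by blast
  qed
  then show ?thesis by blast
qed

lemma computable_power [comp_intros]:
  assumes "computable f" "computable g" shows "computable (\<lambda>x. f x ^ g x :: nat)"
proof -
  have "computable (\<lambda>x. rec_nat 1 (\<lambda>i r. r * f x) (g x))"
    by (intro comp_intros assms computable_comp[OF assms(1)])
  moreover have "rec_nat 1 (\<lambda>i r. r * a) n = a ^ n" for n and a :: nat
    by (induction n) auto
  ultimately show ?thesis by simp
qed

lemma computable_div [comp_intros]: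
  fixes f g :: "'a::cenc \<Rightarrow> nat"
  assumes "computable f" "computable g" shows "computable (\<lambda>x. f x div g x)"
proof -
  \<comment> \<open>The disjunct \<open>g x = 0\<close> keeps the search total, as
    \<open>computable_Least\<close> demands a witness for every argument.\<close>
  have "computable (\<lambda>x. if g x = 0 then 0 else LEAST q. g x = 0 \<or> f x < Suc q * g x)"
  proof (intro comp_intros assms computable_Least computable_comp[OF assms(1)] computable_comp[OF assms(2)])
    show "\<exists>n. g x = 0 \<or> f x < Suc n * g x" for x
      by (rule exI[of _ "f x"]) (auto simp: less_Suc_eq_le trans_le_add1 trans_le_add2
          intro!: le_less_trans[of "f x" "f x * g x"])
  qed
  moreover have "(LEAST q. b = 0 \<or> a < Suc q * b) = a div b" if "b \<noteq> 0" for a b :: nat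
  proof (rule Least_equality)
    show "b = 0 \<or> a < Suc (a div b) * b"
      using that dividend_less_div_times[of b a] by simp
    show "a div b \<le> q" if "b = 0 \<or> a < Suc q * b" for q
      using that \<open>b \<noteq> 0\<close> less_mult_imp_div_less[of a "Suc q" b] by simp
  qed
  ultimately have "computable (\<lambda>x. if g x = 0 then 0 else f x div g x)" by (simp cong: if_cong)
  moreover have "(if b = 0 then 0 else a div b) = a div b" for a b :: nat by simp
  ultimately show ?thesis by simp
qed

lemma computable_mod [comp_intros]:
  fixes f g :: "'a::cenc \<Rightarrow> nat"
  assumes "computable f" "computable g" shows "computable (\<lambda>x. f x mod g x)"
  unfolding modulo_nat_def by (intro comp_intros assms)

subsection \<open>Computable operations on lists\<close>

lemma computable_Cons [comp_intros]: "computable f \<Longrightarrow> computable g \<Longrightarrow> computable (\<lambda>x. f x # g x)"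
  by (rule computable_compose2[OF raw2_comp1[OF raw1_Suc raw2_pair], of f g]) (auto simp: enc_list_def)

text \<open>The default value is the one with code \<open>0\<close>, which is what unpairing the code of the empty
  list produces.\<close>

definition hdd :: "'a::cenc list \<Rightarrow> 'a" where
  "hdd xs = (case xs of [] \<Rightarrow> dec 0 | x # _ \<Rightarrow> x)"

lemma hdd_Cons [simp]: "hdd (x # xs) = x"
  by (simp add: hdd_def)

lemma prod_decode_0: "prod_decode 0 = (0, 0)"
  by (simp add: prod_decode_def prod_decode_aux.simps)

lemma computable_hdd [comp_intros]: "computable f \<Longrightarrow> computable (\<lambda>x. hdd (f x))"
  by (rule computable_compose1[OF raw1_comp1[OF raw1_unpair(1) raw1_pred]])
    (auto simp: enc_list_def hdd_def prod_decode_0 split: list.split)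

lemma computable_tl [comp_intros]: "computable f \<Longrightarrow> computable (\<lambda>x. tl (f x))"
proof (rule computable_compose1[OF raw1_comp1[OF raw1_unpair(2) raw1_pred]])
  fix x show "enc (tl (f x)) = snd (prod_decode (enc (f x) - 1))"
    by (cases "f x") (auto simp: enc_list_def prod_decode_0)
qed

lemma computable_drop [comp_intros]:
  assumes "computable n" "computable f" shows "computable (\<lambda>x. drop (n x) (f x))"
proof -
  have "computable (\<lambda>x. rec_nat (f x) (\<lambda>i r. tl r) (n x))"
    by (intro comp_intros assms)
  moreover have "rec_nat xs (\<lambda>i r. tl r) n = drop n xs" for n and xs :: "'b list"
    by (induction n) (auto simp: drop_Suc tl_drop)
  ultimately show ?thesis by simp
qed

definition nthd :: "'a::cenc list \<Rightarrow> nat \<Rightarrow> 'a" where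
  "nthd xs i = hdd (drop i xs)"

lemma nthd_nth [simp]: "i < length xs \<Longrightarrow> nthd xs i = xs ! i"
  by (simp add: nthd_def hdd_def Cons_nth_drop_Suc[symmetric])

lemma computable_nthd [comp_intros]: "computable f \<Longrightarrow> computable n \<Longrightarrow> computable (\<lambda>x. nthd (f x) (n x))"
  unfolding nthd_def by (intro comp_intros)

lemma computable_length [comp_intros]:
  assumes "computable f" shows "computable (\<lambda>x. length (f x))"
proof -
  have "computable (\<lambda>x. LEAST n. drop n (f x) = [])"
    by (intro computable_Least comp_intros computable_comp[OF assms]) (meson drop_eq_Nil order.refl)
  moreover have "(LEAST n. length xs \<le> n) = length xs" for xs :: "'b list"
    by (rule Least_equality) auto
  ultimately show ?thesis by simp
qed

lemma computable_map_upt [comp_intros]: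
  assumes "computable (\<lambda>z. f (fst z) (snd z))" "computable n"
  shows "computable (\<lambda>x. map (f x) [0..<n x])"
proof -
  \<comment> \<open>The list grows from its end: after \<open>i\<close> steps it covers the last
    \<open>i\<close> indices, and the next one is \<open>n x - Suc i\<close>.\<close>
  have "computable (\<lambda>x. rec_nat [] (\<lambda>i r. f x (n x - Suc i) # r) (n x))"
    by (intro comp_intros assms computable_comp[OF assms(2)] computable_comp2[OF assms(1)])
  moreover have "rec_nat [] (\<lambda>i r. f x (n - Suc i) # r) m = map (f x) [n - m..<n]" if "m \<le> n" for m n x
    using that
  proof (induction m)
    case (Suc m)
    then have "[n - Suc m..<n] = (n - Suc m) # [n - m..<n]"
      by (subst upt_conv_Cons) (auto simp: Suc_diff_Suc)
    with Suc show ?case by simp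
  qed simp
  ultimately show ?thesis by simp
qed

subsection \<open>Initial segments as numbers\<close>

text \<open>With \<open>X i\<close> as bit \<open>i\<close>, truncating a prefix and deleting its
  beginning become \<open>take_bit\<close> and \<open>drop_bit\<close>, which are computable by
  division.\<close>

definition seg :: "cantor \<Rightarrow> nat \<Rightarrow> nat" where
  "seg X n = horner_sum of_bool 2 (map X [0..<n])"

lemma bit_seg [simp]: "bit (seg X n) i \<longleftrightarrow> i < n \<and> X i"
  by (auto simp: seg_def bit_horner_sum_bit_iff)

lemma take_bit_seg [simp]: "take_bit k (seg X n) = seg X (min k n)"
  by (rule bit_eqI) (auto simp: bit_take_bit_iff)

lemma seg_bit [simp]: "seg (bit x) n = take_bit n x"
  by (rule bit_eqI) (auto simp: bit_take_bit_iff)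

lemma seg_less: "seg X n < 2 ^ n"
  using take_bit_seg[of n X n] by (metis min.idem take_bit_nat_less_exp)

lemma seg_eq_iff: "seg X n = seg Y n \<longleftrightarrow> (\<forall>i<n. X i = Y i)"
  by (auto simp: bit_eq_iff)

lemma seg_empty [simp]: "seg empty_oracle n = 0"
  by (rule bit_eqI) auto

lemma seg_eq_mono: "seg X n = seg Y n \<Longrightarrow> m \<le> n \<Longrightarrow> seg X m = seg Y m"
  by (auto simp: seg_eq_iff)

definition shift :: "nat \<Rightarrow> cantor \<Rightarrow> cantor" where
  "shift l X = (\<lambda>i. X (i + l))"

lemma seg_shift: "seg (shift l X) n = drop_bit l (seg X (n + l))"
  by (rule bit_eqI) (auto simp: bit_drop_bit_eq shift_def add.commute)

text \<open>\<open>comb_seq l Z X\<close> is the first \<open>l\<close> bits of \<open>Z\<close>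
  followed by \<open>X\<close>. The two summands share no bit, so the addition has no
  carries.\<close>

lemma seg_comb_seq: "seg (comb_seq l Z X) n = take_bit n (seg Z l + 2 ^ l * seg X n)"
proof -
  have "seg Z l + 2 ^ l * seg X n = semiring_bit_operations_class.or (seg Z l) (push_bit l (seg X n))"
  proof -
    have "seg Z l + push_bit l (seg X n) = semiring_bit_operations_class.or (seg Z l) (push_bit l (seg X n))"
      by (rule disjunctive_add_eq_or) (auto intro!: bit_eqI simp: bit_and_iff bit_push_bit_iff)
    then show ?thesis by (simp add: push_bit_eq_mult mult.commute)
  qed
  then show ?thesis
    by (auto intro!: bit_eqI simp: bit_take_bit_iff bit_or_iff bit_push_bit_iff comb_seq_def
        split: if_splits)
qed

lemma comb_seq_shift: "seg Z l = seg X l \<Longrightarrow> comb_seq l Z (shift l X) = X"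
  by (auto simp: comb_seq_def shift_def seg_eq_iff fun_eq_iff)

lemma shift_comb_seq [simp]: "shift l (comb_seq l Z X) = X"
  by (auto simp: comb_seq_def shift_def fun_eq_iff)

lemma seg_comb_seq_le: "k \<le> l \<Longrightarrow> seg (comb_seq l Z X) k = seg Z k"
  by (auto simp: comb_seq_def seg_eq_iff)

lemma shift_shift: "shift k (shift l X) = shift (k + l) X"
  by (auto simp: shift_def ac_simps)

lemma shift_0 [simp]: "shift 0 X = X"
  by (auto simp: shift_def)

lemma decidable_bit [comp_intros]: "computable f \<Longrightarrow> computable g \<Longrightarrow> decidable (\<lambda>x. bit (f x :: nat) (g x))"
  unfolding bit_iff_odd odd_iff_mod_2_eq_one by (intro comp_intros)

lemma computable_take_bit [comp_intros]: "computable f \<Longrightarrow> computable g \<Longrightarrow> computable (\<lambda>x. take_bit (f x) (g x) :: nat)"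
  unfolding take_bit_eq_mod by (intro comp_intros)

lemma computable_drop_bit [comp_intros]: "computable f \<Longrightarrow> computable g \<Longrightarrow> computable (\<lambda>x. drop_bit (f x) (g x) :: nat)"
  unfolding drop_bit_eq_div by (intro comp_intros)

subsection \<open>Effectively open predicates\<close>

text \<open>
  The sequence and the oracle enter only through initial segments of a common length \<open>n\<close>, so \<open>R\<close>
  itself is decidable without an oracle.  The length is an argument of its own because
  \<open>seg\<close> forgets it.
\<close>

definition sigma1 :: "cantor \<Rightarrow> (cantor \<Rightarrow> 'e::cenc \<Rightarrow> bool) \<Rightarrow> bool" where
  "sigma1 A P \<longleftrightarrow> (\<exists>R. decidable R \<and> (\<forall>X e. P X e \<longleftrightarrow> (\<exists>n. R (e, n, seg X n, seg A n))))"

named_theorems sigma1_intros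

text \<open>The witness may be any coded object and may determine how much of the sequence and
  oracle is read. A single length \<open>n\<close> absorbs both: it only has to exceed the code of
  \<open>w\<close> and reach \<open>h (e, w)\<close>.\<close>

lemma sigma1_gen:
  fixes D :: "'e::cenc \<times> 'w::cenc \<times> nat \<times> nat \<Rightarrow> bool" and h :: "'e \<times> 'w \<Rightarrow> nat"
  assumes D: "decidable D" and h: "computable h"
    and P: "\<And>X e. P X e \<longleftrightarrow> (\<exists>w. D (e, w, seg X (h (e, w)), seg A (h (e, w))))"
  shows "sigma1 A P"
proof -
  define R where "R z = (\<exists>d<fst (snd z). h (fst z, dec d) \<le> fst (snd z) \<and>
      D (fst z, dec d, take_bit (h (fst z, dec d)) (fst (snd (snd z))),
        take_bit (h (fst z, dec d)) (snd (snd (snd z)))))" for z :: "'e \<times> nat \<times> nat \<times> nat"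
  have "decidable R"
    unfolding R_def by (intro comp_intros decidable_comp[OF D] computable_comp[OF h])
  moreover have "P X e \<longleftrightarrow> (\<exists>n. R (e, n, seg X n, seg A n))" for X e
  proof
    assume "P X e"
    then obtain w where w: "D (e, w, seg X (h (e, w)), seg A (h (e, w)))" using P by auto
    then have "R (e, n, seg X n, seg A n)" if "n = max (Suc (enc w)) (h (e, w))" for n
      unfolding R_def using that by (auto intro!: exI[of _ "enc w"] simp: min_def)
    then show "\<exists>n. R (e, n, seg X n, seg A n)" by blast
  qed (auto simp: R_def P min_def)
  ultimately show ?thesis unfolding sigma1_def by blast
qed

text \<open>Evidence found on a prefix stays valid on longer ones, so that several witnesses can be
  replaced by one common length.\<close>

definition upward :: "('e \<times> nat \<times> nat \<times> nat \<Rightarrow> bool) \<Rightarrow> bool" where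
  "upward R \<longleftrightarrow> (\<forall>e m n x a. m \<le> n \<longrightarrow> R (e, m, take_bit m x, take_bit m a) \<longrightarrow> R (e, n, x, a))"

lemma upwardD: "upward R \<Longrightarrow> R (e, m, take_bit m x, take_bit m a) \<Longrightarrow> m \<le> n \<Longrightarrow> R (e, n, x, a)"
  unfolding upward_def by blast

lemma upward_seg: "upward R \<Longrightarrow> R (e, m, seg X m, seg A m) \<Longrightarrow> m \<le> n \<Longrightarrow> R (e, n, seg X n, seg A n)"
  by (rule upwardD[of R e m]) (simp_all add: min_def)

lemma sigma1_mono:
  fixes P :: "cantor \<Rightarrow> 'e::cenc \<Rightarrow> bool"
  assumes "sigma1 A P"
  obtains R where "decidable R" "\<And>X e. P X e \<longleftrightarrow> (\<exists>n. R (e, n, seg X n, seg A n))"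
    "upward R"
proof -
  from assms obtain R where R: "decidable R" "\<And>X e. P X e \<longleftrightarrow> (\<exists>n. R (e, n, seg X n, seg A n))"
    unfolding sigma1_def by blast
  define R' where "R' z = (\<exists>m\<le>fst (snd z). R (fst z, m, take_bit m (fst (snd (snd z))),
      take_bit m (snd (snd (snd z)))))" for z :: "'e \<times> nat \<times> nat \<times> nat"
  show ?thesis
  proof
    show "decidable R'"
      unfolding R'_def by (intro comp_intros decidable_comp[OF R(1)])
    show "P X e \<longleftrightarrow> (\<exists>n. R' (e, n, seg X n, seg A n))" for X e
      unfolding R(2) R'_def by (auto simp: min_def)
    show "upward R'"
      unfolding upward_def
    proof (intro allI impI)
      fix e m n x a assume "m \<le> n" "R' (e, m, take_bit m x, take_bit m a)"
      then show "R' (e, n, x, a)"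
        unfolding R'_def by (auto simp: min_def intro: order_trans)
    qed
  qed
qed

lemma sigma1_conj [sigma1_intros]:
  assumes "sigma1 A P" "sigma1 A Q" shows "sigma1 A (\<lambda>X e. P X e \<and> Q X e)"
proof -
  obtain R where R: "decidable R" "\<And>X e. P X e \<longleftrightarrow> (\<exists>n. R (e, n, seg X n, seg A n))"
    "upward R"
    using sigma1_mono[OF assms(1)] by metis
  obtain S where S: "decidable S" "\<And>X e. Q X e \<longleftrightarrow> (\<exists>n. S (e, n, seg X n, seg A n))"
    "upward S"
    using sigma1_mono[OF assms(2)] by metis
  have "decidable (\<lambda>z. R z \<and> S z)" by (intro comp_intros R(1) S(1))
  moreover have "P X e \<and> Q X e \<longleftrightarrow> (\<exists>n. R (e, n, seg X n, seg A n) \<and> S (e, n, seg X n, seg A n))" for X e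
    unfolding R(2) S(2)
    using upward_seg[OF R(3)] upward_seg[OF S(3)] by (meson nat_le_linear)
  ultimately show ?thesis unfolding sigma1_def by blast
qed

lemma sigma1_disj [sigma1_intros]:
  assumes "sigma1 A P" "sigma1 A Q" shows "sigma1 A (\<lambda>X e. P X e \<or> Q X e)"
proof -
  obtain R where R: "decidable R" "\<And>X e. P X e \<longleftrightarrow> (\<exists>n. R (e, n, seg X n, seg A n))"
    using assms(1) unfolding sigma1_def by blast
  obtain S where S: "decidable S" "\<And>X e. Q X e \<longleftrightarrow> (\<exists>n. S (e, n, seg X n, seg A n))"
    using assms(2) unfolding sigma1_def by blast
  have "decidable (\<lambda>z. R z \<or> S z)" by (intro comp_intros R(1) S(1))
  moreover have "P X e \<or> Q X e \<longleftrightarrow> (\<exists>n. R (e, n, seg X n, seg A n) \<or> S (e, n, seg X n, seg A n))" for X e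
    unfolding R(2) S(2) by blast
  ultimately show ?thesis unfolding sigma1_def by blast
qed

lemma sigma1_ex [sigma1_intros]:
  fixes P :: "cantor \<Rightarrow> 'e::cenc \<Rightarrow> 'w::cenc \<Rightarrow> bool"
  assumes "sigma1 A (\<lambda>X z. P X (fst z) (snd z))" shows "sigma1 A (\<lambda>X e. \<exists>w. P X e w)"
proof -
  obtain R where R: "decidable R" "\<And>X z. P X (fst z) (snd z) \<longleftrightarrow> (\<exists>n. R (z, n, seg X n, seg A n))"
    using assms unfolding sigma1_def by blast
  have R2: "P X e w \<longleftrightarrow> (\<exists>n. R ((e, w), n, seg X n, seg A n))" for X e w
    using R(2)[of X "(e, w)"] by simp
  show ?thesis
  proof (rule sigma1_gen)
    show "decidable (\<lambda>z. R ((fst z, fst (fst (snd z))), snd (fst (snd z)), snd (snd z)))"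
      by (intro comp_intros decidable_comp[OF R(1)])
    show "computable (\<lambda>z :: 'e \<times> 'w \<times> nat. snd (snd z))" by (intro comp_intros)
  qed (simp add: R2)
qed

lemma sigma1_ball_less [sigma1_intros]:
  fixes P :: "cantor \<Rightarrow> 'e::cenc \<Rightarrow> nat \<Rightarrow> bool"
  assumes "sigma1 A (\<lambda>X z. P X (fst z) (snd z))" "computable b"
  shows "sigma1 A (\<lambda>X e. \<forall>i<b e. P X e i)"
proof -
  obtain R where R: "decidable R" "\<And>X z. P X (fst z) (snd z) \<longleftrightarrow> (\<exists>n. R (z, n, seg X n, seg A n))"
    "upward R"
    using sigma1_mono[OF assms(1)] by metis
  have "decidable (\<lambda>z. \<forall>i<b (fst z). R ((fst z, i), snd z))"
    by (intro comp_intros decidable_comp[OF R(1)] computable_comp[OF assms(2)])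
  moreover have "(\<forall>i<b e. P X e i) \<longleftrightarrow> (\<exists>n. \<forall>i<b e. R ((e, i), n, seg X n, seg A n))" for X e
  proof
    assume "\<forall>i<b e. P X e i"
    then have "\<forall>i<b e. \<exists>n. R ((e, i), n, seg X n, seg A n)" using R(2)[of X "(e, i)" for i] by auto
    then obtain f where f: "\<And>i. i < b e \<Longrightarrow> R ((e, i), f i, seg X (f i), seg A (f i))" by metis
    have "\<forall>i<b e. R ((e, i), n, seg X n, seg A n)" if "n = (\<Sum>i<b e. f i)" for n
    proof (intro allI impI)
      fix i assume "i < b e"
      then have "f i \<le> n" unfolding that by (intro member_le_sum) auto
      then show "R ((e, i), n, seg X n, seg A n)"
        using upward_seg[OF R(3) f[OF \<open>i < b e\<close>]] by blast
    qed
    then show "\<exists>n. \<forall>i<b e. R ((e, i), n, seg X n, seg A n)" by blast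
  qed (use R(2)[of X "(e, i)" for i] in auto)
  ultimately show ?thesis unfolding sigma1_def by (intro exI[of _ "\<lambda>z. \<forall>i<b (fst z). R ((fst z, i), snd z)"]) simp
qed

lemma sigma1_ball_le [sigma1_intros]:
  fixes P :: "cantor \<Rightarrow> 'e::cenc \<Rightarrow> nat \<Rightarrow> bool"
  assumes "sigma1 A (\<lambda>X z. P X (fst z) (snd z))" "computable b"
  shows "sigma1 A (\<lambda>X e. \<forall>i\<le>b e. P X e i)"
  using sigma1_ball_less[OF assms(1) computable_Suc[OF assms(2)]] by (simp add: less_Suc_eq_le)

text \<open>The parameter itself may be computed from prefixes. Evidence is sought only at lengths
  \<open>w + h e\<close>, which is harmless for an upward matrix and makes these prefixes
  available.\<close>

lemma sigma1_subst:
  assumes P: "sigma1 A P" and h: "computable h" and g: "computable g"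
  shows "sigma1 A (\<lambda>X e. P X (g (e, seg X (h e), seg A (h e))))"
proof -
  obtain R where R: "decidable R" "\<And>X z. P X z \<longleftrightarrow> (\<exists>n. R (z, n, seg X n, seg A n))"
    "upward R"
    using sigma1_mono[OF P] by metis
  have R2: "P X z \<longleftrightarrow> (\<exists>w. R (z, w + k, seg X (w + k), seg A (w + k)))" for X z k
    unfolding R(2) using upward_seg[OF R(3), of z _ X A] by (meson le_add1)
  show ?thesis
  proof (rule sigma1_gen)
    show "decidable (\<lambda>z. R (g (fst z, take_bit (h (fst z)) (fst (snd (snd z))),
        take_bit (h (fst z)) (snd (snd (snd z)))), fst (snd z) + h (fst z), snd (snd z)))"
      by (intro comp_intros decidable_comp[OF R(1)] computable_comp[OF h] computable_comp[OF g])
    show "computable (\<lambda>z. snd z + h (fst z))" by (intro comp_intros computable_comp[OF h])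
  qed (subst R2, simp add: min_def)
qed

lemma sigma1_comp: "sigma1 A P \<Longrightarrow> computable g \<Longrightarrow> sigma1 A (\<lambda>X e. P X (g e))"
  using sigma1_subst[of A P "\<lambda>_. 0" "\<lambda>z. g (fst z)"] by (simp add: computable_const computable_comp computable_fst computable_id)

lemma sigma1_comp2:
  "sigma1 A (\<lambda>X z. P X (fst z) (snd z)) \<Longrightarrow> computable g \<Longrightarrow> computable h \<Longrightarrow> sigma1 A (\<lambda>X e. P X (g e) (h e))"
  using sigma1_comp[of A "\<lambda>X z. P X (fst z) (snd z)" "\<lambda>x. (g x, h x)"] by (simp add: computable_pair)

lemma sigma1_decp [sigma1_intros]: "decidable D \<Longrightarrow> sigma1 A (\<lambda>X e. D e)"
  unfolding sigma1_def
  by (intro exI[of _ "\<lambda>z. D (fst z)"]) (auto intro!: decidable_comp[of D] comp_intros)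

lemma sigma1_seg:
  assumes "decidable D" "computable h" shows "sigma1 A (\<lambda>X e. D (e, seg X (h e), seg A (h e)))"
  using sigma1_subst[OF sigma1_decp[OF assms(1)] assms(2) computable_id] .

lemma sigma1_bit:
  assumes "computable t" shows "sigma1 A (\<lambda>X e. X (t e))"
proof -
  have "sigma1 A (\<lambda>X e. (\<lambda>z. bit (fst (snd z)) (t (fst z))) (e, seg X (Suc (t e)), seg A (Suc (t e))))"
    by (rule sigma1_seg) (intro comp_intros assms computable_comp[OF assms])+
  then show ?thesis by simp
qed

lemma sigma1_seg_eq [sigma1_intros]:
  assumes "computable f" "computable g" shows "sigma1 A (\<lambda>X e. seg X (f e) = g e)"
proof -
  have "sigma1 A (\<lambda>X e. (\<lambda>z. fst (snd z) = g (fst z)) (e, seg X (f e), seg A (f e)))"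
    by (rule sigma1_seg) (intro comp_intros assms computable_comp[OF assms(2)])+
  then show ?thesis by simp
qed

lemma sigma1_shift:
  assumes P: "sigma1 A P" and l: "computable l"
  shows "sigma1 A (\<lambda>X e. P (shift (l e) X) e)"
proof -
  obtain R where R: "decidable R" "\<And>X z. P X z \<longleftrightarrow> (\<exists>n. R (z, n, seg X n, seg A n))"
    using P unfolding sigma1_def by blast
  show ?thesis
  proof (rule sigma1_gen)
    show "decidable (\<lambda>z. R (fst z, fst (snd z), drop_bit (l (fst z)) (fst (snd (snd z))),
        take_bit (fst (snd z)) (snd (snd (snd z)))))"
      by (intro comp_intros decidable_comp[OF R(1)] computable_comp[OF l])
    show "computable (\<lambda>z. snd z + l (fst z))" by (intro comp_intros computable_comp[OF l])
  qed (simp add: R(2) seg_shift min_def)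
qed

lemma sigma1_comb_seq:
  fixes r :: "'e::cenc \<Rightarrow> nat"
  assumes P: "sigma1 A P" and l: "computable l" and r: "computable r"
  shows "sigma1 A (\<lambda>X e. P (comb_seq (l e) (bit (r e)) X) e)"
proof -
  obtain R where R: "decidable R" "\<And>X z. P X z \<longleftrightarrow> (\<exists>n. R (z, n, seg X n, seg A n))"
    using P unfolding sigma1_def by blast
  show ?thesis
  proof (rule sigma1_gen)
    show "decidable (\<lambda>z. R (fst z, fst (snd z), take_bit (fst (snd z)) (take_bit (l (fst z)) (r (fst z))
         + 2 ^ l (fst z) * fst (snd (snd z))), snd (snd (snd z))))"
      by (intro comp_intros decidable_comp[OF R(1)] computable_comp[OF l] computable_comp[OF r])
    show "computable (\<lambda>z. snd z)" by (intro comp_intros)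
  qed (simp add: R(2) seg_comb_seq)
qed

text \<open>All prefixes of the empty oracle are 0, so the constant 0 can be supplied in place of
  the prefix of \<open>A\<close>.\<close>

lemma sigma1_relativize:
  assumes "sigma1 empty_oracle P" shows "sigma1 A P"
proof -
  from assms obtain R where R: "decidable R" "\<forall>X z. P X z \<longleftrightarrow> (\<exists>n. R (z, n, seg X n, 0 :: nat))"
    unfolding sigma1_def seg_empty by blast
  show ?thesis
    unfolding sigma1_def
    by (rule exI[of _ "\<lambda>z. R (fst z, fst (snd z), fst (snd (snd z)), 0)"], intro conjI)
      (intro comp_intros decidable_comp[OF R(1)], simp add: R(2))
qed

lemma sigma1_halts:
  assumes "sigma1 empty_oracle (\<lambda>X e. P e)"
  obtains p where "\<And>e. halts empty_oracle p [enc e] \<longleftrightarrow> P e"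
proof -
  from assms obtain R where R: "decidable R" "\<forall>X z. P z \<longleftrightarrow> (\<exists>n. R (z, n, seg X n, 0 :: nat))"
    unfolding sigma1_def seg_empty by blast
  have "decidable (\<lambda>z. R (fst z, snd z, 0, 0))"
    by (intro comp_intros decidable_comp[OF R(1)])
  from halts_ex[of "\<lambda>x n. R (x, n, 0, 0)", simplified, OF this] obtain p
    where "\<And>A x. halts A p [enc x] \<longleftrightarrow> (\<exists>n. R (x, n, 0, 0))" by blast
  then show ?thesis using that[of p] R(2)[rule_format, of _ empty_oracle] by simp
qed

subsection \<open>Derivations and the enumeration of programs\<close>

fun pcode :: "prog \<Rightarrow> nat" where
  "pcode Zero = enc (0::nat, 0::nat)"
| "pcode Succ = enc (1::nat, 0::nat)"
| "pcode Orac = enc (2::nat, 0::nat)"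
| "pcode (Proj i) = enc (3::nat, i)"
| "pcode (Comp f gs) = enc (4::nat, pcode f, map pcode gs)"
| "pcode (PrimRec f g) = enc (5::nat, pcode f, pcode g)"
| "pcode (Minim f) = enc (6::nat, pcode f)"

text \<open>
  A claim \<open>(c, xs, y)\<close> states that the program with code \<open>c\<close> maps \<open>xs\<close> to \<open>y\<close>; \<open>step n a S c\<close> means that
  \<open>c\<close> follows from the claims in \<open>S\<close> by one rule of \<open>computes\<close>, with an oracle that
  is known, as the number \<open>a\<close>, only below \<open>n\<close>.
\<close>

type_synonym claim = "nat \<times> nat list \<times> nat"

definition step :: "nat \<Rightarrow> nat \<Rightarrow> claim set \<Rightarrow> claim \<Rightarrow> bool" where
  "step n a S c \<longleftrightarrow>
    (fst (dec (fst c) :: nat \<times> nat) = 0 \<and> snd (snd c) = 0) \<or>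
    (fst (dec (fst c) :: nat \<times> nat) = 1 \<and> fst (snd c) \<noteq> [] \<and> snd (snd c) = Suc (hdd (fst (snd c)))) \<or>
    (fst (dec (fst c) :: nat \<times> nat) = 2 \<and> fst (snd c) \<noteq> [] \<and> hdd (fst (snd c)) < n \<and>
      snd (snd c) = of_bool (bit a (hdd (fst (snd c))))) \<or>
    (fst (dec (fst c) :: nat \<times> nat) = 3 \<and> snd (dec (fst c) :: nat \<times> nat) < length (fst (snd c)) \<and>
      snd (snd c) = nthd (fst (snd c)) (snd (dec (fst c) :: nat \<times> nat))) \<or>
    (fst (dec (fst c) :: nat \<times> nat) = 4 \<and> (\<exists>u\<in>S.
      fst u = fst (snd (dec (fst c) :: nat \<times> nat \<times> nat list)) \<and> snd (snd u) = snd (snd c) \<and>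
      length (fst (snd u)) = length (snd (snd (dec (fst c) :: nat \<times> nat \<times> nat list))) \<and>
      (\<forall>k<length (fst (snd u)). (nthd (snd (snd (dec (fst c) :: nat \<times> nat \<times> nat list))) k,
        fst (snd c), nthd (fst (snd u)) k) \<in> S))) \<or>
    (fst (dec (fst c) :: nat \<times> nat) = 5 \<and> fst (snd c) \<noteq> [] \<and> hdd (fst (snd c)) = 0 \<and>
      (fst (snd (dec (fst c) :: nat \<times> nat \<times> nat)), tl (fst (snd c)), snd (snd c)) \<in> S) \<or>
    (fst (dec (fst c) :: nat \<times> nat) = 5 \<and> fst (snd c) \<noteq> [] \<and> hdd (fst (snd c)) \<noteq> 0 \<and> (\<exists>u\<in>S.
      fst u = fst c \<and> fst (snd u) = (hdd (fst (snd c)) - 1) # tl (fst (snd c)) \<and>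
      (snd (snd (dec (fst c) :: nat \<times> nat \<times> nat)),
        (hdd (fst (snd c)) - 1) # snd (snd u) # tl (fst (snd c)), snd (snd c)) \<in> S)) \<or>
    (fst (dec (fst c) :: nat \<times> nat) = 6 \<and>
      (snd (dec (fst c) :: nat \<times> nat), snd (snd c) # fst (snd c), 0) \<in> S \<and>
      (\<forall>m<snd (snd c). \<exists>u\<in>S. fst u = snd (dec (fst c) :: nat \<times> nat) \<and>
        fst (snd u) = m # fst (snd c) \<and> 0 < snd (snd u)))"

text \<open>A finite proof that is checked by a decidable condition; searching for one takes the
  place of a universal program.\<close>

definition derivation :: "nat \<Rightarrow> nat \<Rightarrow> claim list \<Rightarrow> bool" where
  "derivation n a D \<longleftrightarrow> (\<forall>i<length D. step n a (nthd D ` {..<i}) (nthd D i))"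

lemma decidable_mem_nthd [comp_intros]:
  fixes i :: "'a::cenc \<Rightarrow> nat"
  assumes "computable f" "computable D" "computable i"
  shows "decidable (\<lambda>x. f x \<in> nthd (D x) ` {..<i x})"
proof -
  have "decidable (\<lambda>x. \<exists>j<i x. f x = nthd (D x) j)"
    by (intro comp_intros assms assms[THEN computable_comp])
  then show ?thesis by (simp add: image_iff Bex_def)
qed

lemma decidable_bex_nthd [comp_intros]:
  fixes i :: "'a::cenc \<Rightarrow> nat"
  assumes "decidable (\<lambda>z. P (fst z) (snd z))" "computable D" "computable i"
  shows "decidable (\<lambda>x. \<exists>u\<in>nthd (D x) ` {..<i x}. P x u)"
proof -
  have "decidable (\<lambda>x. \<exists>j<i x. P x (nthd (D x) j))"
    by (intro comp_intros assms assms(2,3)[THEN computable_comp] decidable_comp2[OF assms(1)])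
  then show ?thesis by (simp add: Bex_def)
qed

lemma decidable_derivation [comp_intros]:
  assumes [comp_intros]: "computable n" "computable a" "computable D"
  shows "decidable (\<lambda>x. derivation (n x) (a x) (D x))"
proof -
  have "decidable (\<lambda>z :: nat \<times> nat \<times> claim list. derivation (fst z) (fst (snd z)) (snd (snd z)))"
    unfolding derivation_def step_def by (intro comp_intros)
  then have "decidable (\<lambda>x. (\<lambda>z :: nat \<times> nat \<times> claim list. derivation (fst z) (fst (snd z)) (snd (snd z))) (n x, a x, D x))"
    by (rule decidable_comp) (intro comp_intros)
  then show ?thesis by simp
qed

text \<open>Vacuous for numbers that code no program, about which \<open>step\<close> may derive
  claims as well.\<close>

definition sound :: "cantor \<Rightarrow> claim \<Rightarrow> bool" where
  "sound A c \<longleftrightarrow> (\<forall>p. pcode p = fst c \<longrightarrow> computes A p (fst (snd c)) (snd (snd c)))"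

lemma fst_dec_enc: "fst (dec (enc (t, r)) :: nat \<times> nat) = t" for t :: nat and r :: "'a::cenc"
  by (simp add: enc_prod_def dec_prod_def)

lemma step_sound:
  assumes "step n (seg A n) S c" "\<And>u. u \<in> S \<Longrightarrow> sound A u"
  shows "sound A c"
  unfolding sound_def
proof (intro allI impI)
  fix p assume p: "pcode p = fst c"
  obtain c0 xs y where c: "c = (c0, xs, y)" by (cases c)
  have S: "computes A q zs z" if "(pcode q, zs, z) \<in> S" for q zs z
    using assms(2)[OF that] by (simp add: sound_def)
  have "computes A p xs y"
  proof (cases p)
    case Zero
    with assms(1) c p show ?thesis by (auto simp: step_def intro: computes.intros simp flip: p)
  next
    case Succ
    with assms(1) c p show ?thesis
      by (cases xs) (auto simp: step_def intro: computes.intros simp flip: p)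
  next
    case Orac
    with assms(1) c p show ?thesis
      using computes.orac[of A "hd xs" "tl xs"]
      by (cases xs) (auto simp: step_def simp flip: p split: if_splits)
  next
    case (Proj i)
    with assms(1) c p show ?thesis
      by (auto simp: step_def intro: computes.intros simp flip: p)
  next
    case (Comp f gs)
    with assms(1) c p obtain zs where zs: "(pcode f, zs, y) \<in> S" "length zs = length gs"
      "\<And>k. k < length zs \<Longrightarrow> (nthd (map pcode gs) k, xs, nthd zs k) \<in> S"
      by (auto simp: step_def fst_dec_enc simp flip: p)
    have "list_all2 (\<lambda>g z. computes A g xs z) gs zs"
      using zs(2,3) S by (auto simp: list_all2_conv_all_nth)
    then show ?thesis using Comp S[OF zs(1)] computes.comp by blast
  next
    case (PrimRec f g)
    with assms(1) c p have nn: "xs \<noteq> []" by (auto simp: step_def fst_dec_enc simp flip: p)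
    then obtain x xs' where xs: "xs = x # xs'" by (cases xs) auto
    show ?thesis
    proof (cases x)
      case 0
      with assms(1) c p PrimRec xs have "(pcode f, xs', y) \<in> S"
        by (auto simp: step_def fst_dec_enc simp flip: p)
      then have "computes A f xs' y" by (rule S)
      then show ?thesis unfolding PrimRec 0 xs by (rule computes.primrec_0)
    next
      case (Suc m)
      with assms(1) c p PrimRec xs obtain r where
        "(pcode p, m # xs', r) \<in> S" "(pcode g, m # r # xs', y) \<in> S"
        by (auto simp: step_def fst_dec_enc simp flip: p)
      then have "computes A p (m # xs') r" "computes A g (m # r # xs') y" using S by blast+
      then show ?thesis unfolding PrimRec Suc xs by (rule computes.primrec_Suc)
    qed
  next
    case (Minim f)
    with assms(1) c p have "step n (seg A n) S (enc (6::nat, pcode f), xs, y)" by simp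
    then have *: "(pcode f, y # xs, 0) \<in> S"
      "\<forall>m<y. \<exists>u\<in>S. fst u = pcode f \<and> fst (snd u) = m # xs \<and> 0 < snd (snd u)"
      by (simp_all add: step_def)
    show ?thesis
      unfolding Minim
    proof (rule computes.minim[OF S[OF *(1)]])
      fix m assume "m < y"
      with *(2) obtain u where u: "u \<in> S" "fst u = pcode f" "fst (snd u) = m # xs" "0 < snd (snd u)"
        by blast
      then have "(pcode f, m # xs, snd (snd u)) \<in> S" by (metis prod.collapse)
      with S u(4) show "\<exists>r>0. computes A f (m # xs) r" by blast
    qed
  qed
  then show "computes A p (fst (snd c)) (snd (snd c))" using c by simp
qed

lemma derivation_sound:
  assumes "derivation n (seg A n) D" "c \<in> set D"
  shows "sound A c"
proof -
  have "i < length D \<Longrightarrow> sound A (nthd D i)" for i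
  proof (induction i rule: less_induct)
    case (less i)
    from assms(1) less.prems have "step n (seg A n) (nthd D ` {..<i}) (nthd D i)"
      by (simp add: derivation_def)
    then show ?case by (rule step_sound) (use less in auto)
  qed
  with assms(2) show ?thesis by (metis in_set_conv_nth nthd_nth)
qed

text \<open>Premises occur only positively in each rule, and the oracle only through positions below
  \<open>n\<close>; so derivations can be joined and lengthened.\<close>

lemma step_mono:
  assumes "step n (seg A n) S c" "S \<subseteq> T" "n \<le> m" "c' = c"
  shows "step m (seg A m) T c'"
proof -
  have ST: "u \<in> S \<longrightarrow> u \<in> T" for u using assms(2) by blast
  have "step n (seg A n) S c \<longrightarrow> step n (seg A n) T c"
    unfolding step_def Bex_def
    by ((rule imp_refl ST disj_mono conj_mono ex_mono all_mono imp_mono)+)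
  with assms(1) have "step n (seg A n) T c" by blast
  then have "step m (seg A m) T c"
    unfolding step_def
  proof (elim disj_forward, goal_cases)
    \<comment> \<open>The oracle rule is the only one in which \<open>n\<close> and the prefix
      occur.\<close>
    case 3
    then show ?case using assms(3) by auto
  qed assumption+
  with assms(4) show ?thesis by simp
qed

definition derivable :: "cantor \<Rightarrow> claim \<Rightarrow> bool" where
  "derivable A c \<longleftrightarrow> (\<exists>n D. derivation n (seg A n) D \<and> c \<in> set D)"

lemma image_nthd: "i \<le> length D \<Longrightarrow> nthd D ` {..<i} = set (take i D)"
proof -
  assume i: "i \<le> length D"
  then have "nthd D ` {..<i} = (!) D ` {..<i}" by (intro image_cong) auto
  then show ?thesis using nth_image[OF i] by (simp add: lessThan_atLeast0)
qed

lemma derivation_take: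
  "derivation n a D \<longleftrightarrow> (\<forall>i<length D. step n a (set (take i D)) (D ! i))"
proof -
  have "step n a (nthd D ` {..<i}) (nthd D i) \<longleftrightarrow> step n a (set (take i D)) (D ! i)"
    if "i < length D" for i
    by (simp only: image_nthd[OF less_imp_le[OF that]] nthd_nth[OF that])
  then show ?thesis unfolding derivation_def by blast
qed

lemma derivation_append:
  assumes "derivation n (seg A n) D" "derivation m (seg A m) E"
  shows "derivation (max n m) (seg A (max n m)) (D @ E)"
  unfolding derivation_take
proof (intro allI impI)
  fix i assume i: "i < length (D @ E)"
  show "step (max n m) (seg A (max n m)) (set (take i (D @ E))) ((D @ E) ! i)"
  proof (cases "i < length D")
    case True
    with assms(1) have "step n (seg A n) (set (take i D)) (D ! i)" by (simp add: derivation_take)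
    then show ?thesis
      by (rule step_mono) (use True in \<open>auto simp: nth_append\<close>)
  next
    case False
    with i assms(2) have "step m (seg A m) (set (take (i - length D) E)) (E ! (i - length D))"
      by (simp add: derivation_take)
    then show ?thesis
      by (rule step_mono) (use False in \<open>auto simp: nth_append\<close>)
  qed
qed

lemma derivable_finite:
  assumes "finite T" "\<And>u. u \<in> T \<Longrightarrow> derivable A u"
  shows "\<exists>n D. derivation n (seg A n) D \<and> T \<subseteq> set D"
  using assms
proof (induction T rule: finite_induct)
  case empty
  show ?case by (rule exI[of _ 0], rule exI[of _ "[]"]) (simp add: derivation_def)
next
  case (insert u T)
  then obtain n D where "derivation n (seg A n) D" "T \<subseteq> set D" by auto
  moreover from insert.prems obtain m E where "derivation m (seg A m) E" "u \<in> set E"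
    unfolding derivable_def by blast
  ultimately show ?case using derivation_append[of n A D m E] by fastforce
qed

lemma derivable_step:
  assumes "finite T" "\<And>u. u \<in> T \<Longrightarrow> derivable A u" "step k (seg A k) T c"
  shows "derivable A c"
proof -
  from derivable_finite[OF assms(1,2)] obtain n D where D: "derivation n (seg A n) D" "T \<subseteq> set D"
    by blast
  have "derivation (max n k) (seg A (max n k)) (D @ [c])"
    unfolding derivation_take
  proof (intro allI impI)
    fix i assume i: "i < length (D @ [c])"
    show "step (max n k) (seg A (max n k)) (set (take i (D @ [c]))) ((D @ [c]) ! i)"
    proof (cases "i < length D")
      case True
      with D(1) have "step n (seg A n) (set (take i D)) (D ! i)" by (simp add: derivation_take)
      then show ?thesis
        by (rule step_mono) (use True in \<open>auto simp: nth_append\<close>)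
    next
      case False
      with i have "i = length D" by simp
      then show ?thesis
        using step_mono[OF assms(3) D(2), of "max n k" c] by simp
    qed
  qed
  then show ?thesis unfolding derivable_def by (metis in_set_conv_decomp)
qed

lemma derivable_complete: "computes A p xs y \<Longrightarrow> derivable A (pcode p, xs, y)"
proof (induction rule: computes.induct)
  case (zero xs)
  show ?case by (rule derivable_step[of "{}" _ 0]) (simp_all add: step_def)
next
  case (succ x xs)
  show ?case by (rule derivable_step[of "{}" _ 0]) (simp_all add: step_def)
next
  case (orac x xs)
  have "step (Suc x) (seg A (Suc x)) {} (pcode Orac, x # xs, of_bool (A x))"
    unfolding step_def by (rule disjI2, rule disjI2, rule disjI1) (simp add: fst_dec_enc)
  from derivable_step[OF _ _ this] show ?case by simp
next
  case (proj i xs)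
  then have "step 0 (seg A 0) {} (pcode (Proj i), xs, xs ! i)"
    by (simp add: step_def)
  from derivable_step[OF _ _ this] show ?case by simp
next
  case (comp xs gs zs f y)
  have len: "length gs = length zs" using comp(1) by (rule list_all2_lengthD)
  let ?T = "insert (pcode f, zs, y) ((\<lambda>k. (pcode (gs ! k), xs, zs ! k)) ` {..<length zs})"
  show ?case
  proof (rule derivable_step[of ?T _ 0])
    show "derivable A u" if "u \<in> ?T" for u
      using that comp by (auto simp: list_all2_conv_all_nth)
    show "step 0 (seg A 0) ?T (pcode (Comp f gs), xs, y)"
      unfolding step_def using len by (simp add: fst_dec_enc)
  qed simp
next
  case (primrec_0 f xs y g)
  show ?case
    by (rule derivable_step[of "{(pcode f, xs, y)}" _ 0])
      (use primrec_0 in \<open>simp_all add: step_def fst_dec_enc\<close>)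
next
  case (primrec_Suc f g n xs r y)
  show ?case
  proof (rule derivable_step[of "{(pcode (PrimRec f g), n # xs, r), (pcode g, n # r # xs, y)}" _ 0])
    show "derivable A u" if "u \<in> {(pcode (PrimRec f g), n # xs, r), (pcode g, n # r # xs, y)}" for u
      using that primrec_Suc.IH by blast
  qed (simp_all add: step_def fst_dec_enc)
next
  case (minim f n xs)
  then have "\<forall>m<n. \<exists>r>0. derivable A (pcode f, m # xs, r)" by blast
  then obtain r where r: "\<And>m. m < n \<Longrightarrow> r m > 0 \<and> derivable A (pcode f, m # xs, r m)" by metis
  let ?T = "insert (pcode f, n # xs, 0) ((\<lambda>m. (pcode f, m # xs, r m)) ` {..<n})"
  show ?case
  proof (rule derivable_step[of ?T _ 0])
    show "derivable A u" if "u \<in> ?T" for u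
      using that minim.IH(1) r by blast
    have "\<exists>u\<in>?T. fst u = pcode f \<and> fst (snd u) = m # xs \<and> 0 < snd (snd u)" if "m < n" for m
      by (rule bexI[of _ "(pcode f, m # xs, r m)"]) (use that r in auto)
    then show "step 0 (seg A 0) ?T (pcode (Minim f), xs, n)"
      unfolding step_def by simp
  qed simp
qed

lemma halts_iff_derivable: "halts A p xs \<longleftrightarrow> (\<exists>y. derivable A (pcode p, xs, y))"
proof
  assume "\<exists>y. derivable A (pcode p, xs, y)"
  then obtain y where "derivable A (pcode p, xs, y)" by blast
  then have "sound A (pcode p, xs, y)" unfolding derivable_def using derivation_sound by blast
  then show "halts A p xs" by (auto simp: sound_def halts_def)
qed (auto simp: halts_def intro: derivable_complete)

text \<open>Numbers that are not codes of programs may enumerate anything.\<close>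

definition phalts :: "cantor \<Rightarrow> nat \<Rightarrow> nat list \<Rightarrow> bool" where
  "phalts A c xs \<longleftrightarrow> (\<exists>y. derivable A (c, xs, y))"

lemma phalts_pcode [simp]: "phalts A (pcode p) xs \<longleftrightarrow> halts A p xs"
  by (simp add: phalts_def halts_iff_derivable)

text \<open>This is universality: the witness is a derivation together with the length of the oracle
  prefix it may consult, and the index is an ordinary parameter.\<close>

lemma sigma1_phalts: "sigma1 A (\<lambda>X z. phalts A (fst z) (snd z))"
proof (rule sigma1_gen)
  show "decidable (\<lambda>z :: (nat \<times> nat list) \<times> (nat \<times> claim list) \<times> nat \<times> nat.
    derivation (fst (fst (snd z))) (snd (snd (snd z))) (snd (fst (snd z))) \<and>
    (\<exists>u\<in>nthd (snd (fst (snd z))) ` {..<length (snd (fst (snd z)))}.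
      fst u = fst (fst z) \<and> fst (snd u) = snd (fst z)))"
    by (intro comp_intros)
  show "computable (\<lambda>z :: (nat \<times> nat list) \<times> (nat \<times> claim list). fst (snd z))" by (intro comp_intros)
  show "phalts A (fst e) (snd e) \<longleftrightarrow> (\<exists>w. (\<lambda>z :: (nat \<times> nat list) \<times> (nat \<times> claim list) \<times> nat \<times> nat.
    derivation (fst (fst (snd z))) (snd (snd (snd z))) (snd (fst (snd z))) \<and>
    (\<exists>u\<in>nthd (snd (fst (snd z))) ` {..<length (snd (fst (snd z)))}.
      fst u = fst (fst z) \<and> fst (snd u) = snd (fst z)))
    (e, w, seg X (fst (snd (e, w))), seg A (fst (snd (e, w)))))" for X :: cantor and e
  proof -
    have *: "nthd D ` {..<length D} = set D" for D :: "claim list"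
      using image_nthd[of "length D" D] by (simp only: order.refl take_all)
    show ?thesis
      unfolding phalts_def derivable_def * fst_conv snd_conv split_paired_Ex
      by (auto simp: Bex_def)
  qed
qed

section \<open>Effectively open classes as domains of programs\<close>

lemma string_code_seg:
  "string_code (map X [0..<k]) = enc (map (\<lambda>j. of_bool (bit (seg X k) j) :: nat) [0..<k])"
  unfolding string_code_def enc_list_def by (rule arg_cong[of _ _ list_encode]) simp

lemma cylinder_iff_map: "X \<in> cylinder \<sigma> \<longleftrightarrow> map X [0..<length \<sigma>] = \<sigma>"
  unfolding cylinder_def list_eq_iff_nth_eq by simp

definition pclass :: "cantor \<Rightarrow> nat \<Rightarrow> nat \<Rightarrow> cantor set" where
  "pclass A c i = {X. \<exists>k. phalts A c [i, string_code (map X [0..<k])]}"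

lemma pclass_pcode:
  "pclass A (pcode p) i = (\<Union>\<sigma> \<in> {\<sigma>. halts A p [i, string_code \<sigma>]}. cylinder \<sigma>)"
proof -
  have "(\<exists>k. P (map X [0..<k])) \<longleftrightarrow> (\<exists>\<sigma>. P \<sigma> \<and> X \<in> cylinder \<sigma>)" for P X
  proof
    assume "\<exists>k. P (map X [0..<k])"
    then obtain k where "P (map X [0..<k])" by blast
    moreover have "X \<in> cylinder (map X [0..<k])" by (simp add: cylinder_def)
    ultimately show "\<exists>\<sigma>. P \<sigma> \<and> X \<in> cylinder \<sigma>" by blast
  next
    assume "\<exists>\<sigma>. P \<sigma> \<and> X \<in> cylinder \<sigma>"
    then obtain \<sigma> where "P \<sigma>" "X \<in> cylinder \<sigma>" by blast
    then have "P (map X [0..<length \<sigma>])" by (simp only: cylinder_iff_map)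
    then show "\<exists>k. P (map X [0..<k])" ..
  qed
  from this[of "\<lambda>\<sigma>. halts A p [i, string_code \<sigma>]"] show ?thesis
    by (simp add: pclass_def set_eq_iff)
qed

lemma sigma1_pclass: "sigma1 A (\<lambda>X e. X \<in> pclass A (fst e) (snd e))"
proof -
  define g where "g z = (fst (fst (fst z)), [snd (fst (fst z)),
    enc (map (\<lambda>j. of_bool (bit (fst (snd z)) j) :: nat) [0..<snd (fst z)])])"
    for z :: "((nat \<times> nat) \<times> nat) \<times> nat \<times> nat"
  have "computable g" unfolding g_def by (intro comp_intros)
  from sigma1_subst[OF sigma1_phalts computable_snd[OF computable_id] this] have "sigma1 A (\<lambda>X e. phalts A (fst (g (e, seg X (snd e), seg A (snd e))))
      (snd (g (e, seg X (snd e), seg A (snd e)))))"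
    by this
  then have "sigma1 A (\<lambda>X z. phalts A (fst (fst z)) [snd (fst z), string_code (map X [0..<snd z])])"
    by (simp only: g_def string_code_seg fst_conv snd_conv)
  from sigma1_ex[of A "\<lambda>X e k. phalts A (fst e) [snd e, string_code (map X [0..<k])]", OF this]
  show ?thesis by (simp add: pclass_def)
qed

text \<open>This is where a program actually queries its oracle: a decidable matrix receives its
  oracle prefix as a number, which has to be assembled first.\<close>

lemma ex_raw_seg: "\<exists>p. \<forall>k xs. computes A p (k # xs) (seg A k)"
proof -
  from raw2_add obtain pa where a: "\<And>A x y xs. computes A pa (x # y # xs) (x + y)"
    unfolding raw2_def by metis
  from raw2_mult obtain pm where m: "\<And>A x y xs. computes A pm (x # y # xs) (x * y)"
    unfolding raw2_def by metis
  have "computable (\<lambda>i::nat. 2 ^ i :: nat)" by (intro comp_intros)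
  then obtain pe where e: "\<And>A x xs. computes A pe (x # xs) (2 ^ x)"
    unfolding computable_def enc_nat_def by metis
  have S: "seg A (Suc i) = seg A i + of_bool (A i) * 2 ^ i" for i
    by (simp add: seg_def horner_sum_append)
  have "computes A (PrimRec Zero (Comp pa [Proj 1, Comp pm [Comp Orac [Proj 0], Comp pe [Proj 0]]])) (k # xs) (seg A k)" for k xs
  proof (rule computes_PrimRec)
    show "computes A Zero xs (seg A 0)" by (simp add: seg_def computes.zero)
    show "computes A (Comp pa [Proj 1, Comp pm [Comp Orac [Proj 0], Comp pe [Proj 0]]]) (n # seg A n # xs)
        (seg A (Suc n))" for n
      unfolding S One_nat_def
      by (rule computes_Comp2 computes_Comp1 computes_Proj0 computes_Proj1 a m e computes.orac)+
  qed
  then show ?thesis by blast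
qed

lemma halts_Comp1:
  assumes "computes A g xs z"
  shows "halts A (Comp f [g]) xs \<longleftrightarrow> halts A f [z]"
proof
  assume "halts A (Comp f [g]) xs"
  then obtain y where "computes A (Comp f [g]) xs y" unfolding halts_def by blast
  then obtain zs where zs: "list_all2 (\<lambda>g z. computes A g xs z) [g] zs" and "computes A f zs y"
    by (rule computes_elims(5))
  moreover from zs have "zs = [z]"
    using computes_deterministic[OF assms] by (auto simp: list_all2_Cons1)
  ultimately show "halts A f [z]" unfolding halts_def by blast
next
  assume "halts A f [z]"
  then show "halts A (Comp f [g]) xs" unfolding halts_def using computes_Comp1[OF assms] by blast
qed

text \<open>Towards programs, a string of length \<open>k\<close> is enumerated exactly if the
  matrix holds with both prefixes cut at \<open>k\<close>; the length of the string thus serves as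
  the existential witness.\<close>

theorem uniformly_Sigma1_iff: "uniformly_Sigma1 A U \<longleftrightarrow> sigma1 A (\<lambda>X i. X \<in> U i)"
proof
  assume "uniformly_Sigma1 A U"
  then obtain p where "\<And>n. U n = pclass A (pcode p) n"
    unfolding uniformly_Sigma1_def pclass_pcode by blast
  then have "(\<lambda>X i. X \<in> U i) = (\<lambda>X i. X \<in> pclass A (fst (pcode p, i)) (snd (pcode p, i)))"
    by (simp add: fun_eq_iff)
  then show "sigma1 A (\<lambda>X i. X \<in> U i)"
    using sigma1_comp[OF sigma1_pclass, of "\<lambda>i. (pcode p, i)" A] by (simp add: computable_pair computable_const computable_id)
next
  assume "sigma1 A (\<lambda>X i. X \<in> U i)"
  then obtain R where R: "decidable R" "\<And>X i. X \<in> U i \<longleftrightarrow> (\<exists>n. R (i, n, seg X n, seg A n))"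
    unfolding sigma1_def by blast
  let ?R = "\<lambda>z::nat \<times> nat list \<times> nat. R (fst z, length (fst (snd z)),
    \<Sum>j<length (fst (snd z)). nthd (fst (snd z)) j * 2 ^ j, snd (snd z))"
  \<comment> \<open>\<open>halts_ex\<close> expects a search, so a decidable condition is given a
    dummy search variable.\<close>
  have "decidable (\<lambda>z. ?R (fst z))"
    by (intro comp_intros decidable_comp[OF R(1)])
  from halts_ex[of "\<lambda>x (n::nat). ?R x", OF this] obtain q where
    "\<forall>A z. halts A q [enc z] \<longleftrightarrow> (\<exists>n::nat. ?R z)" by blast
  then have q: "\<And>A z. halts A q [enc z] \<longleftrightarrow> ?R z" by blast
  from raw2_pair obtain s where s: "\<And>A x y xs. computes A s (x # y # xs) (prod_encode (x, y))"
    unfolding raw2_def by metis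
  obtain ps where ps: "\<And>k xs. computes A ps (k # xs) (seg A k)"
    using ex_raw_seg by metis
  have "computable (length :: nat list \<Rightarrow> nat)" by (intro comp_intros)
  then obtain pl where pl: "\<And>A x xs. computes A pl (enc (x :: nat list) # xs) (length x)"
    unfolding computable_def enc_nat_def by metis
  define t where "t = Comp s [Proj 0, Comp s [Proj 1, Comp ps [Comp pl [Proj 1]]]]"
  have t: "computes A t [i, enc l] (enc (i, l, seg A (length l)))" for i and l :: "nat list"
    unfolding t_def enc_prod_def fst_conv snd_conv enc_nat_def One_nat_def
    by (rule computes_Comp2 computes_Comp1 computes_Proj0 computes_Proj1 s ps pl)+
  have h: "halts A (Comp q [t]) [i :: nat, enc l] \<longleftrightarrow> halts A q [enc (i, l, seg A (length l))]" for i and l :: "nat list"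
    by (rule halts_Comp1[OF t])
  have sum: "(\<Sum>j<k. of_bool (X j) * 2 ^ j) = seg X k" for X k
    by (induction k) (simp_all add: seg_def horner_sum_append)
  have "X \<in> U i \<longleftrightarrow> (\<exists>k. halts A (Comp q [t]) [i, string_code (map X [0..<k])])" for X i
  proof -
    have "(\<Sum>j<k. nthd (map (\<lambda>j. of_bool (bit (seg X k) j)) [0..<k]) j * 2 ^ j) = seg X k" for k
      unfolding sum[of X k, symmetric] by (rule sum.cong) (simp_all add: sum)
    then have "halts A (Comp q [t]) [i, string_code (map X [0..<k])] \<longleftrightarrow> R (i, k, seg X k, seg A k)" for k
      unfolding string_code_seg h q by simp
    then show ?thesis using R(2) by simp
  qed
  then have "U i = pclass A (pcode (Comp q [t])) i" for i
    by (simp add: pclass_def set_eq_iff del: pcode.simps)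
  then show "uniformly_Sigma1 A U"
    unfolding uniformly_Sigma1_def pclass_pcode by blast
qed

subsection \<open>The coin-tossing measure\<close>

abbreviation mu :: "cantor set \<Rightarrow> real" where
  "mu \<equiv> measure coin_measure"

lemma space_coin [simp]: "space coin_measure = UNIV"
  by (simp add: coin_measure_def space_PiM PiE_def)

lemma UNIV_coin [simp]: "UNIV \<in> sets coin_measure"
  using sets.top[of coin_measure] by simp

lemma seg_0 [simp]: "seg X 0 = 0"
  by (simp add: seg_def)

interpretation coin: sequence_space "measure_pmf (bernoulli_pmf (1 / 2))"
  by unfold_locales

interpretation coin_prob: prob_space coin_measure
  unfolding coin_measure_def by (rule prob_space_PiM) (rule measure_pmf.prob_space_axioms)

lemma mu_UNIV [simp]: "mu UNIV = 1"
  using coin_prob.prob_space by simp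

lemma sets_seg_eq: "{X. seg X n = x} \<in> sets coin_measure"
proof (cases "\<exists>Y. seg Y n = x")
  case True
  then obtain Y where "seg Y n = x" by blast
  then have "{X. seg X n = x} = cylinder (map Y [0..<n])"
    by (auto simp: cylinder_def seg_eq_iff)
  then show ?thesis by simp
qed auto

lemma sets_seg [simp]: "{X. Q (seg X n)} \<in> sets coin_measure"
proof -
  have "{X. Q (seg X n)} = (\<Union>x\<in>{x. Q x \<and> x < 2 ^ n}. {X. seg X n = x})"
    by (auto simp: seg_less)
  also have "\<dots> \<in> sets coin_measure"
    by (rule sets.finite_UN) (auto simp: sets_seg_eq)
  finally show ?thesis .
qed

lemma sets_ex: "(\<And>n::nat. {X. Q n X} \<in> sets coin_measure) \<Longrightarrow> {X. \<exists>n. Q n X} \<in> sets coin_measure"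
proof -
  assume "\<And>n::nat. {X. Q n X} \<in> sets coin_measure"
  then have "(\<Union>n. {X. Q n X}) \<in> sets coin_measure" by (intro sets.countable_UN) auto
  moreover have "(\<Union>n. {X. Q n X}) = {X. \<exists>n. Q n X}" by auto
  ultimately show ?thesis by simp
qed

lemma sets_ex_seg [simp]: "{X. \<exists>n. Q n (seg X n)} \<in> sets coin_measure"
  by (rule sets_ex) simp

lemma mu_seg_eq: "x < 2 ^ n \<Longrightarrow> mu {X. seg X n = x} = 1 / 2 ^ n"
proof -
  assume x: "x < 2 ^ n"
  have "{X. seg X n = x} = prod_emb UNIV (\<lambda>_. measure_pmf (bernoulli_pmf (1 / 2))) {..<n}
      (\<Pi>\<^sub>E j\<in>{..<n}. {bit x j})" (is "_ = ?E")
  proof -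
    have e: "seg (bit x) n = x" using x by (simp add: take_bit_nat_eq_self)
    have "seg X n = x \<longleftrightarrow> (\<forall>i<n. X i = bit x i)" for X
      using seg_eq_iff[of X n "bit x"] unfolding e .
    moreover have "X \<in> ?E \<longleftrightarrow> (\<forall>i<n. X i = bit x i)" for X
      unfolding prod_emb_iff PiE_iff by simp blast
    ultimately show ?thesis by blast
  qed
  then have "mu {X. seg X n = x} = measure (PiM UNIV (\<lambda>_. measure_pmf (bernoulli_pmf (1 / 2)))) ?E"
    by (simp add: coin_measure_def)
  also have "\<dots> = (\<Prod>j<n. measure_pmf.prob (bernoulli_pmf (1 / 2)) {bit x j})"
    by (rule coin.measure_PiM_emb) auto
  also have "\<dots> = (\<Prod>j<n. 1 / 2)"
    by (rule prod.cong) (simp_all add: measure_pmf_single pmf_bernoulli_half)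
  finally show ?thesis by (simp add: power_divide)
qed

lemma mu_seg: "mu {X. Q (seg X n)} = card {x. x < 2 ^ n \<and> Q x} / 2 ^ n"
proof -
  have "{X. Q (seg X n)} = (\<Union>x\<in>{x. x < 2 ^ n \<and> Q x}. {X. seg X n = x})"
    by (auto simp: seg_less)
  moreover have "mu (\<Union>x\<in>{x. x < 2 ^ n \<and> Q x}. {X. seg X n = x}) =
      (\<Sum>x\<in>{x. x < 2 ^ n \<and> Q x}. mu {X. seg X n = x})"
    by (rule coin_prob.finite_measure_finite_Union) (auto simp: disjoint_family_on_def sets_seg_eq)
  moreover have "\<dots> = (\<Sum>x\<in>{x. x < 2 ^ n \<and> Q x}. 1 / 2 ^ n)"
    by (rule sum.cong) (auto simp: mu_seg_eq)
  ultimately show ?thesis by simp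
qed

section \<open>Independence of prefix and tail\<close>

lemma measurable_shift [measurable]: "shift l \<in> measurable coin_measure coin_measure"
  unfolding coin_measure_def shift_def
  by (rule measurable_PiM_single') (auto simp: space_PiM intro!: measurable_component_singleton)

text \<open>Gluing the first \<open>n\<close> bits of one independent sequence to another reproduces
  the measure, and under this map the event becomes a rectangle.\<close>

lemma mu_seg_shift:
  assumes "B \<in> sets coin_measure"
  shows "mu {X. Q (seg X n) \<and> shift n X \<in> B} = mu {X. Q (seg X n)} * mu B"
proof -
  let ?E = "{X. Q (seg X n) \<and> shift n X \<in> B}"
  have [measurable]: "{X. Q (seg X n)} \<in> sets coin_measure" by simp
  have E: "?E \<in> sets coin_measure"
  proof -
    have "?E = {X. Q (seg X n)} \<inter> (shift n -` B \<inter> space coin_measure)" by auto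
    also have "\<dots> \<in> sets coin_measure"
      using measurable_sets[OF measurable_shift assms] by (intro sets.Int) auto
    finally show ?thesis .
  qed
  let ?f = "\<lambda>(w, w'). comb_seq n w w'"
  have "emeasure coin_measure ?E = emeasure (distr (coin_measure \<Otimes>\<^sub>M coin_measure) coin_measure ?f) ?E"
    unfolding coin_measure_def coin.PiM_comb_seq ..
  also have "\<dots> = emeasure (coin_measure \<Otimes>\<^sub>M coin_measure)
      (?f -` ?E \<inter> space (coin_measure \<Otimes>\<^sub>M coin_measure))"
    using E by (intro emeasure_distr) (auto simp: coin_measure_def intro!: measurable_comb_seq)
  also have "?f -` ?E \<inter> space (coin_measure \<Otimes>\<^sub>M coin_measure) = {X. Q (seg X n)} \<times> B"
    by (auto simp: space_pair_measure seg_comb_seq_le)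
  also have "emeasure (coin_measure \<Otimes>\<^sub>M coin_measure) ({X. Q (seg X n)} \<times> B) =
      emeasure coin_measure {X. Q (seg X n)} * emeasure coin_measure B"
    using assms by (intro coin_prob.emeasure_pair_measure_Times) auto
  finally show ?thesis
    by (simp add: coin_prob.emeasure_eq_measure flip: ennreal_mult)
qed

lemma mu_shift: "B \<in> sets coin_measure \<Longrightarrow> mu {X. shift n X \<in> B} = mu B"
  using mu_seg_shift[of B "\<lambda>_. True" n] by simp

lemma sets_shift: "B \<in> sets coin_measure \<Longrightarrow> {X. shift n X \<in> B} \<in> sets coin_measure"
  using measurable_sets[OF measurable_shift, of B n] by (simp add: vimage_def)

text \<open>Measure inside a cylinder is the measure of the tails, scaled by
  \<open>2^-n\<close>.\<close>

lemma comb_seq_vimage: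
  assumes "B \<in> sets coin_measure"
  shows "{X. comb_seq n Z X \<in> B} \<in> sets coin_measure"
    and "mu {X. seg X n = seg Z n \<and> X \<in> B} = mu {X. comb_seq n Z X \<in> B} / 2 ^ n"
proof -
  have "comb_seq n Z \<in> measurable coin_measure coin_measure"
    unfolding coin_measure_def by (intro measurable_comb_seq') (auto simp: space_PiM)
  from measurable_sets[OF this assms] show s: "{X. comb_seq n Z X \<in> B} \<in> sets coin_measure"
    by (simp add: vimage_def)
  have "{X. seg X n = seg Z n \<and> X \<in> B} =
      {X. seg X n = seg Z n \<and> shift n X \<in> {X. comb_seq n Z X \<in> B}}"
    using comb_seq_shift[of Z n] by auto
  also have "mu \<dots> = mu {X. seg X n = seg Z n} * mu {X. comb_seq n Z X \<in> B}"
    by (rule mu_seg_shift[OF s])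
  finally show "mu {X. seg X n = seg Z n \<and> X \<in> B} = mu {X. comb_seq n Z X \<in> B} / 2 ^ n"
    by (simp add: mu_seg_eq seg_less)
qed

lemma sigma1_sets: "sigma1 A P \<Longrightarrow> {X. P X e} \<in> sets coin_measure"
proof -
  assume "sigma1 A P"
  then obtain R where "\<And>X e. P X e \<longleftrightarrow> (\<exists>n. R (e, n, seg X n, seg A n))" unfolding sigma1_def by blast
  then show ?thesis using sets_ex_seg[of "\<lambda>n x. R (e, n, x, seg A n)"] by simp
qed

lemma mu_mono: "A \<subseteq> B \<Longrightarrow> B \<in> sets coin_measure \<Longrightarrow> mu A \<le> mu B"
  by (rule coin_prob.finite_measure_mono)

lemma mu_UN_le:
  assumes "\<And>n::nat. U n \<in> sets coin_measure" "\<And>n. mu (U n) \<le> f n" "f sums c"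
  shows "mu (\<Union>n. U n) \<le> c"
proof -
  have "summable (\<lambda>n. mu (U n))"
    by (rule summable_comparison_test'[OF sums_summable[OF assms(3)], of 0]) (use assms(2) in auto)
  then have "mu (\<Union>n. U n) \<le> (\<Sum>n. mu (U n))"
    using assms(1) by (intro coin_prob.finite_measure_subadditive_countably) auto
  also have "\<dots> \<le> (\<Sum>n. f n)"
    by (rule suminf_le) (use assms sums_summable \<open>summable (\<lambda>n. mu (U n))\<close> in auto)
  finally show ?thesis using assms(3) by (simp add: sums_iff)
qed

lemma mu_ex_seg_limit:
  assumes "\<And>X m n. m \<le> n \<Longrightarrow> Q m (seg X m) \<Longrightarrow> Q n (seg X n)"
  shows "(\<lambda>n. mu {X. Q n (seg X n)}) \<longlonglongrightarrow> mu {X. \<exists>n. Q n (seg X n)}"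
proof -
  have "(\<lambda>n. mu {X. Q n (seg X n)}) \<longlonglongrightarrow> mu (\<Union>n. {X. Q n (seg X n)})"
    by (rule coin_prob.finite_Lim_measure_incseq) (auto simp: incseq_def dest: assms)
  moreover have "(\<Union>n. {X. Q n (seg X n)}) = {X. \<exists>n. Q n (seg X n)}" by auto
  ultimately show ?thesis by simp
qed

subsection \<open>Randomness and tests\<close>

text \<open>Intersecting the first components makes any such sequence nested without raising the
  measures.\<close>

lemma not_random_if:
  assumes "sigma1 A (\<lambda>X n. X \<in> U n)" "\<And>n. mu (U n) \<le> (1 / 2) ^ n" "\<And>n. R \<in> U n"
  shows "\<not> random_rel A R"
proof -
  define V where "V n = {X. \<forall>m\<le>n. X \<in> U m}" for n
  have "sigma1 A (\<lambda>X n. X \<in> V n)"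
    unfolding V_def mem_Collect_eq by (intro sigma1_intros computable_id sigma1_comp[OF assms(1)] comp_intros)
  moreover have "decseq V" by (auto simp: V_def decseq_def)
  moreover have "mu (V n) \<le> (1 / 2) ^ n" for n
  proof -
    have "mu (V n) \<le> mu (U n)"
      by (rule mu_mono) (use sigma1_sets[OF assms(1), of n] in \<open>auto simp: V_def\<close>)
    with assms(2)[of n] show ?thesis by linarith
  qed
  ultimately have "Martin_Lof_test A V"
    by (simp add: Martin_Lof_test_def uniformly_Sigma1_iff)
  moreover have "R \<in> (\<Inter>n. V n)" using assms(3) by (simp add: V_def)
  ultimately show ?thesis unfolding random_rel_def by blast
qed

lemma not_randomE:
  assumes "\<not> random_rel A R"
  obtains U where "sigma1 A (\<lambda>X n. X \<in> U n)" "\<And>n. mu (U n) \<le> (1 / 2) ^ n" "\<And>n. R \<in> U n"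
  using assms unfolding random_rel_def Martin_Lof_test_def uniformly_Sigma1_iff by blast

text \<open>
  Kucera's argument.  If \<open>U\<close> is generated by the minimal strings in \<open>R\<close>, the sequences that start
  with a concatenation of \<open>k\<close> such strings form a class of measure \<open>mu U ^ k\<close>.  The pair
  \<open>parse\<close> records where the current block starts and how many blocks have been completed.
\<close>

definition parse :: "(nat \<times> nat \<times> nat \<Rightarrow> bool) \<Rightarrow> cantor \<Rightarrow> cantor \<Rightarrow> nat \<Rightarrow> nat \<times> nat" where
  "parse R A X m = rec_nat (0, 0) (\<lambda>m s.
     if R (Suc m - fst s, seg (shift (fst s) X) (Suc m - fst s), seg A (Suc m - fst s))
     then (Suc m, Suc (snd s)) else s) m"

lemma parse_0 [simp]: "parse R A X 0 = (0, 0)"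
  by (simp add: parse_def)

lemma parse_Suc: "parse R A X (Suc m) =
  (if R (Suc m - fst (parse R A X m), seg (shift (fst (parse R A X m)) X) (Suc m - fst (parse R A X m)),
      seg A (Suc m - fst (parse R A X m)))
   then (Suc m, Suc (snd (parse R A X m))) else parse R A X m)"
  by (simp add: parse_def)

definition first_hit :: "(nat \<times> nat \<times> nat \<Rightarrow> bool) \<Rightarrow> cantor \<Rightarrow> nat \<Rightarrow> nat \<Rightarrow> bool" where
  "first_hit R A n x \<longleftrightarrow> R (n, x, seg A n) \<and> (\<forall>j<n. \<not> R (j, take_bit j x, seg A j))"

lemma first_hit_seg: "first_hit R A n (seg X n) \<longleftrightarrow>
    R (n, seg X n, seg A n) \<and> (\<forall>j<n. \<not> R (j, seg X j, seg A j))"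
  by (auto simp: first_hit_def min_def)

lemma ex_first_hit: "(\<exists>n. R (n, seg X n, seg A n)) \<longleftrightarrow> (\<exists>n. first_hit R A n (seg X n))"
  unfolding first_hit_seg using exists_least_iff[of "\<lambda>n. R (n, seg X n, seg A n)"] by blast

lemma first_hit_unique: "first_hit R A n (seg X n) \<Longrightarrow> first_hit R A m (seg X m) \<Longrightarrow> n = m"
  unfolding first_hit_seg by (metis linorder_neqE_nat)

lemma parse_no_hit: "(\<And>j. 0 < j \<Longrightarrow> j \<le> m \<Longrightarrow> \<not> R (j, seg X j, seg A j)) \<Longrightarrow> parse R A X m = (0, 0)"
  by (induction m) (auto simp: parse_Suc)

lemma parse_after_hit:
  assumes "first_hit R A n (seg X n)" "n > 0"
  shows "parse R A X (n + j) = (n + fst (parse R A (shift n X) j), Suc (snd (parse R A (shift n X) j)))"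
proof (induction j)
  case 0
  obtain m where n: "n = Suc m" using assms(2) by (cases n) auto
  have "parse R A X m = (0, 0)"
    by (rule parse_no_hit) (use assms n in \<open>auto simp: first_hit_seg\<close>)
  then show ?case using assms(1) n by (auto simp: parse_Suc first_hit_seg)
next
  case (Suc j)
  then show ?case by (simp add: parse_Suc shift_shift add.commute)
qed

definition parsed :: "(nat \<times> nat \<times> nat \<Rightarrow> bool) \<Rightarrow> cantor \<Rightarrow> nat \<Rightarrow> cantor set" where
  "parsed R A k = {X. \<exists>m. k \<le> snd (parse R A X m)}"

lemma parse_fst_le: "fst (parse R A X m) \<le> m"
  by (induction m) (auto simp: parse_Suc)

lemma parsed_0 [simp]: "parsed R A 0 = UNIV"
  by (simp add: parsed_def)

text \<open>\<open>parse\<close> only tests blocks of positive length; \<open>R0\<close> excludes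
  the empty block, so that its first cut agrees with \<open>first_hit\<close>.\<close>

lemma parsed_Suc:
  assumes R0: "\<not> R (0, 0, 0)"
  shows "X \<in> parsed R A (Suc k) \<longleftrightarrow> (\<exists>n. first_hit R A n (seg X n) \<and> shift n X \<in> parsed R A k)"
proof
  have pos: "n > 0" if "first_hit R A n (seg X n)" for n
    using that R0 by (cases n) (auto simp: first_hit_def)
  {
    assume "X \<in> parsed R A (Suc k)"
    then obtain m where m: "Suc k \<le> snd (parse R A X m)" by (auto simp: parsed_def)
    have "\<exists>n\<le>m. R (n, seg X n, seg A n)"
    proof (rule ccontr)
      assume "\<not> (\<exists>n\<le>m. R (n, seg X n, seg A n))"
      then have "parse R A X m = (0, 0)" by (intro parse_no_hit) auto
      with m show False by simp
    qed
    then obtain n where n: "n \<le> m" "first_hit R A n (seg X n)"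
      unfolding first_hit_seg using exists_least_iff[of "\<lambda>n. n \<le> m \<and> R (n, seg X n, seg A n)"]
      by (meson less_imp_le order_trans)
    then obtain j where "m = n + j" using le_Suc_ex by blast
    with m parse_after_hit[OF n(2) pos[OF n(2)], of j] have "k \<le> snd (parse R A (shift n X) j)" by simp
    with n(2) show "\<exists>n. first_hit R A n (seg X n) \<and> shift n X \<in> parsed R A k"
      by (auto simp: parsed_def)
  next
    assume "\<exists>n. first_hit R A n (seg X n) \<and> shift n X \<in> parsed R A k"
    then obtain n j where n: "first_hit R A n (seg X n)" "k \<le> snd (parse R A (shift n X) j)"
      by (auto simp: parsed_def)
    with parse_after_hit[OF n(1) pos[OF n(1)], of j] have "Suc k \<le> snd (parse R A X (n + j))" by simp
    then show "X \<in> parsed R A (Suc k)" unfolding parsed_def by blast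
  }
qed

lemma sigma1_parsed:
  assumes "decidable R" shows "sigma1 A (\<lambda>X k. X \<in> parsed R A k)"
proof (rule sigma1_gen)
  \<comment> \<open>The same recursion as \<open>parse\<close>, run on prefixes given as numbers:
    the block starting at \<open>s\<close> is obtained by dropping \<open>s\<close> bits.\<close>
  define st where "st x a m = rec_nat (0, 0) (\<lambda>m s.
     if R (Suc m - fst s, take_bit (Suc m - fst s) (drop_bit (fst s) x), take_bit (Suc m - fst s) a)
     then (Suc m, Suc (snd s)) else s) m" for x a m :: nat
  show "decidable (\<lambda>z. fst z \<le> snd (st (fst (snd (snd z))) (snd (snd (snd z))) (fst (snd z))))"
    unfolding st_def by (intro comp_intros decidable_comp[OF assms])
  show "computable (\<lambda>z :: nat \<times> nat. snd z)" by (intro comp_intros)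
  have "st (seg X N) (seg A N) m = parse R A X m" if "m \<le> N" for X N m
    using that
  proof (induction m)
    case (Suc m)
    have "seg (shift s X) (Suc m - s) = take_bit (Suc m - s) (drop_bit s (seg X N))" if "s \<le> m" for s
    proof -
      have "take_bit (Suc m - s) (drop_bit s (seg X N)) = drop_bit s (take_bit (Suc m) (seg X N))"
        by (simp only: drop_bit_take_bit)
      then show ?thesis using that Suc.prems by (simp add: seg_shift min_def)
    qed
    note this[OF parse_fst_le[of R A X m]]
    moreover have "seg A (Suc m - s) = take_bit (Suc m - s) (seg A N)" for s
      using Suc.prems by (simp add: min_def)
    ultimately show ?case
      using Suc by (simp add: parse_Suc st_def del: take_bit_seg)
  qed (simp add: st_def)
  then show "X \<in> parsed R A k \<longleftrightarrow> (\<exists>w. (\<lambda>z. fst z \<le> snd (st (fst (snd (snd z))) (snd (snd (snd z))) (fst (snd z))))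
    (k, w, seg X (snd (k, w)), seg A (snd (k, w))))" for X k
    by (simp add: parsed_def)
qed

text \<open>Splitting by the first block gives disjoint events, and the tail after that block is
  independent of it; each further block therefore contributes one factor.\<close>

lemma mu_parsed:
  assumes R: "decidable R" and R0: "\<not> R (0, 0, 0)"
  shows "mu (parsed R A k) = mu {X. \<exists>n. R (n, seg X n, seg A n)} ^ k"
proof (induction k)
  case (Suc k)
  have s: "parsed R A k \<in> sets coin_measure" for k
    using sigma1_sets[OF sigma1_parsed[OF R], of A k] by simp
  let ?H = "\<lambda>n. {X. first_hit R A n (seg X n)}"
  let ?K = "\<lambda>n. {X. first_hit R A n (seg X n) \<and> shift n X \<in> parsed R A k}"
  have dis: "disjoint_family ?H" "disjoint_family ?K"
    using first_hit_unique[of R A] unfolding disjoint_family_on_def by blast+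
  have K: "?K n \<in> sets coin_measure" for n
    using sets.Int[OF sets_seg[of "first_hit R A n" n] sets_shift[OF s, of n k]]
    by (simp add: Collect_conj_eq)
  have "(\<lambda>n. mu (?H n)) sums mu (\<Union>n. ?H n)"
    by (rule coin_prob.finite_measure_UNION) (use dis in auto)
  also have "(\<Union>n. ?H n) = {X. \<exists>n. R (n, seg X n, seg A n)}"
    using ex_first_hit[of R _ A] by auto
  finally have "(\<lambda>n. mu (?H n) * mu (parsed R A k)) sums
      (mu {X. \<exists>n. R (n, seg X n, seg A n)} * mu (parsed R A k))"
    by (rule sums_mult2)
  moreover have "(\<lambda>n. mu (?K n)) sums mu (\<Union>n. ?K n)"
    by (rule coin_prob.finite_measure_UNION) (use dis K in auto)
  moreover have "(\<Union>n. ?K n) = parsed R A (Suc k)"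
    using parsed_Suc[of R _ A k, OF R0] by auto
  moreover have "mu (?K n) = mu (?H n) * mu (parsed R A k)" for n
    by (rule mu_seg_shift[OF s])
  ultimately show ?case using Suc by (simp add: sums_iff)
qed simp

text \<open>\<open>L\<close> is a set of block boundaries of \<open>X\<close>, closed under passing
  to the end of the next minimal string.\<close>

lemma parsed_chain:
  assumes R0: "\<not> R (0, 0, 0)" and "0 \<in> L"
    and "\<And>l. l \<in> L \<Longrightarrow> \<exists>n. first_hit R A n (seg (shift l X) n) \<and> l + n \<in> L"
  shows "X \<in> parsed R A k"
  using assms(2,3)
proof (induction k arbitrary: X L)
  case (Suc k)
  from Suc.prems(2)[OF Suc.prems(1)] obtain n where n: "first_hit R A n (seg X n)" "n \<in> L" by auto
  have "shift n X \<in> parsed R A k"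
  proof (rule Suc.IH[of "{l. l + n \<in> L}"])
    show "\<exists>m. first_hit R A m (seg (shift l (shift n X)) m) \<and> l + m \<in> {l. l + n \<in> L}"
      if "l \<in> {l. l + n \<in> L}" for l
      using Suc.prems(2)[of "l + n"] that by (auto simp: shift_shift ac_simps)
  qed (use n in auto)
  with n(1) show ?case by (auto simp: parsed_Suc[of R, OF R0])
qed simp

theorem kucera_chain:
  assumes R: "decidable R" and less: "mu {X. \<exists>n. R (n, seg X n, seg A n)} < 1" and "0 \<in> L"
    and "\<And>l. l \<in> L \<Longrightarrow> \<exists>n. first_hit R A n (seg (shift l X) n) \<and> l + n \<in> L"
  shows "\<not> random_rel A X"
proof -
  let ?q = "mu {X. \<exists>n. R (n, seg X n, seg A n)}"
  have R0: "\<not> R (0, 0, 0)"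
  proof
    assume "R (0, 0, 0)"
    then have "{X. \<exists>n. R (n, seg X n, seg A n)} = UNIV"
      by (auto intro!: exI[of _ 0] simp: seg_def)
    with less show False by simp
  qed
  \<comment> \<open>Groups of \<open>c\<close> blocks halve the measure, so
    \<open>parsed R A (c * n)\<close> obeys the bound \<open>2^-n\<close> of a test.\<close>
  obtain c where c: "?q ^ c < 1 / 2"
    using real_arch_pow_inv[OF _ less, of "1 / 2"] by auto
  show ?thesis
  proof (rule not_random_if)
    show "sigma1 A (\<lambda>X n. X \<in> parsed R A (c * n))"
      by (intro sigma1_comp[OF sigma1_parsed[OF R]] comp_intros)
    show "mu (parsed R A (c * n)) \<le> (1 / 2) ^ n" for n
      unfolding mu_parsed[OF R R0] power_mult by (rule power_mono) (use c in auto)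
    show "X \<in> parsed R A (c * n)" for n
      by (rule parsed_chain[OF R0 assms(3,4)])
  qed
qed

section \<open>Closed classes of 1-random sequences and covers of open classes\<close>

abbreviation sigma1_class :: "cantor \<Rightarrow> cantor set \<Rightarrow> bool" where
  "sigma1_class A W \<equiv> sigma1 A (\<lambda>X (e::nat). X \<in> W)"

lemma sigma1_classE:
  assumes "sigma1_class A W"
  obtains R where "decidable R" "\<And>X. X \<in> W \<longleftrightarrow> (\<exists>n. R (n, seg X n, seg A n))"
    "\<And>m n X B. R (m, seg X m, seg B m) \<Longrightarrow> m \<le> n \<Longrightarrow> R (n, seg X n, seg B n)"
proof -
  obtain R where R: "decidable R" "\<And>X (e::nat). X \<in> W \<longleftrightarrow> (\<exists>n. R (e, n, seg X n, seg A n))" "upward R"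
    using sigma1_mono[OF assms] by metis
  show ?thesis
  proof
    show "decidable (\<lambda>z. R (0, z))" by (intro decidable_comp[OF R(1)] comp_intros)
    show "X \<in> W \<longleftrightarrow> (\<exists>n. R (0, n, seg X n, seg A n))" for X by (rule R(2))
    show "R (0, n, seg X n, seg B n)" if "R (0, m, seg X m, seg B m)" "m \<le> n" for m n X B
      using upward_seg[OF R(3) that] .
  qed
qed

lemma sigma1_class_sets: "sigma1_class A W \<Longrightarrow> W \<in> sets coin_measure"
  using sigma1_sets[of A "\<lambda>X (e::nat). X \<in> W" 0] by simp

text \<open>If all tails were in \<open>U\<close>, every position would be a possible block boundary
  and \<open>kucera_chain\<close> would apply with \<open>L = UNIV\<close>.\<close>

lemma kucera_tail:
  assumes "sigma1_class A U" "mu U < 1" "random_rel A X"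
  obtains l where "shift l X \<notin> U"
proof (rule ccontr)
  assume "\<not> thesis"
  with that have U: "shift l X \<in> U" for l by blast
  obtain R where R: "decidable R" "\<And>X. X \<in> U \<longleftrightarrow> (\<exists>n. R (n, seg X n, seg A n))"
    using sigma1_classE[OF assms(1)] by metis
  have "\<exists>n. first_hit R A n (seg (shift l X) n) \<and> l + n \<in> UNIV" for l
    using U[of l] unfolding R(2) ex_first_hit by simp
  moreover have "U = {X. \<exists>n. R (n, seg X n, seg A n)}"
    using R(2) by blast
  then have "mu {X. \<exists>n. R (n, seg X n, seg A n)} < 1"
    using assms(2) by simp
  ultimately have "\<not> random_rel A X" by (intro kucera_chain[OF R(1), of A UNIV]) auto
  with assms(3) show False by simp
qed

text \<open>Rewrites a bound on the measure of a clopen class as an inequality of integers, hence as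
  a decidable condition.\<close>

lemma mu_iff_card:
  "card {x. x < 2 ^ n \<and> Q x} * 2 ^ k \<le> (2::nat) ^ n \<longleftrightarrow> mu {X. Q (seg X n)} \<le> (1 / 2) ^ k"
proof -
  have "card {x. x < 2 ^ n \<and> Q x} * 2 ^ k \<le> (2::nat) ^ n \<longleftrightarrow>
      real (card {x. x < 2 ^ n \<and> Q x} * 2 ^ k) \<le> real (2 ^ n)"
    by (simp only: of_nat_le_iff)
  also have "\<dots> \<longleftrightarrow> real (card {x. x < 2 ^ n \<and> Q x}) / 2 ^ n \<le> (1 / 2) ^ k"
    by (simp add: field_simps power_divide)
  finally show ?thesis by (simp only: mu_seg)
qed

text \<open>Each program is allowed to contribute to the universal class only while it stays small.\<close>

theorem universal_class:
  obtains W where "sigma1_class empty_oracle W" "mu W \<le> 1 / 2" "\<And>X. X \<notin> W \<Longrightarrow> random_rel empty_oracle X"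
proof -
  obtain R where R: "decidable R"
      "\<And>X e. X \<in> pclass empty_oracle (fst e) (snd e) \<longleftrightarrow> (\<exists>n. R (e, n, seg X n, seg empty_oracle n))"
      "upward R"
    using sigma1_mono[OF sigma1_pclass[of empty_oracle]] by metis
  \<comment> \<open>Program \<open>c\<close> contributes its component \<open>c + 2\<close>; the
    bounds \<open>2^-(c + 2)\<close> sum to 1/2.\<close>
  define E where "E c n x \<longleftrightarrow> R ((c, c + 2), n, x, 0)" for c n x
  define T where "T c n \<longleftrightarrow> card {x. x < 2 ^ n \<and> E c n x} * 2 ^ (c + 2) \<le> 2 ^ n" for c n
  define V where "V c = {X. \<exists>n. E c n (seg X n) \<and> T c n}" for c
  have E_mono: "E c n (seg X n)" if "E c m (seg X m)" "m \<le> n" for c m n X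
    using upward_seg[OF R(3), of _ m X empty_oracle n] that by (simp add: E_def)
  have T_iff: "T c n \<longleftrightarrow> mu {X. E c n (seg X n)} \<le> (1 / 2) ^ (c + 2)" for c n
    unfolding T_def by (rule mu_iff_card)
  have muV: "mu (V c) \<le> (1 / 2) ^ (c + 2)" for c
  proof -
    define Q where "Q n x \<longleftrightarrow> (\<exists>m\<le>n. E c m (take_bit m x) \<and> T c m)" for n x
    have Qs: "Q n (seg X n) \<longleftrightarrow> (\<exists>m\<le>n. E c m (seg X m) \<and> T c m)" for n X
      unfolding Q_def by (auto simp: min_def)
    \<comment> \<open>Only stages satisfying \<open>T\<close> contribute. As \<open>E\<close> grows
      with the stage, the last of them up to \<open>n\<close> contains all that was contributed so
      far, and it is small.\<close>
    have "mu {X. Q n (seg X n)} \<le> (1 / 2) ^ (c + 2)" for n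
    proof (induction n)
      case 0
      have "{X. Q 0 (seg X 0)} \<subseteq> (if T c 0 then {X. E c 0 (seg X 0)} else {})"
        unfolding Qs by auto
      then show ?case using T_iff[of c 0] mu_mono[of "{X. Q 0 (seg X 0)}" "{X. E c 0 (seg X 0)}"]
        by (auto split: if_splits)
    next
      case (Suc n)
      show ?case
      proof (cases "T c (Suc n)")
        case True
        have "{X. Q (Suc n) (seg X (Suc n))} \<subseteq> {X. E c (Suc n) (seg X (Suc n))}"
          unfolding Qs using E_mono by blast
        then have "mu {X. Q (Suc n) (seg X (Suc n))} \<le> mu {X. E c (Suc n) (seg X (Suc n))}"
          by (rule mu_mono) simp
        with True show ?thesis unfolding T_iff by linarith
      next
        case False
        then have "{X. Q (Suc n) (seg X (Suc n))} = {X. Q n (seg X n)}"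
          unfolding Qs by (auto simp: le_Suc_eq)
        with Suc show ?thesis by simp
      qed
    qed
    then have bound: "\<exists>N. \<forall>n\<ge>N. mu {X. Q n (seg X n)} \<le> (1 / 2) ^ (c + 2)" by blast
    have lim: "(\<lambda>n. mu {X. Q n (seg X n)}) \<longlonglongrightarrow> mu {X. \<exists>n. Q n (seg X n)}"
      by (rule mu_ex_seg_limit) (auto simp: Qs intro: order_trans)
    have "{X. \<exists>n. Q n (seg X n)} = V c" unfolding Qs V_def by auto
    then show ?thesis using LIMSEQ_le_const2[OF lim bound] by simp
  qed
  define W where "W = (\<Union>c. V c)"
  show ?thesis
  proof
    have "sigma1_class empty_oracle {X. \<exists>w. (\<lambda>z. E (fst (fst (snd z))) (snd (fst (snd z))) (fst (snd (snd z))) \<and>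
        T (fst (fst (snd z))) (snd (fst (snd z))))
        (0::nat, w, seg X (snd (snd (0::nat, w))), seg empty_oracle (snd (snd (0::nat, w))))}"
      unfolding mem_Collect_eq
    proof (rule sigma1_gen)
      show "decidable (\<lambda>z. E (fst (fst (snd z))) (snd (fst (snd z))) (fst (snd (snd z))) \<and>
        T (fst (fst (snd z))) (snd (fst (snd z))))"
        unfolding E_def T_def by (intro comp_intros decidable_comp[OF R(1)])
      show "computable (\<lambda>z :: nat \<times> nat \<times> nat. snd (snd z))" by (intro comp_intros)
    qed simp
    also have "{X. \<exists>w. (\<lambda>z. E (fst (fst (snd z))) (snd (fst (snd z))) (fst (snd (snd z))) \<and>
        T (fst (fst (snd z))) (snd (fst (snd z))))
        (0::nat, w, seg X (snd (snd (0::nat, w))), seg empty_oracle (snd (snd (0::nat, w))))} = W"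
      unfolding W_def V_def by auto
    finally show "sigma1_class empty_oracle W" .
    show "mu W \<le> 1 / 2"
      unfolding W_def
    proof (rule mu_UN_le[OF _ muV])
      show "V c \<in> sets coin_measure" for c unfolding V_def by (rule sets_ex_seg)
      have "(\<lambda>c. (1 / 4) * (1 / 2 :: real) ^ c) sums (1 / 4 * 2)"
        by (intro sums_mult) (use geometric_sums[of "1 / 2 :: real"] in simp)
      then show "(\<lambda>c. (1 / 2 :: real) ^ (c + 2)) sums (1 / 2)"
        by (simp add: power_add power2_eq_square mult.commute)
    qed
    show "random_rel empty_oracle X" if "X \<notin> W" for X
    proof (rule ccontr)
      assume "\<not> random_rel empty_oracle X"
      then obtain U where U: "sigma1 empty_oracle (\<lambda>X n. X \<in> U n)" "\<And>n. mu (U n) \<le> (1 / 2) ^ n"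
        "\<And>n. X \<in> U n" by (rule not_randomE) blast
      then obtain p where "\<And>n. U n = pclass empty_oracle (pcode p) n"
        unfolding uniformly_Sigma1_iff[symmetric] uniformly_Sigma1_def pclass_pcode by blast
      then have UE: "Y \<in> U (pcode p + 2) \<longleftrightarrow> (\<exists>n. E (pcode p) n (seg Y n))" for Y
        using R(2)[of Y "(pcode p, pcode p + 2)"] by (simp add: E_def)
      then obtain n where n: "E (pcode p) n (seg X n)" using U(3) by blast
      have "mu {Y. E (pcode p) n (seg Y n)} \<le> mu (U (pcode p + 2))"
      proof (rule mu_mono)
        show "U (pcode p + 2) \<in> sets coin_measure"
          using sigma1_sets[OF U(1), of "pcode p + 2"] by simp
      qed (use UE in blast)
      with U(2)[of "pcode p + 2"] have "T (pcode p) n" unfolding T_iff by linarith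
      with n have "X \<in> W" unfolding W_def V_def by blast
      with that show False by simp
    qed
  qed
qed

text \<open>A null effectively closed class contains no 1-random sequence: its clopen approximations
  shrink to measure 0, and stages at which they are below \<open>2^-n\<close> can be found
  effectively, which gives a test that captures \<open>Y\<close>.\<close>

lemma random_positive:
  assumes W: "sigma1_class empty_oracle W" and Y: "Y \<notin> W" "random_rel empty_oracle Y"
  shows "mu {X. seg X l = seg Y l \<and> X \<notin> W} > 0"
proof (rule ccontr)
  assume "\<not> ?thesis"
  then have null: "mu {X. seg X l = seg Y l \<and> X \<notin> W} = 0"
    by (simp add: order.antisym not_less)
  obtain R where R: "decidable R" "\<And>X. X \<in> W \<longleftrightarrow> (\<exists>n. R (n, seg X n, seg empty_oracle n))"
    "\<And>m n X B. R (m, seg X m, seg B m) \<Longrightarrow> m \<le> n \<Longrightarrow> R (n, seg X n, seg B n)"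
    using sigma1_classE[OF W] by metis
  have mono: "R (m, seg X m, 0) \<Longrightarrow> m \<le> n \<Longrightarrow> R (n, seg X n, 0)" for m n X
    using R(3)[of m X empty_oracle n] by simp
  let ?C = "\<lambda>s. {X. seg X l = seg Y l \<and> \<not> R (s, seg X s, 0)}"
  let ?K = "\<lambda>s. {x. x < 2 ^ s \<and> (take_bit l x = seg Y l \<and> \<not> R (s, x, 0))}"
  have C: "?C s = {X. (\<lambda>x. take_bit l x = seg Y l \<and> \<not> R (s, x, 0)) (seg X s)}" if "l \<le> s" for s
    using that by (simp add: min_def)
  have Cs: "?C s \<in> sets coin_measure" for s
    using sets.Int[OF sets_seg[of "\<lambda>x. x = seg Y l" l] sets_seg[of "\<lambda>x. \<not> R (s, x, 0)" s]]
    by (simp add: Collect_conj_eq)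
  have "(\<lambda>s. mu (?C s)) \<longlonglongrightarrow> mu (\<Inter>s. ?C s)"
    by (rule coin_prob.finite_Lim_measure_decseq) (use Cs mono in \<open>auto simp: decseq_def\<close>)
  also have "(\<Inter>s. ?C s) = {X. seg X l = seg Y l \<and> X \<notin> W}"
    unfolding R(2) by auto
  finally have lim: "(\<lambda>s. mu (?C s)) \<longlonglongrightarrow> 0" using null by simp
  \<comment> \<open>The search terminates because the measures tend to 0; the requirement
    \<open>l \<le> s\<close> makes the cylinder condition readable from
    \<open>seg X s\<close>.\<close>
  define s where "s n = (LEAST s. l \<le> s \<and> card (?K s) * 2 ^ n \<le> 2 ^ s)" for n
  have ex: "\<exists>s. l \<le> s \<and> card (?K s) * 2 ^ n \<le> 2 ^ s" for n
  proof -
    have "eventually (\<lambda>s. mu (?C s) < (1 / 2) ^ n) sequentially"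
      by (rule order_tendstoD(2)[OF lim]) simp
    then have "eventually (\<lambda>s. mu (?C s) < (1 / 2) ^ n \<and> l \<le> s) sequentially"
      using eventually_ge_at_top by (rule eventually_conj)
    then obtain s where "mu (?C s) < (1 / 2) ^ n" "l \<le> s"
      by (auto simp: eventually_sequentially)
    then show ?thesis
      unfolding C[OF \<open>l \<le> s\<close>] mu_iff_card by (intro exI[of _ s]) simp
  qed
  have s': "l \<le> s n \<and> card (?K (s n)) * 2 ^ n \<le> 2 ^ s n" for n
    unfolding s_def by (rule LeastI_ex[OF ex])
  then have s: "l \<le> s n" for n by blast
  have muC: "mu (?C (s n)) \<le> (1 / 2) ^ n" for n
    using s'[of n] unfolding C[OF s] mu_iff_card by blast
  have "computable s"
    unfolding s_def by (rule computable_Least) (intro comp_intros decidable_comp[OF R(1)], rule ex)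
  have "sigma1 empty_oracle (\<lambda>X n. (\<lambda>z. take_bit l (fst (snd z)) = seg Y l \<and>
      \<not> R (s (fst z), fst (snd z), 0)) (n, seg X (s n), seg empty_oracle (s n)))"
    by (rule sigma1_seg) (intro comp_intros decidable_comp[OF R(1)] computable_comp[OF \<open>computable s\<close>] \<open>computable s\<close>)+
  then have "sigma1 empty_oracle (\<lambda>X n. X \<in> ?C (s n))"
    using s by (simp add: min_def)
  moreover have "Y \<in> ?C (s n)" for n using Y(1) unfolding R(2) by simp
  ultimately have "\<not> random_rel empty_oracle Y"
    using muC by (intro not_random_if[of _ "\<lambda>n. ?C (s n)"])
  with Y(2) show False by simp
qed

lemma limit_point:
  assumes Z: "\<And>k. seg (Z (Suc k)) (l k) = seg (Z k) (l k)" and l: "\<And>k. l k < (l (Suc k) :: nat)"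
  obtains X where "\<And>k. seg X (l k) = seg (Z k) (l k)"
proof
  have mono: "l k \<le> l m" if "k \<le> m" for k m
    by (rule lift_Suc_mono_le[of l, OF _ that]) (rule less_imp_le[OF l])
  have ge: "k \<le> l k" for k by (induction k) (use l le_less_trans Suc_leI in blast)+
  have agree: "seg (Z m) (l k) = seg (Z k) (l k)" if "k \<le> m" for k m
    using that
  proof (induction m rule: dec_induct)
    case (step m)
    then show ?case using seg_eq_mono[OF Z mono[of k m]] by simp
  qed simp
  \<comment> \<open>Bit \<open>i\<close> is final from stage \<open>Suc i\<close> on, because
    \<open>i < l (Suc i)\<close>.\<close>
  show "seg (\<lambda>i. Z (Suc i) i) (l k) = seg (Z k) (l k)" for k
    unfolding seg_eq_iff
  proof (intro allI impI)
    fix i assume i: "i < l k"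
    have i': "i < l (Suc i)" using ge[of "Suc i"] by simp
    show "Z (Suc i) i = Z k i"
      using agree[of k "Suc i"] agree[of "Suc i" k] i i' unfolding seg_eq_iff by (meson nat_le_linear)
  qed
qed

lemma mu_slice_less_1:
  assumes W: "sigma1_class A W" and pos: "mu {X. seg X l = seg Z l \<and> X \<notin> W} > 0"
  shows "sigma1_class A {Y. comb_seq l Z Y \<in> W}" "mu {Y. comb_seq l Z Y \<in> W} < 1"
proof -
  \<comment> \<open>Only \<open>l\<close> bits of \<open>Z\<close> matter, so the arbitrary sequence
    \<open>Z\<close> can be replaced by a constant number.\<close>
  have "comb_seq l (bit (seg Z l)) Y = comb_seq l Z Y" for Y
    by (auto simp: comb_seq_def fun_eq_iff)
  then show "sigma1_class A {Y. comb_seq l Z Y \<in> W}"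
    using sigma1_comb_seq[OF W, of "\<lambda>_. l" "\<lambda>_. seg Z l"] by (simp add: computable_const)
  have s: "UNIV - W \<in> sets coin_measure" using sigma1_class_sets[OF W] by auto
  have "mu {X. seg X l = seg Z l \<and> X \<in> UNIV - W} = mu {Y. comb_seq l Z Y \<in> UNIV - W} / 2 ^ l"
    by (rule comb_seq_vimage(2)[OF s])
  with pos have "mu {Y. comb_seq l Z Y \<notin> W} > 0" by (simp add: zero_less_divide_iff)
  moreover have "mu {Y. comb_seq l Z Y \<notin> W} = 1 - mu {Y. comb_seq l Z Y \<in> W}"
    using coin_prob.prob_compl[OF comb_seq_vimage(1)[OF sigma1_class_sets[OF W], of l Z]]
    by (simp add: Compl_eq_Diff_UNIV[symmetric] Collect_neg_eq)
  ultimately show "mu {Y. comb_seq l Z Y \<in> W} < 1" by simp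
qed

text \<open>The cover is a slice \<open>{Y. comb_seq l Z Y \<in> W}\<close> with
  \<open>Z \<notin> W\<close>. If no such slice contained \<open>U\<close>, minimal strings of
  \<open>U\<close> could be appended for ever while each prefix keeps an extension outside the open
  class \<open>W\<close>. The limit would lie outside \<open>W\<close>, hence be 1-random and by
  lowness \<open>A\<close>-random, against \<open>kucera_chain\<close>. The slice has measure below
  1 by \<open>random_positive\<close>.\<close>

theorem low_cover:
  assumes low: "low_for_1_randomness A" and U: "sigma1_class A U" "mu U < 1"
  obtains W where "sigma1_class empty_oracle W" "mu W < 1" "U \<subseteq> W"
proof -
  obtain W where W: "sigma1_class empty_oracle W" "mu W \<le> 1 / 2"
    "\<And>X. X \<notin> W \<Longrightarrow> random_rel empty_oracle X"
    using universal_class by metis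
  obtain R where R: "decidable R" "\<And>X. X \<in> U \<longleftrightarrow> (\<exists>n. R (n, seg X n, seg A n))"
    using sigma1_classE[OF U(1)] by metis
  have R0: "\<not> R (0, 0, 0)"
  proof
    assume "R (0, 0, 0)"
    then have "U = UNIV" using R(2) by (auto intro!: exI[of _ 0])
    with U(2) show False by simp
  qed
  have "\<exists>Z l. Z \<notin> W \<and> (\<forall>Y\<in>U. comb_seq l Z Y \<in> W)"
  proof (rule ccontr)
    assume "\<not> ?thesis"
    then have no: "\<exists>Y\<in>U. comb_seq l Z Y \<notin> W" if "Z \<notin> W" for Z l using that by blast
    have "W \<noteq> UNIV" using W(2) by auto
    then obtain Z0 where Z0: "Z0 \<notin> W" by blast
    \<comment> \<open>A state is a sequence outside \<open>W\<close> with the position up to which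
      it is final. The clause for \<open>k = 0\<close> pins the first boundary to 0, which the
      choice principle would leave open.\<close>
    have "\<exists>f :: nat \<Rightarrow> cantor \<times> nat. \<forall>k. (fst (f k) \<notin> W \<and> (k = 0 \<longrightarrow> snd (f k) = 0)) \<and>
      (seg (fst (f (Suc k))) (snd (f k)) = seg (fst (f k)) (snd (f k)) \<and>
       snd (f k) < snd (f (Suc k)) \<and>
       first_hit R A (snd (f (Suc k)) - snd (f k))
        (seg (shift (snd (f k)) (fst (f (Suc k)))) (snd (f (Suc k)) - snd (f k))))"
    proof (rule dependent_nat_choice)
      show "\<exists>x. fst x \<notin> W \<and> ((0::nat) = 0 \<longrightarrow> snd x = (0::nat))"
        using Z0 by (intro exI[of _ "(Z0, 0)"]) simp
    next
      fix x :: "cantor \<times> nat" and k :: nat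
      assume "fst x \<notin> W \<and> (k = 0 \<longrightarrow> snd x = 0)"
      then obtain Y where Y: "Y \<in> U" "comb_seq (snd x) (fst x) Y \<notin> W" using no by blast
      then obtain n where n: "first_hit R A n (seg Y n)" unfolding R(2) ex_first_hit by blast
      with R0 have "n > 0" by (cases n) (auto simp: first_hit_def)
      with Y n show "\<exists>y. (fst y \<notin> W \<and> (Suc k = 0 \<longrightarrow> snd y = 0)) \<and>
        (seg (fst y) (snd x) = seg (fst x) (snd x) \<and> snd x < snd y \<and>
         first_hit R A (snd y - snd x) (seg (shift (snd x) (fst y)) (snd y - snd x)))"
        by (intro exI[of _ "(comb_seq (snd x) (fst x) Y, snd x + n)"]) (simp add: seg_comb_seq_le)
    qed
    then obtain f :: "nat \<Rightarrow> cantor \<times> nat" where f: "\<And>k. fst (f k) \<notin> W" "snd (f 0) = 0"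
      "\<And>k. seg (fst (f (Suc k))) (snd (f k)) = seg (fst (f k)) (snd (f k))"
      "\<And>k. snd (f k) < snd (f (Suc k))"
      "\<And>k. first_hit R A (snd (f (Suc k)) - snd (f k))
        (seg (shift (snd (f k)) (fst (f (Suc k)))) (snd (f (Suc k)) - snd (f k)))"
      by blast
    obtain X where X: "\<And>k. seg X (snd (f k)) = seg (fst (f k)) (snd (f k))"
      using limit_point[of "\<lambda>k. fst (f k)" "\<lambda>k. snd (f k)", OF f(3,4)] by metis
    have ge: "k \<le> snd (f k)" for k by (induction k) (use f(4) le_less_trans Suc_leI in blast)+
    have "X \<notin> W"
    proof
      assume "X \<in> W"
      moreover obtain S where S: "\<And>X. X \<in> W \<longleftrightarrow> (\<exists>n. S (n, seg X n, seg empty_oracle n))"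
        using sigma1_classE[OF W(1)] by metis
      ultimately obtain n where n: "S (n, seg X n, seg empty_oracle n)" by blast
      have "seg X n = seg (fst (f n)) n" by (rule seg_eq_mono[OF X ge])
      with n have "fst (f n) \<in> W" unfolding S by metis
      with f(1) show False by simp
    qed
    with W(3) low have "random_rel A X" unfolding low_for_1_randomness_def by blast
    moreover have "\<not> random_rel A X"
    proof (rule kucera_chain[OF R(1)])
      show "mu {X. \<exists>n. R (n, seg X n, seg A n)} < 1"
      proof -
        have "U = {X. \<exists>n. R (n, seg X n, seg A n)}" using R(2) by blast
        with U(2) show ?thesis by simp
      qed
      show "0 \<in> range (\<lambda>k. snd (f k))" using f(2) by (metis rangeI)
      fix l assume "l \<in> range (\<lambda>k. snd (f k))"
      then obtain k where l: "l = snd (f k)" by blast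
      let ?n = "snd (f (Suc k)) - l"
      have "?n + l = snd (f (Suc k))" using f(4)[of k] l by simp
      then have "seg (shift l X) ?n = seg (shift l (fst (f (Suc k)))) ?n"
        using X[of "Suc k"] by (simp add: seg_shift)
      with f(5)[of k] l have "first_hit R A ?n (seg (shift l X) ?n)" by simp
      moreover have "l + ?n \<in> range (\<lambda>k. snd (f k))" using f(4)[of k] l by simp
      ultimately show "\<exists>n. first_hit R A n (seg (shift l X) n) \<and> l + n \<in> range (\<lambda>k. snd (f k))"
        by blast
    qed
    ultimately show False by simp
  qed
  then obtain Z l where Z: "Z \<notin> W" "\<forall>Y\<in>U. comb_seq l Z Y \<in> W" by blast
  have pos: "mu {X. seg X l = seg Z l \<and> X \<notin> W} > 0"
    by (rule random_positive[OF W(1) Z(1) W(3)[OF Z(1)]])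
  show ?thesis
    by (rule that[OF mu_slice_less_1[OF W(1) pos]]) (use Z(2) in blast)
qed

subsection \<open>Covering weighted sets\<close>

lemma finite_enc_less: "finite {v :: 'v::cenc. enc v < n}"
proof (rule finite_subset)
  show "{v :: 'v. enc v < n} \<subseteq> dec ` {..<n}"
  proof
    fix v :: 'v assume "v \<in> {v. enc v < n}"
    then show "v \<in> dec ` {..<n}" using dec_enc[of v] by (metis imageI lessThan_iff mem_Collect_eq)
  qed
qed simp

text \<open>Stated through finite subsets, so that infinite \<open>J\<close> cause no summability
  conditions.\<close>

definition bounded_weight :: "('v \<Rightarrow> nat) \<Rightarrow> 'v set \<Rightarrow> real \<Rightarrow> bool" where
  "bounded_weight f J M \<longleftrightarrow> (\<forall>F. finite F \<longrightarrow> F \<subseteq> J \<longrightarrow> (\<Sum>v\<in>F. (1 / 2) ^ f v) \<le> M)"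

lemma bounded_weightD: "bounded_weight f J M \<Longrightarrow> finite F \<Longrightarrow> F \<subseteq> J \<Longrightarrow> (\<Sum>v\<in>F. (1 / 2) ^ f v) \<le> M"
  by (simp add: bounded_weight_def)

text \<open>A finite set whose weight comes within \<open>e\<close> of the supremum leaves at most
  \<open>e\<close> for everything with larger codes.\<close>

lemma bounded_weight_tail:
  fixes f :: "'v::cenc \<Rightarrow> nat"
  assumes "bounded_weight f J M" "e > 0"
  obtains N where "bounded_weight f {v \<in> J. N \<le> enc v} e"
proof -
  let ?S = "{\<Sum>v\<in>F. (1 / 2 :: real) ^ f v |F. finite F \<and> F \<subseteq> J}"
  have bdd: "bdd_above ?S" unfolding bdd_above_def
    using bounded_weightD[OF assms(1)] by blast
  have "?S \<noteq> {}" by (auto intro!: exI[of _ "{}"])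
  with assms(2) obtain F where F: "finite F" "F \<subseteq> J" "Sup ?S - e < (\<Sum>v\<in>F. (1 / 2) ^ f v)"
    using less_cSup_iff[OF _ bdd, of "Sup ?S - e"] by auto
  define N where "N = Suc (\<Sum>v\<in>F. enc v)"
  have "bounded_weight f {v \<in> J. N \<le> enc v} e"
    unfolding bounded_weight_def
  proof (intro allI impI)
    fix G assume G: "finite G" "G \<subseteq> {v \<in> J. N \<le> enc v}"
    have "v \<notin> G" if "v \<in> F" for v
    proof
      assume "v \<in> G"
      with G(2) have "N \<le> enc v" by blast
      moreover have "enc v \<le> (\<Sum>v\<in>F. enc v)" using that F(1) by (intro member_le_sum) auto
      ultimately show False by (simp add: N_def)
    qed
    then have "(\<Sum>v\<in>F \<union> G. (1 / 2 :: real) ^ f v) = (\<Sum>v\<in>F. (1 / 2) ^ f v) + (\<Sum>v\<in>G. (1 / 2) ^ f v)"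
      using F(1) G(1) by (intro sum.union_disjoint) auto
    moreover have "(\<Sum>v\<in>F \<union> G. (1 / 2 :: real) ^ f v) \<le> Sup ?S"
      by (rule cSup_upper[OF _ bdd]) (use F G in blast)
    ultimately show "(\<Sum>v\<in>G. (1 / 2) ^ f v) \<le> e" using F(3) by linarith
  qed
  then show ?thesis by (rule that)
qed

text \<open>Koenig's lemma: \<open>good k Z\<close> says that the prefix of length \<open>k\<close>
  has extensions satisfying every level. If both one-bit extensions failed, a level beyond both
  failures would contradict this.\<close>

lemma cantor_compact:
  assumes ex: "\<And>n. \<exists>X. Q n (seg X n)"
    and anti: "\<And>m n X. m \<le> n \<Longrightarrow> Q n (seg X n) \<Longrightarrow> Q m (seg X m)"
  shows "\<exists>X. \<forall>n. Q n (seg X n)"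
proof -
  define good where "good k Z \<longleftrightarrow> (\<forall>n. \<exists>X. seg X k = seg Z k \<and> Q n (seg X n))" for k Z
  have "\<exists>Z :: nat \<Rightarrow> cantor. \<forall>k. good k (Z k) \<and> seg (Z (Suc k)) k = seg (Z k) k"
  proof (rule dependent_nat_choice)
    show "\<exists>Z. good 0 Z" using ex by (simp add: good_def)
  next
    fix Z :: cantor and k :: nat assume Z: "good k Z"
    show "\<exists>Z'. good (Suc k) Z' \<and> seg Z' k = seg Z k"
    proof (rule ccontr)
      assume "\<not> ?thesis"
      moreover have "seg (Z(k := b)) k = seg Z k" for b by (auto simp: seg_eq_iff)
      ultimately have "\<not> good (Suc k) (Z(k := b))" for b by blast
      then have "\<exists>n. \<forall>X. seg X (Suc k) = seg (Z(k := b)) (Suc k) \<longrightarrow> \<not> Q n (seg X n)" for b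
        unfolding good_def by blast
      then obtain n where n: "\<And>b X. seg X (Suc k) = seg (Z(k := b)) (Suc k) \<Longrightarrow> \<not> Q (n b) (seg X (n b))"
        by metis
      obtain X where X: "seg X k = seg Z k" "Q (max (n True) (n False)) (seg X (max (n True) (n False)))"
        using Z unfolding good_def by blast
      have "n (X k) \<le> max (n True) (n False)" by (cases "X k") auto
      then have "Q (n (X k)) (seg X (n (X k)))" using X(2) anti by blast
      moreover have "seg X (Suc k) = seg (Z(k := X k)) (Suc k)"
        using X(1) by (auto simp: seg_eq_iff less_Suc_eq)
      ultimately show False using n by blast
    qed
  qed
  then obtain Z where Z: "\<And>k. good k (Z k)" "\<And>k. seg (Z (Suc k)) k = seg (Z k) k" by blast
  obtain X where X: "\<And>k. seg X k = seg (Z k) k"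
    using limit_point[of Z "\<lambda>k. k", OF Z(2)] by auto
  have "Q k (seg X k)" for k
    using Z(1)[of k] X unfolding good_def by metis
  then show ?thesis by blast
qed

text \<open>The events \<open>block f v\<close> are independent and of measure \<open>2\<^sup>-\<^sup>f\<^sup>v\<close>, so a class of
  measure less than \<open>1\<close> contains only finitely much of their total weight.\<close>

definition block :: "('v::cenc \<Rightarrow> nat) \<Rightarrow> 'v \<Rightarrow> cantor set" where
  "block f v = {X. \<forall>j<f v. X (prod_encode (enc v, j))}"

lemma block_emb: "block f v = prod_emb UNIV (\<lambda>_. measure_pmf (bernoulli_pmf (1 / 2)))
    ((\<lambda>j. prod_encode (enc v, j)) ` {..<f v}) (\<Pi>\<^sub>E i\<in>(\<lambda>j. prod_encode (enc v, j)) ` {..<f v}. {True})"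
  unfolding block_def by (rule set_eqI, unfold prod_emb_iff PiE_iff) auto

lemma mu_block: "mu (block f v) = (1 / 2) ^ f v"
proof -
  have "mu (block f v) = (\<Prod>i\<in>(\<lambda>j. prod_encode (enc v, j)) ` {..<f v}.
      measure_pmf.prob (bernoulli_pmf (1 / 2)) {True})"
    unfolding coin_measure_def block_emb by (rule coin.measure_PiM_emb) auto
  also have "\<dots> = (1 / 2) ^ card ((\<lambda>j. prod_encode (enc v, j)) ` {..<f v})"
    by (simp add: measure_pmf_single pmf_bernoulli_half)
  also have "card ((\<lambda>j. prod_encode (enc v, j)) ` {..<f v}) = f v"
    by (subst card_image) (auto simp: inj_on_def)
  finally show ?thesis .
qed

lemma block_sets [simp]: "block f v \<in> sets coin_measure"
  unfolding coin_measure_def block_emb by (rule sets_PiM_I) auto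

lemma coin_indep: "coin_prob.indep_vars (\<lambda>_. measure_pmf (bernoulli_pmf (1 / 2))) (\<lambda>i X. X i) UNIV"
proof (subst coin_prob.indep_vars_iff_distr_eq_PiM)
  let ?B = "measure_pmf (bernoulli_pmf (1 / 2))"
  show "(\<lambda>X. X i) \<in> measurable coin_measure ?B" for i
    unfolding coin_measure_def by (rule measurable_component_singleton) simp
  have "distr coin_measure (PiM UNIV (\<lambda>_. ?B)) (\<lambda>X. \<lambda>i\<in>UNIV. X i) = coin_measure"
    by (simp add: coin_measure_def distr_id restrict_UNIV)
  moreover have "distr coin_measure ?B (\<lambda>X. X i) = ?B" for i
    unfolding coin_measure_def by (rule coin.PiM_component) simp
  ultimately show "distr coin_measure (PiM UNIV (\<lambda>_. ?B)) (\<lambda>X. \<lambda>i\<in>UNIV. X i) =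
      (\<Pi>\<^sub>M i\<in>UNIV. distr coin_measure ?B (\<lambda>X. X i))"
    by (simp add: coin_measure_def)
qed simp

lemma mu_avoid_blocks:
  assumes "finite F"
  shows "mu {X. \<forall>v\<in>F. X \<notin> block f v} = (\<Prod>v\<in>F. 1 - (1 / 2) ^ f v)"
proof (cases "F = {}")
  case False
  let ?B = "measure_pmf (bernoulli_pmf (1 / 2))"
  define K where "K v = (\<lambda>j. prod_encode (enc v, j)) ` {..<f v}" for v
  let ?Y = "\<lambda>v X. restrict (\<lambda>i. X i) (K v)"
  define N where "N v = {g \<in> space (PiM (K v) (\<lambda>_. ?B)). \<not> (\<forall>i\<in>K v. g i)}" for v
  have "coin_prob.indep_vars (\<lambda>v. PiM (K v) (\<lambda>_. ?B)) ?Y F"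
    by (rule coin_prob.indep_vars_restrict[OF coin_indep]) (auto simp: disjoint_family_on_def K_def)
  moreover have "N v \<in> sets (PiM (K v) (\<lambda>_. ?B))" for v
  proof -
    have "finite (K v)" by (simp add: K_def)
    then have "sets (PiM (K v) (\<lambda>_. ?B)) = sets (PiM (K v) (\<lambda>_. count_space UNIV))"
      by (intro sets_PiM_cong) auto
    moreover have "g \<in> (\<Pi>\<^sub>E i\<in>K v. {True}) \<longleftrightarrow> (\<forall>i\<in>K v. g i)"
      if "g \<in> space (PiM (K v) (\<lambda>_. ?B))" for g
      using that unfolding space_PiM PiE_iff by auto
    then have "N v = space (PiM (K v) (\<lambda>_. ?B)) - (\<Pi>\<^sub>E i\<in>K v. {True})"
      unfolding N_def by blast
    moreover have "(\<Pi>\<^sub>E i\<in>K v. {True}) \<in> sets (PiM (K v) (\<lambda>_. ?B))"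
      using \<open>finite (K v)\<close> by (intro sets_PiM_I_finite) auto
    ultimately show ?thesis by auto
  qed
  ultimately have "mu (\<Inter>v\<in>F. ?Y v -` N v \<inter> space coin_measure) =
      (\<Prod>v\<in>F. mu (?Y v -` N v \<inter> space coin_measure))"
    using False assms by (intro coin_prob.indep_varsD_finite) auto
  moreover have Y: "?Y v -` N v \<inter> space coin_measure = UNIV - block f v" for v
    by (auto simp: N_def space_PiM block_def K_def)
  moreover have "mu (UNIV - block f v) = 1 - (1 / 2) ^ f v" for v
    using coin_prob.prob_compl[of "block f v"] by (simp add: mu_block)
  moreover have "(\<Inter>v\<in>F. UNIV - block f v) = {X. \<forall>v\<in>F. X \<notin> block f v}" by auto
  ultimately show ?thesis by simp
qed simp

text \<open>By independence, avoiding all blocks of \<open>F\<close> has probability the product of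
  \<open>1 - (1/2) ^ f v\<close>, which is at most \<open>exp\<close> of minus their weight; yet it
  is at least \<open>1 - mu W\<close>, because the complement of \<open>W\<close> avoids
  them.\<close>

lemma weight_of_contained_blocks:
  assumes W: "W \<in> sets coin_measure" "mu W < 1"
  shows "bounded_weight f {v. block f v \<subseteq> W} (- ln (1 - mu W))"
  unfolding bounded_weight_def
proof (intro allI impI)
  fix F assume F: "finite F" "F \<subseteq> {v. block f v \<subseteq> W}"
  have s: "{X. \<forall>v\<in>F. X \<notin> block f v} \<in> sets coin_measure"
  proof -
    have "{X. \<forall>v\<in>F. X \<notin> block f v} = UNIV - (\<Union>v\<in>F. block f v)" by auto
    then show ?thesis using F(1) by (auto intro!: sets.Diff sets.finite_UN)
  qed
  have "1 - mu W = mu (UNIV - W)" using coin_prob.prob_compl[OF W(1)] by simp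
  also have "\<dots> \<le> mu {X. \<forall>v\<in>F. X \<notin> block f v}"
    by (rule mu_mono[OF _ s]) (use F in auto)
  also have "\<dots> = (\<Prod>v\<in>F. 1 - (1 / 2) ^ f v)" by (rule mu_avoid_blocks[OF F(1)])
  also have "\<dots> \<le> (\<Prod>v\<in>F. exp (- ((1 / 2) ^ f v)))"
    by (rule prod_mono) (auto simp: power_le_one intro: order_trans[OF _ exp_ge_add_one_self])
  also have "\<dots> = exp (- (\<Sum>v\<in>F. (1 / 2) ^ f v))"
    using F(1) by (simp add: exp_sum sum_negf[symmetric])
  finally have "ln (1 - mu W) \<le> - (\<Sum>v\<in>F. (1 / 2) ^ f v)"
    using W(2) by (metis diff_gt_0_iff_gt ln_exp ln_mono)
  then show "(\<Sum>v\<in>F. (1 / 2) ^ f v) \<le> - ln (1 - mu W)" by simp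
qed

lemma bounded_weight_Un:
  assumes "bounded_weight f I M" "bounded_weight f J N"
  shows "bounded_weight f (I \<union> J) (M + N)"
  unfolding bounded_weight_def
proof (intro allI impI)
  fix F assume F: "finite F" "F \<subseteq> I \<union> J"
  have "(\<Sum>v\<in>F. (1 / 2 :: real) ^ f v) = (\<Sum>v\<in>F \<inter> I. (1 / 2) ^ f v) + (\<Sum>v\<in>F - I. (1 / 2) ^ f v)"
    using F(1) by (rule sum.Int_Diff)
  moreover have "(\<Sum>v\<in>F \<inter> I. (1 / 2 :: real) ^ f v) \<le> M"
    by (rule bounded_weightD[OF assms(1)]) (use F in auto)
  moreover have "(\<Sum>v\<in>F - I. (1 / 2 :: real) ^ f v) \<le> N"
    by (rule bounded_weightD[OF assms(2)]) (use F in auto)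
  ultimately show "(\<Sum>v\<in>F. (1 / 2) ^ f v) \<le> M + N" by linarith
qed

lemma bounded_weight_finite:
  assumes "finite I" shows "bounded_weight f I (card I)"
  unfolding bounded_weight_def
proof (intro allI impI)
  fix F assume F: "finite F" "F \<subseteq> I"
  have "(\<Sum>v\<in>F. (1 / 2 :: real) ^ f v) \<le> (\<Sum>v\<in>F. 1)" by (intro sum_mono) (simp add: power_le_one)
  also have "\<dots> \<le> card I" using card_mono[OF assms F(2)] by simp
  finally show "(\<Sum>v\<in>F. (1 / 2 :: real) ^ f v) \<le> card I" .
qed

lemma bounded_weight_subset: "bounded_weight f J M \<Longrightarrow> I \<subseteq> J \<Longrightarrow> bounded_weight f I M"
  unfolding bounded_weight_def by blast

lemma mu_UN_weight:
  fixes f :: "'v::cenc \<Rightarrow> nat"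
  assumes B: "\<And>v. B v \<in> sets coin_measure" "\<And>v. v \<in> J \<Longrightarrow> mu (B v) \<le> (1 / 2) ^ f v"
    and wt: "bounded_weight f J M"
  shows "mu (\<Union>v\<in>J. B v) \<le> M"
proof -
  define Vn where "Vn n = (\<Union>v\<in>{v \<in> J. enc v < n}. B v)" for n
  have fin: "finite {v \<in> J. enc v < n}" for n
    by (rule finite_subset[OF _ finite_enc_less[of n]]) auto
  have "mu (Vn n) \<le> M" for n
  proof -
    have "mu (Vn n) \<le> (\<Sum>v\<in>{v \<in> J. enc v < n}. mu (B v))"
      unfolding Vn_def by (rule coin_prob.finite_measure_subadditive_finite[OF fin]) (use B(1) in auto)
    also have "\<dots> \<le> (\<Sum>v\<in>{v \<in> J. enc v < n}. (1 / 2) ^ f v)"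
      by (rule sum_mono) (use B(2) in auto)
    also have "\<dots> \<le> M"
      by (rule bounded_weightD[OF wt fin]) auto
    finally show ?thesis .
  qed
  moreover have "(\<lambda>n. mu (Vn n)) \<longlonglongrightarrow> mu (\<Union>n. Vn n)"
  proof (rule coin_prob.finite_Lim_measure_incseq)
    show "range Vn \<subseteq> sets coin_measure"
      unfolding Vn_def using fin B(1) by (auto intro!: sets.finite_UN)
    show "incseq Vn" unfolding Vn_def incseq_def by (auto intro: less_le_trans)
  qed
  moreover have "(\<Union>n. Vn n) = (\<Union>v\<in>J. B v)" unfolding Vn_def by auto
  ultimately show ?thesis using LIMSEQ_le_const2[of "\<lambda>n. mu (Vn n)" "mu (\<Union>v\<in>J. B v)" M] by auto
qed

text \<open>Requests become blocks, the union of blocks is covered by some \<open>W\<close>, and the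
  requests whose block lies in \<open>W\<close> are read off. Only a tail of \<open>I\<close> of
  weight at most 1/2 is coded, to get measure below 1; the finitely many smaller codes are added to
  \<open>J\<close> outright.\<close>

theorem low_weight_cover:
  fixes f :: "'v::cenc \<Rightarrow> nat"
  assumes low: "low_for_1_randomness A" and I: "sigma1 A (\<lambda>X v. v \<in> I)" and f: "computable f"
    and wt: "bounded_weight f I M"
  obtains J M' where "sigma1 empty_oracle (\<lambda>X v. v \<in> J)" "I \<subseteq> J" "bounded_weight f J M'"
proof -
  obtain N where N: "bounded_weight f {v \<in> I. N \<le> enc v} (1 / 2)"
    using bounded_weight_tail[OF wt, of "1 / 2"] by auto
  define U where "U = {X. \<exists>v. v \<in> I \<and> N \<le> enc v \<and> X \<in> block f v}"
  have sgU: "sigma1_class A U"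
    unfolding U_def block_def mem_Collect_eq
    by (intro sigma1_intros sigma1_comp[OF I] sigma1_bit comp_intros computable_comp[OF f])
  have "mu (\<Union>v\<in>{v \<in> I. N \<le> enc v}. block f v) \<le> 1 / 2"
    by (rule mu_UN_weight[OF _ _ N]) (simp_all add: mu_block)
  moreover have "(\<Union>v\<in>{v \<in> I. N \<le> enc v}. block f v) = U" unfolding U_def by auto
  ultimately have "mu U < 1" by simp
  then obtain W where W: "sigma1_class empty_oracle W" "mu W < 1" "U \<subseteq> W"
    using low_cover[OF low sgU] by metis
  obtain R where R: "decidable R" "\<And>X. X \<in> W \<longleftrightarrow> (\<exists>n. R (n, seg X n, seg empty_oracle n))"
    "\<And>m n X B. R (m, seg X m, seg B m) \<Longrightarrow> m \<le> n \<Longrightarrow> R (n, seg X n, seg B n)"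
    using sigma1_classE[OF W(1)] by metis
  \<comment> \<open>By compactness the block of \<open>v\<close> lies in \<open>W\<close> exactly if
    some level \<open>n\<close> shows this for all strings of length \<open>n\<close> compatible
    with it. That condition is c.e., whereas the inclusion quantifies over sequences.\<close>
  define J where "J = {v. enc v < N \<or> (\<exists>n. \<forall>y<2 ^ n.
    (\<forall>j<f v. prod_encode (enc v, j) < n \<longrightarrow> bit y (prod_encode (enc v, j))) \<longrightarrow> R (n, y, 0))}"
  show ?thesis
  proof
    show "sigma1 empty_oracle (\<lambda>X v. v \<in> J)"
      unfolding J_def mem_Collect_eq
      by (intro sigma1_intros comp_intros computable_comp[OF f] decidable_comp[OF R(1)])
    show "I \<subseteq> J"
    proof
      fix v assume v: "v \<in> I"
      show "v \<in> J"
      proof (rule ccontr)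
        assume "v \<notin> J"
        then have "N \<le> enc v" and ex: "\<exists>y<2 ^ n. (\<forall>j<f v. prod_encode (enc v, j) < n \<longrightarrow>
            bit y (prod_encode (enc v, j))) \<and> \<not> R (n, y, 0)" for n
          by (auto simp: J_def)
        define Q where "Q n y \<longleftrightarrow> (\<forall>j<f v. prod_encode (enc v, j) < n \<longrightarrow>
            bit y (prod_encode (enc v, j))) \<and> \<not> R (n, y, 0)" for n y
        have "\<exists>X. Q n (seg X n)" for n
        proof -
          from ex[of n] obtain y where "y < 2 ^ n" "Q n y" unfolding Q_def by blast
          then show ?thesis by (intro exI[of _ "bit y"]) (simp add: take_bit_nat_eq_self)
        qed
        moreover have "Q m (seg X m)" if "m \<le> n" "Q n (seg X n)" for m n X
          using that R(3)[of m X empty_oracle n] unfolding Q_def by auto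
        ultimately have "\<exists>X. \<forall>n. Q n (seg X n)" by (rule cantor_compact)
        then obtain X where X: "\<And>n. Q n (seg X n)" by blast
        then have "X \<notin> W" unfolding R(2) Q_def by simp
        moreover have "X \<in> block f v"
          unfolding block_def
        proof (intro CollectI allI impI)
          fix j assume "j < f v"
          with X[of "Suc (prod_encode (enc v, j))"] show "X (prod_encode (enc v, j))"
            unfolding Q_def by simp
        qed
        ultimately show False using v \<open>N \<le> enc v\<close> W(3) unfolding U_def by blast
      qed
    qed
    have "J \<subseteq> {v. enc v < N} \<union> {v. block f v \<subseteq> W}"
    proof
      fix v assume "v \<in> J"
      then consider "enc v < N" | n where "\<forall>y<2 ^ n. (\<forall>j<f v. prod_encode (enc v, j) < n \<longrightarrow>
          bit y (prod_encode (enc v, j))) \<longrightarrow> R (n, y, 0)"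
        unfolding J_def by blast
      then show "v \<in> {v. enc v < N} \<union> {v. block f v \<subseteq> W}"
      proof cases
        case 2
        have "block f v \<subseteq> W"
        proof
          fix X assume "X \<in> block f v"
          then have "R (n, seg X n, 0)" using 2 seg_less[of X n] by (simp add: block_def)
          then show "X \<in> W" unfolding R(2) by auto
        qed
        then show ?thesis by blast
      qed simp
    qed
    moreover have fin: "finite {v :: 'v. enc v < N}"
      by (rule finite_enc_less)
    ultimately show "bounded_weight f J (card {v :: 'v. enc v < N} + - ln (1 - mu W))"
      using bounded_weight_subset[OF bounded_weight_Un[OF bounded_weight_finite[OF fin]
        weight_of_contained_blocks[OF sigma1_class_sets[OF W(1)] W(2)]]] by blast
  qed
qed

subsection \<open>An optimal set of weighted requests\<close>

lemma ce_stages: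
  fixes J :: "'v::cenc set"
  assumes "sigma1 empty_oracle (\<lambda>X v. v \<in> J)"
  obtains H :: "'v \<times> nat \<Rightarrow> bool" where "decidable H" "\<And>v. v \<in> J \<longleftrightarrow> (\<exists>t. H (v, t))"
    "\<And>v s t. H (v, s) \<Longrightarrow> s \<le> t \<Longrightarrow> H (v, t)"
proof -
  obtain R where R: "decidable R" "\<And>X v. v \<in> J \<longleftrightarrow> (\<exists>n. R (v, n, seg X n, seg empty_oracle n))" "upward R"
    using sigma1_mono[OF assms] by metis
  show ?thesis
  proof
    show "decidable (\<lambda>z :: 'v \<times> nat. R (fst z, snd z, 0, 0))"
      by (intro decidable_comp[OF R(1)] comp_intros)
    show "v \<in> J \<longleftrightarrow> (\<exists>t. R (fst (v, t), snd (v, t), 0, 0))" for v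
      using R(2)[of v empty_oracle] by simp
    show "R (fst (v, t), snd (v, t), 0, 0)" if "R (fst (v, s), snd (v, s), 0, 0)" "s \<le> t" for v s t
      using upward_seg[OF R(3), of v s empty_oracle empty_oracle t] that by simp
  qed
qed

text \<open>The surcharge \<open>d e + Suc e\<close> scales family \<open>e\<close> down to weight
  \<open>2^-(e+1)\<close>, so all families together weigh at most 1.\<close>

lemma bounded_weight_UN:
  fixes S :: "nat \<Rightarrow> 'a set"
  assumes S: "\<And>e. bounded_weight f (S e) (2 ^ d e)"
    and J: "J \<subseteq> (\<Union>e. h e ` S e)"
    and g: "\<And>e z. z \<in> S e \<Longrightarrow> g (h e z) = f z + d e + Suc e"
  shows "bounded_weight g J 1"
  unfolding bounded_weight_def
proof (intro allI impI)
  fix F assume F: "finite F" "F \<subseteq> J"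
  with J have "\<forall>x\<in>F. \<exists>e z. z \<in> S e \<and> x = h e z" by blast
  then obtain ee zz where ez: "\<And>x. x \<in> F \<Longrightarrow> zz x \<in> S (ee x) \<and> x = h (ee x) (zz x)" by metis
  have part: "(\<Sum>x\<in>{x \<in> F. ee x = e}. (1 / 2 :: real) ^ g x) \<le> (1 / 2) ^ Suc e" for e
  proof -
    let ?F = "{x \<in> F. ee x = e}"
    have inj: "inj_on zz ?F"
    proof (rule inj_onI)
      fix x y assume "x \<in> ?F" "y \<in> ?F" "zz x = zz y"
      moreover from this have "x = h (ee x) (zz x)" "y = h (ee y) (zz y)" using ez by blast+
      ultimately show "x = y" by simp
    qed
    have gx: "(1 / 2 :: real) ^ g x = (1 / 2) ^ (d e + Suc e) * (1 / 2) ^ f (zz x)" if "x \<in> ?F" for x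
    proof -
      have "x = h e (zz x)" "zz x \<in> S e" using ez[of x] that by blast+
      then have "g x = f (zz x) + d e + Suc e" using g[of "zz x" e] by simp
      then show ?thesis by (simp add: power_add)
    qed
    have "(\<Sum>x\<in>?F. (1 / 2 :: real) ^ f (zz x)) = (\<Sum>z\<in>zz ` ?F. (1 / 2) ^ f z)"
      by (simp add: sum.reindex[OF inj])
    also have "\<dots> \<le> 2 ^ d e"
      by (rule bounded_weightD[OF S]) (use F(1) ez in auto)
    finally have le: "(\<Sum>x\<in>?F. (1 / 2 :: real) ^ f (zz x)) \<le> 2 ^ d e" .
    have "(\<Sum>x\<in>?F. (1 / 2 :: real) ^ g x) = (1 / 2) ^ (d e + Suc e) * (\<Sum>x\<in>?F. (1 / 2) ^ f (zz x))"
      unfolding sum_distrib_left by (rule sum.cong[OF refl gx])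
    also have "\<dots> \<le> (1 / 2) ^ (d e + Suc e) * 2 ^ d e"
      by (rule mult_left_mono[OF le]) simp
    also have "\<dots> = (1 / 2) ^ Suc e"
      by (simp add: power_add power_divide)
    finally show ?thesis .
  qed
  have "(\<Sum>x\<in>F. (1 / 2 :: real) ^ g x) = (\<Sum>e\<in>ee ` F. \<Sum>x\<in>{x \<in> F. ee x = e}. (1 / 2) ^ g x)"
    by (rule sum.image_gen[OF F(1)])
  also have "\<dots> \<le> (\<Sum>e\<in>ee ` F. (1 / 2) ^ Suc e)" by (rule sum_mono[OF part])
  also have "\<dots> \<le> 1"
  proof -
    have s: "(\<lambda>e. (1 / 2 :: real) ^ Suc e) sums 1" by (rule power_half_series)
    then show ?thesis
      using sum_le_suminf[OF sums_summable[OF s], of "ee ` F"] F(1) sums_unique[OF s] by simp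
  qed
  finally show "(\<Sum>x\<in>F. (1 / 2 :: real) ^ g x) \<le> 1" .
qed

text \<open>Makes \<open>t - k\<close> a true difference for requests with code below
  \<open>t\<close>, so that the scaled weights are exact.\<close>

lemma snd_dec_le: "snd (dec u :: nat \<times> nat) \<le> u"
  using le_prod_encode_2[of "snd (prod_decode u)" "fst (prod_decode u)"] by (simp add: dec_prod_def)

text \<open>The least \<open>k\<close> with \<open>(n, k) \<in> Q\<close> plays the role of the
  prefix-free complexity of \<open>n\<close>, up to a constant. Each index declares a weight bound,
  and its enumeration is frozen once the bound would be exceeded; a set of finite weight with a
  correct declaration is never frozen.\<close>

theorem optimal_requests:
  obtains Q :: "(nat \<times> nat) set"
  where "sigma1 empty_oracle (\<lambda>X z. z \<in> Q)" "bounded_weight snd Q 1"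
    "\<And>P M. sigma1 empty_oracle (\<lambda>X z. z \<in> P) \<Longrightarrow> bounded_weight snd P M \<Longrightarrow>
      \<exists>c. \<forall>n k. (n, k) \<in> P \<longrightarrow> (n, k + c) \<in> Q"
proof -
  have "sigma1 empty_oracle (\<lambda>X w :: nat \<times> nat \<times> nat. phalts empty_oracle (fst w) [enc (snd w)])"
    by (intro sigma1_comp2[OF sigma1_phalts] comp_intros)
  then have "sigma1 empty_oracle (\<lambda>X w :: nat \<times> nat \<times> nat. w \<in> {w. phalts empty_oracle (fst w) [enc (snd w)]})"
    by simp
  then obtain H :: "(nat \<times> nat \<times> nat) \<times> nat \<Rightarrow> bool" where H: "decidable H"
      "\<And>w. w \<in> {w. phalts empty_oracle (fst w) [enc (snd w)]} \<longleftrightarrow> (\<exists>t. H (w, t))"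
      "\<And>w s t. H (w, s) \<Longrightarrow> s \<le> t \<Longrightarrow> H (w, t)"
    by (rule ce_stages) blast
  \<comment> \<open>An index \<open>e\<close> stands for a program together with a bound \<open>2 ^ d e\<close> on the weight of the set that
    it enumerates; sums of weights are scaled by \<open>2 ^ t\<close> to become integers.\<close>
  define S where "S e t = {z :: nat \<times> nat. enc z < t \<and> H ((fst (dec e :: nat \<times> nat), z), t)}"
    for e t :: nat
  define d where "d e = snd (dec e :: nat \<times> nat)" for e :: nat
  define OK where "OK e t \<longleftrightarrow> (\<Sum>u<t. of_bool (H ((fst (dec e :: nat \<times> nat), dec u), t)) * 2 ^ (t - snd (dec u :: nat \<times> nat)))
      \<le> (2::nat) ^ (d e + t)" for e t :: nat
  have fin: "finite (S e t)" for e t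
    unfolding S_def by (rule finite_subset[OF _ finite_enc_less[of t]]) auto
  have S_mono: "S e s \<subseteq> S e t" if "s \<le> t" for e s t
    using that H(3) unfolding S_def by auto
  have OK_iff: "OK e t \<longleftrightarrow> (\<Sum>z\<in>S e t. (1 / 2 :: real) ^ snd z) \<le> 2 ^ d e" for e t
  proof -
    have filt: "(\<Sum>u\<in>{u \<in> {..<t}. P u}. g u) = (\<Sum>u<t. of_bool (P u) * g u)" for P and g :: "nat \<Rightarrow> real"
      unfolding sum.inter_filter[OF finite_lessThan] by (rule sum.cong) auto
    have img: "S e t = dec ` {u. u < t \<and> H ((fst (dec e :: nat \<times> nat), dec u), t)}"
    proof
      show "S e t \<subseteq> dec ` {u. u < t \<and> H ((fst (dec e :: nat \<times> nat), dec u), t)}"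
      proof
        fix z assume "z \<in> S e t"
        then have "enc z \<in> {u. u < t \<and> H ((fst (dec e :: nat \<times> nat), dec u), t)}" by (simp add: S_def)
        then show "z \<in> dec ` {u. u < t \<and> H ((fst (dec e :: nat \<times> nat), dec u), t)}" by (rule rev_image_eqI) simp
      qed
    qed (auto simp: S_def)
    have "(\<Sum>z\<in>S e t. (1 / 2 :: real) ^ snd z) =
        (\<Sum>u\<in>{u. u < t \<and> H ((fst (dec e :: nat \<times> nat), dec u), t)}. (1 / 2) ^ snd (dec u :: nat \<times> nat))"
      unfolding img by (rule sum.reindex_cong[OF inj_on_inverseI[of _ enc] refl refl]) simp
    also have "\<dots> = (\<Sum>u<t. of_bool (H ((fst (dec e :: nat \<times> nat), dec u), t)) * (1 / 2) ^ snd (dec u :: nat \<times> nat))"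
      using filt[of _ "\<lambda>u. H ((fst (dec e :: nat \<times> nat), dec u), t)"] by simp
    also have "\<dots> = (\<Sum>u<t. real (of_bool (H ((fst (dec e :: nat \<times> nat), dec u), t)) * 2 ^ (t - snd (dec u :: nat \<times> nat)))) / 2 ^ t"
      unfolding sum_divide_distrib
    proof (rule sum.cong)
      fix u assume "u \<in> {..<t}"
      then have "snd (dec u :: nat \<times> nat) \<le> t" using snd_dec_le[of u] by simp
      then have "(2::real) ^ (t - snd (dec u :: nat \<times> nat)) / 2 ^ t = (1 / 2) ^ snd (dec u :: nat \<times> nat)"
        by (simp add: power_diff power_divide)
      then show "of_bool (H ((fst (dec e :: nat \<times> nat), dec u), t)) * (1 / 2) ^ snd (dec u :: nat \<times> nat) =
        real (of_bool (H ((fst (dec e :: nat \<times> nat), dec u), t)) * 2 ^ (t - snd (dec u :: nat \<times> nat))) / 2 ^ t"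
        by simp
    qed simp
    finally have eq: "(\<Sum>z\<in>S e t. (1 / 2 :: real) ^ snd z) = real (\<Sum>u<t. of_bool (H ((fst (dec e :: nat \<times> nat), dec u), t))
        * 2 ^ (t - snd (dec u :: nat \<times> nat))) / 2 ^ t" by simp
    have "OK e t \<longleftrightarrow> real (\<Sum>u<t. of_bool (H ((fst (dec e :: nat \<times> nat), dec u), t)) * 2 ^ (t - snd (dec u :: nat \<times> nat)))
      \<le> real (2 ^ (d e + t))"
      unfolding OK_def of_nat_le_iff ..
    then show ?thesis unfolding eq by (simp add: power_add field_simps)
  qed
  define V where "V e = {z. \<exists>t. OK e t \<and> z \<in> S e t}" for e
  have wV: "bounded_weight snd (V e) (2 ^ d e)" for e
    unfolding bounded_weight_def
  proof (intro allI impI)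
    fix F assume F: "finite F" "F \<subseteq> V e"
    show "(\<Sum>v\<in>F. (1 / 2 :: real) ^ snd v) \<le> 2 ^ d e"
    proof (cases "F = {}")
      case False
      from F(2) have "\<forall>z\<in>F. \<exists>t. OK e t \<and> z \<in> S e t" by (auto simp: V_def)
      then obtain t where t: "\<And>z. z \<in> F \<Longrightarrow> OK e (t z) \<and> z \<in> S e (t z)" by metis
      \<comment> \<open>A finite subset is contained in the latest of the accepted stages at which
        its elements appear.\<close>
      have "Max (t ` F) \<in> t ` F" using F(1) False by (intro Max_in) auto
      then have OK: "OK e (Max (t ` F))" using t by auto
      have "F \<subseteq> S e (Max (t ` F))"
      proof
        fix z assume z: "z \<in> F"
        then have "t z \<le> Max (t ` F)" using F(1) by simp
        with z t S_mono show "z \<in> S e (Max (t ` F))" by blast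
      qed
      then have "(\<Sum>v\<in>F. (1 / 2 :: real) ^ snd v) \<le> (\<Sum>v\<in>S e (Max (t ` F)). (1 / 2) ^ snd v)"
        by (intro sum_mono2 fin) auto
      with OK show ?thesis unfolding OK_iff by linarith
    qed simp
  qed
  define Q where "Q = {z. \<exists>e t. \<exists>k<Suc (snd z). OK e t \<and> (fst z, k) \<in> S e t \<and> snd z = k + d e + Suc e}"
  show ?thesis
  proof
    show "sigma1 empty_oracle (\<lambda>X z. z \<in> Q)"
    proof -
      have "sigma1 empty_oracle (\<lambda>X z :: nat \<times> nat. \<exists>e t. \<exists>k<Suc (snd z). OK e t \<and> (fst z, k) \<in> S e t \<and> snd z = k + d e + Suc e)"
        unfolding OK_def S_def d_def mem_Collect_eq
        by (intro sigma1_ex sigma1_decp comp_intros decidable_comp[OF H(1)])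
      then show ?thesis unfolding Q_def by simp
    qed
    show "bounded_weight snd Q 1"
    proof (rule bounded_weight_UN[OF wV])
      show "Q \<subseteq> (\<Union>e. (\<lambda>z. (fst z, snd z + d e + Suc e)) ` V e)"
        unfolding Q_def V_def by force
    qed simp
    fix P :: "(nat \<times> nat) set" and M
    assume P: "sigma1 empty_oracle (\<lambda>X z. z \<in> P)" "bounded_weight snd P M"
    obtain p where p: "\<And>z. halts empty_oracle p [enc z] \<longleftrightarrow> z \<in> P"
      using sigma1_halts[OF P(1)] by metis
    obtain b where b: "M \<le> 2 ^ b"
      using real_arch_pow[of 2 M] by (auto intro: less_imp_le)
    define e where "e = enc (pcode p, b)"
    have e: "fst (dec e :: nat \<times> nat) = pcode p" "d e = b" by (simp_all add: e_def d_def)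
    have HP: "z \<in> P \<longleftrightarrow> (\<exists>t. H ((pcode p, z), t))" for z
      using H(2)[of "(pcode p, z)"] p[of z] by simp
    have SP: "S e t \<subseteq> P" for t using HP unfolding S_def e by blast
    have OK: "OK e t" for t
      using bounded_weightD[OF P(2) fin SP, of t] b unfolding OK_iff e by linarith
    have "(n, k + (b + Suc e)) \<in> Q" if "(n, k) \<in> P" for n k
    proof -
      from that obtain t where t: "H ((pcode p, (n, k)), t)" unfolding HP by blast
      have "(n, k) \<in> S e (max t (Suc (enc (n, k))))"
        unfolding S_def e using H(3)[OF t, of "max t (Suc (enc (n, k)))"] by simp
      then show ?thesis
        unfolding Q_def using OK[of "max t (Suc (enc (n, k)))"] e(2)
        by (intro CollectI exI[of _ e] exI[of _ "max t (Suc (enc (n, k)))"] exI[of _ k]) simp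
    qed
    then show "\<exists>c. \<forall>n k. (n, k) \<in> P \<longrightarrow> (n, k + c) \<in> Q" by blast
  qed
qed

subsection \<open>Approximating the initial segments of a low set\<close>

lemma separate_finite:
  assumes "finite (S :: cantor set)"
  obtains n where "inj_on (\<lambda>X. seg X n) S"
proof -
  have "\<forall>p\<in>S \<times> S. \<exists>i. fst p \<noteq> snd p \<longrightarrow> fst p i \<noteq> snd p i" by (auto simp: fun_eq_iff)
  then obtain i where i: "\<And>p. p \<in> S \<times> S \<Longrightarrow> fst p \<noteq> snd p \<Longrightarrow> fst p (i p) \<noteq> snd p (i p)" by metis
  define n where "n = Suc (\<Sum>p\<in>S \<times> S. i p)"
  have "inj_on (\<lambda>X. seg X n) S"
  proof (rule inj_onI, rule ccontr)
    fix X Y assume XY: "X \<in> S" "Y \<in> S" "seg X n = seg Y n" "X \<noteq> Y"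
    then have "X (i (X, Y)) \<noteq> Y (i (X, Y))" using i[of "(X, Y)"] by simp
    moreover have "i (X, Y) \<le> (\<Sum>p\<in>S \<times> S. i p)"
      using XY assms by (intro member_le_sum) auto
    ultimately show False using XY(3) unfolding seg_eq_iff n_def by (meson le_imp_less_Suc)
  qed
  then show ?thesis by (rule that)
qed

text \<open>
  A counting argument in the style of Chaitin: for a request \<open>(n, k)\<close> of minimal \<open>k\<close>, a set of
  requests \<open>(n, x, k)\<close> of finite weight can contain only boundedly many \<open>x\<close>, since otherwise
  a cheaper request for \<open>n\<close> would have been made.
\<close>

lemma bounded_width:
  fixes J :: "(nat \<times> nat \<times> nat) set"
  assumes opt: "\<forall>P M. sigma1 empty_oracle (\<lambda>X z. z \<in> P) \<longrightarrow> bounded_weight snd P M \<longrightarrow>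
      (\<exists>c. \<forall>n k. (n, k) \<in> P \<longrightarrow> (n, k + c) \<in> Q)"
    and J: "sigma1 empty_oracle (\<lambda>X v. v \<in> J)" "bounded_weight (\<lambda>v. snd (snd v)) J M"
  shows "\<exists>B. \<forall>n. card {x. x < 2 ^ n \<and> (\<forall>k. (n, k) \<in> Q \<longrightarrow> (n, x, k) \<in> J)} \<le> B"
proof -
  obtain H :: "(nat \<times> nat \<times> nat) \<times> nat \<Rightarrow> bool" where H: "decidable H"
      "\<And>v. v \<in> J \<longleftrightarrow> (\<exists>t. H (v, t))" "\<And>v s t. H (v, s) \<Longrightarrow> s \<le> t \<Longrightarrow> H (v, t)"
    using J(1) by (rule ce_stages) blast
  obtain d where d: "M \<le> 2 ^ d"
    using real_arch_pow[of 2 M] by (auto intro: less_imp_le)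
  define C where "C n j = {x. x < 2 ^ n \<and> (n, x, j) \<in> J}" for n j
  have finC: "finite (C n j)" for n j unfolding C_def by simp
  have weightC: "card (C n j) * (1 / 2 :: real) ^ j \<le> 2 ^ d" for n j
  proof -
    have "(\<Sum>v\<in>(\<lambda>x. (n, x, j)) ` C n j. (1 / 2 :: real) ^ snd (snd v)) \<le> M"
      by (rule bounded_weightD[OF J(2)]) (use finC in \<open>auto simp: C_def\<close>)
    also have "(\<Sum>v\<in>(\<lambda>x. (n, x, j)) ` C n j. (1 / 2 :: real) ^ snd (snd v)) = card (C n j) * (1 / 2) ^ j"
      by (subst sum.reindex) (auto simp: inj_on_def)
    finally show ?thesis using d by linarith
  qed
  \<comment> \<open>If at least \<open>4 ^ q\<close> strings carry the value
    \<open>k + 2 * q\<close> for \<open>n\<close>, their joint weight in \<open>J\<close> is at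
    least \<open>2^-k\<close>. The weight of \<open>J\<close> therefore pays for the cheaper
    requests \<open>(n, k)\<close>.\<close>
  define S where "S q = {z. 4 ^ q \<le> card (C (fst z) (snd z + 2 * q))}" for q
  have wS: "bounded_weight snd (S q) (2 ^ d)" for q
    unfolding bounded_weight_def
  proof (intro allI impI)
    fix F assume F: "finite F" "F \<subseteq> S q"
    have "(\<Sum>z\<in>F. (1 / 2 :: real) ^ snd z) \<le> (\<Sum>z\<in>F. \<Sum>x\<in>C (fst z) (snd z + 2 * q). (1 / 2) ^ (snd z + 2 * q))"
    proof (rule sum_mono)
      fix z assume "z \<in> F"
      then have "4 ^ q \<le> card (C (fst z) (snd z + 2 * q))" using F(2) by (auto simp: S_def)
      then have "real (4 ^ q) \<le> real (card (C (fst z) (snd z + 2 * q)))" by (simp only: of_nat_le_iff)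
      then have "real (4 ^ q) * (1 / 2) ^ (snd z + 2 * q) \<le>
          real (card (C (fst z) (snd z + 2 * q))) * (1 / 2) ^ (snd z + 2 * q)"
        by (rule mult_right_mono) simp
      moreover have "real (4 ^ q) * (1 / 2) ^ (snd z + 2 * q) = (1 / 2) ^ snd z"
      proof -
        have "(1 / 2 :: real) ^ (2 * q) = (1 / 4) ^ q"
          by (simp add: power_mult power2_eq_square)
        then show ?thesis by (simp add: power_add power_divide)
      qed
      ultimately show "(1 / 2 :: real) ^ snd z \<le> (\<Sum>x\<in>C (fst z) (snd z + 2 * q). (1 / 2) ^ (snd z + 2 * q))"
        by (simp only: sum_constant)
    qed
    also have "\<dots> = (\<Sum>(z, x)\<in>(SIGMA z:F. C (fst z) (snd z + 2 * q)). (1 / 2) ^ (snd z + 2 * q))"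
      using F(1) finC by (intro sum.Sigma) auto
    also have "\<dots> = (\<Sum>v\<in>(\<lambda>(z, x). (fst z, x, snd z + 2 * q)) ` (SIGMA z:F. C (fst z) (snd z + 2 * q)).
        (1 / 2) ^ snd (snd v))"
      by (subst sum.reindex) (auto simp: inj_on_def case_prod_beta prod_eq_iff)
    also have "\<dots> \<le> M"
      by (rule bounded_weightD[OF J(2)]) (use F(1) finC in \<open>auto simp: C_def\<close>)
    finally show "(\<Sum>z\<in>F. (1 / 2 :: real) ^ snd z) \<le> 2 ^ d" using d by linarith
  qed
  \<comment> \<open>One c.e. set treats all \<open>q\<close> at once, since the \<open>q\<close> to
    be used depends on the constant \<open>c\<close> that is obtained only after \<open>P\<close> is
    fixed.\<close>
  define P where "P = {z :: nat \<times> nat. \<exists>q t. \<exists>k<Suc (snd z). snd z = k + d + Suc q \<and>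
      4 ^ q \<le> card {x. x < 2 ^ fst z \<and> H ((fst z, x, k + 2 * q), t)}}"
  have stage: "4 ^ q \<le> card (C n j) \<longleftrightarrow> (\<exists>t. 4 ^ q \<le> card {x. x < 2 ^ n \<and> H ((n, x, j), t)})" for n j q
  proof
    assume a: "4 ^ q \<le> card (C n j)"
    have "\<forall>x\<in>C n j. \<exists>t. H ((n, x, j), t)" using H(2) by (auto simp: C_def)
    then obtain t where t: "\<And>x. x \<in> C n j \<Longrightarrow> H ((n, x, j), t x)" by metis
    have "C n j \<subseteq> {x. x < 2 ^ n \<and> H ((n, x, j), \<Sum>x\<in>C n j. t x)}"
    proof
      fix x assume x: "x \<in> C n j"
      then have "t x \<le> (\<Sum>x\<in>C n j. t x)" using finC by (intro member_le_sum) auto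
      with x H(3)[OF t[OF x]] show "x \<in> {x. x < 2 ^ n \<and> H ((n, x, j), \<Sum>x\<in>C n j. t x)}"
        by (simp add: C_def)
    qed
    then have "card (C n j) \<le> card {x. x < 2 ^ n \<and> H ((n, x, j), \<Sum>x\<in>C n j. t x)}"
      by (intro card_mono) auto
    with a show "\<exists>t. 4 ^ q \<le> card {x. x < 2 ^ n \<and> H ((n, x, j), t)}"
      by (meson order_trans)
  next
    assume "\<exists>t. 4 ^ q \<le> card {x. x < 2 ^ n \<and> H ((n, x, j), t)}"
    then obtain t where t: "4 ^ q \<le> card {x. x < 2 ^ n \<and> H ((n, x, j), t)}" by blast
    have "{x. x < 2 ^ n \<and> H ((n, x, j), t)} \<subseteq> C n j" using H(2) by (auto simp: C_def)
    then have "card {x. x < 2 ^ n \<and> H ((n, x, j), t)} \<le> card (C n j)" by (rule card_mono[OF finC])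
    with t show "4 ^ q \<le> card (C n j)" by simp
  qed
  have "sigma1 empty_oracle (\<lambda>X z. z \<in> P)"
    unfolding P_def mem_Collect_eq
    by (intro sigma1_ex sigma1_decp comp_intros decidable_comp[OF H(1)])
  moreover have "bounded_weight snd P 1"
  proof (rule bounded_weight_UN[where d = "\<lambda>_. d", OF wS])
    show "P \<subseteq> (\<Union>q. (\<lambda>z. (fst z, snd z + d + Suc q)) ` S q)"
    proof
      fix z assume "z \<in> P"
      then obtain q k where "snd z = k + d + Suc q" "4 ^ q \<le> card (C (fst z) (k + 2 * q))"
        unfolding P_def using stage by blast
      then have "(fst z, k) \<in> S q" "z = (fst (fst z, k), snd (fst z, k) + d + Suc q)"
        by (simp_all add: S_def prod_eq_iff)
      then show "z \<in> (\<Union>q. (\<lambda>z. (fst z, snd z + d + Suc q)) ` S q)" by blast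
    qed
  qed simp
  ultimately obtain c where c: "\<And>n k. (n, k) \<in> P \<Longrightarrow> (n, k + c) \<in> Q" using opt by metis
  have PS: "(n, k + d + Suc q) \<in> P" if "4 ^ q \<le> card (C n (k + 2 * q))" for n k q
  proof -
    from that obtain t where "4 ^ q \<le> card {x. x < 2 ^ n \<and> H ((n, x, k + 2 * q), t)}"
      unfolding stage by blast
    then show ?thesis
      unfolding P_def by (intro CollectI exI[of _ q] exI[of _ t] exI[of _ k]) simp
  qed
  \<comment> \<open>The requests \<open>(n, n + 1)\<close> have total weight 1, so optimality
    provides a request for every \<open>n\<close> and a minimal one exists.\<close>
  have exQ: "\<exists>k. (n, k) \<in> Q" for n
  proof -
    have "sigma1 empty_oracle (\<lambda>X z. z \<in> {z :: nat \<times> nat. snd z = Suc (fst z)})"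
      unfolding mem_Collect_eq by (intro sigma1_decp comp_intros)
    moreover have "bounded_weight snd {z :: nat \<times> nat. snd z = Suc (fst z)} 1"
    proof (rule bounded_weight_UN[where d = "\<lambda>_. 0" and f = "\<lambda>_ :: unit. 0" and h = "\<lambda>e _. (e, Suc e)" and S = "\<lambda>_. UNIV"])
      show "bounded_weight (\<lambda>_ :: unit. 0) UNIV (2 ^ 0)"
        using bounded_weight_finite[of "UNIV :: unit set" "\<lambda>_. 0"] by simp
    qed auto
    ultimately obtain c where "\<And>n k. (n, k) \<in> {z :: nat \<times> nat. snd z = Suc (fst z)} \<Longrightarrow> (n, k + c) \<in> Q"
      using opt by metis
    from this[of n "Suc n"] show ?thesis by auto
  qed
  \<comment> \<open>\<open>4 ^ q\<close> strings for a minimal request would yield one that is cheaper by \<open>2 * q\<close>, at a cost of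
    \<open>q + d + 1 + c\<close>.\<close>
  define q where "q = d + Suc c + 1"
  show ?thesis
  proof (intro exI allI)
    fix n
    define K where "K = (LEAST k. (n, k) \<in> Q)"
    have K: "(n, K) \<in> Q" "\<And>k. (n, k) \<in> Q \<Longrightarrow> K \<le> k"
      unfolding K_def using LeastI_ex[OF exQ[of n]] Least_le by metis+
    have "card {x. x < 2 ^ n \<and> (\<forall>k. (n, k) \<in> Q \<longrightarrow> (n, x, k) \<in> J)} \<le> card (C n K)"
      by (rule card_mono[OF finC]) (use K(1) in \<open>auto simp: C_def\<close>)
    \<comment> \<open>The first summand covers the case in which the minimal request can be undercut
      by \<open>2 * q\<close>. For smaller \<open>K\<close> the weight of \<open>J\<close> alone
      allows at most \<open>2 ^ d * 2 ^ K\<close> strings.\<close>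
    also have "card (C n K) \<le> 4 ^ q + 2 ^ d * 2 ^ (2 * q)"
    proof (cases "2 * q \<le> K")
      case True
      have "\<not> 4 ^ q \<le> card (C n K)"
      proof
        assume "4 ^ q \<le> card (C n K)"
        with True have "4 ^ q \<le> card (C n ((K - 2 * q) + 2 * q))" by simp
        from c[OF PS[OF this]] have "K \<le> (K - 2 * q) + d + Suc q + c" by (rule K(2))
        with True show False unfolding q_def by arith
      qed
      then show ?thesis by simp
    next
      case False
      have "real (card (C n K)) = card (C n K) * (1 / 2) ^ K * 2 ^ K" by (simp add: power_divide)
      also have "\<dots> \<le> 2 ^ d * 2 ^ K" by (rule mult_right_mono[OF weightC]) simp
      also have "\<dots> \<le> 2 ^ d * 2 ^ (2 * q)" using False by (intro mult_left_mono power_increasing) auto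
      also have "\<dots> = real (2 ^ d * 2 ^ (2 * q))" by simp
      finally have "card (C n K) \<le> 2 ^ d * 2 ^ (2 * q)" by (simp only: of_nat_le_iff)
      then show ?thesis by simp
    qed
    finally show "card {x. x < 2 ^ n \<and> (\<forall>k. (n, k) \<in> Q \<longrightarrow> (n, x, k) \<in> J)} \<le> 4 ^ q + 2 ^ d * 2 ^ (2 * q)" .
  qed
qed

text \<open>Each request \<open>(n, k)\<close> of \<open>Q\<close> is used with the single string
  \<open>seg A n\<close>, so \<open>I\<close> inherits the weight bound of \<open>Q\<close>, and
  \<open>bounded_width\<close> limits the cover. A wrong \<open>x\<close> disappears at some stage:
  otherwise compactness would give a second member of \<open>Paths\<close> agreeing with
  \<open>A\<close> on \<open>n0\<close> bits.\<close>

theorem low_prefix_approx: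
  assumes low: "low_for_1_randomness A"
  obtains L :: "(nat \<times> nat \<times> nat) set"
  where "sigma1 empty_oracle (\<lambda>X z. z \<in> L)" "\<And>s n. (s, n, seg A n) \<in> L"
    "\<And>s n x. (Suc s, n, x) \<in> L \<Longrightarrow> (s, n, x) \<in> L"
    "\<And>n x. x \<noteq> seg A n \<Longrightarrow> \<exists>s. (s, n, x) \<notin> L"
proof -
  obtain Q :: "(nat \<times> nat) set" where Q: "sigma1 empty_oracle (\<lambda>X z. z \<in> Q)" "bounded_weight snd Q 1"
    "\<And>P M. sigma1 empty_oracle (\<lambda>X z. z \<in> P) \<Longrightarrow> bounded_weight snd P M \<Longrightarrow>
      \<exists>c. \<forall>n k. (n, k) \<in> P \<longrightarrow> (n, k + c) \<in> Q"
    using optimal_requests by metis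
  obtain HQ :: "(nat \<times> nat) \<times> nat \<Rightarrow> bool" where HQ: "decidable HQ" "\<And>v. v \<in> Q \<longleftrightarrow> (\<exists>t. HQ (v, t))"
    "\<And>v s t. HQ (v, s) \<Longrightarrow> s \<le> t \<Longrightarrow> HQ (v, t)"
    using Q(1) by (rule ce_stages) blast
  define I where "I = {v :: nat \<times> nat \<times> nat. fst (snd v) = seg A (fst v) \<and> (fst v, snd (snd v)) \<in> Q}"
  have "sigma1 A (\<lambda>X v. v \<in> I)"
  proof -
    have "sigma1 A (\<lambda>X v :: nat \<times> nat \<times> nat. (\<lambda>z. fst (snd (fst z)) = snd (snd z))
        (v, seg X (fst v), seg A (fst v)))"
      by (rule sigma1_seg) (intro comp_intros)+
    then have "sigma1 A (\<lambda>X v :: nat \<times> nat \<times> nat. fst (snd v) = seg A (fst v))" by simp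
    moreover have "sigma1 A (\<lambda>X v :: nat \<times> nat \<times> nat. (fst v, snd (snd v)) \<in> Q)"
      by (intro sigma1_comp[OF sigma1_relativize[OF Q(1)]] comp_intros)
    ultimately show ?thesis unfolding I_def mem_Collect_eq by (rule sigma1_conj)
  qed
  moreover have "computable (\<lambda>v :: nat \<times> nat \<times> nat. snd (snd v))" by (intro comp_intros)
  moreover have "bounded_weight (\<lambda>v. snd (snd v)) I 1"
    unfolding bounded_weight_def
  proof (intro allI impI)
    fix F assume F: "finite F" "F \<subseteq> I"
    have "inj_on (\<lambda>v. (fst v, snd (snd v))) F"
    proof (rule inj_onI)
      fix v w assume vw: "v \<in> F" "w \<in> F" "(fst v, snd (snd v)) = (fst w, snd (snd w))"
      with F(2) have "fst (snd v) = seg A (fst v)" "fst (snd w) = seg A (fst w)"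
        unfolding I_def by blast+
      with vw(3) show "v = w" by (simp add: prod_eq_iff)
    qed
    then have "(\<Sum>v\<in>F. (1 / 2 :: real) ^ snd (snd v)) =
        (\<Sum>z\<in>(\<lambda>v. (fst v, snd (snd v))) ` F. (1 / 2) ^ snd z)"
      by (simp add: sum.reindex)
    also have "\<dots> \<le> 1"
      by (rule bounded_weightD[OF Q(2)]) (use F in \<open>auto simp: I_def\<close>)
    finally show "(\<Sum>v\<in>F. (1 / 2 :: real) ^ snd (snd v)) \<le> 1" .
  qed
  ultimately obtain J M where J: "sigma1 empty_oracle (\<lambda>X v. v \<in> J)" "I \<subseteq> J"
    "bounded_weight (\<lambda>v. snd (snd v)) J M"
    using low_weight_cover[OF low] by metis
  obtain B where B: "\<And>n. card {x. x < 2 ^ n \<and> (\<forall>k. (n, k) \<in> Q \<longrightarrow> (n, x, k) \<in> J)} \<le> B"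
    using bounded_width[OF _ J(1) J(3), of Q] Q(3) by blast
  define Paths where "Paths = {X. \<forall>n k. (n, k) \<in> Q \<longrightarrow> (n, seg X n, k) \<in> J}"
  have "A \<in> Paths" using J(2) unfolding Paths_def I_def by auto
  have "finite Paths"
  proof (rule ccontr)
    assume "infinite Paths"
    then obtain S where S: "S \<subseteq> Paths" "finite S" "card S = Suc B"
      by (metis infinite_arbitrarily_large)
    obtain n where n: "inj_on (\<lambda>X. seg X n) S" using separate_finite[OF S(2)] .
    have "card S = card ((\<lambda>X. seg X n) ` S)" using card_image[OF n] by simp
    also have "\<dots> \<le> card {x. x < 2 ^ n \<and> (\<forall>k. (n, k) \<in> Q \<longrightarrow> (n, x, k) \<in> J)}"
      by (rule card_mono) (use S(1) in \<open>auto simp: Paths_def seg_less\<close>)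
    also have "\<dots> \<le> B" by (rule B)
    finally show False using S(3) by simp
  qed
  then obtain n0 where n0: "inj_on (\<lambda>X. seg X n0) Paths" using separate_finite by metis
  \<comment> \<open>\<open>y\<close> extends \<open>x\<close>, agrees with \<open>A\<close> on the
    \<open>n0\<close> bits that isolate \<open>A\<close> in \<open>Paths\<close>, and passes all
    requests visible at stage \<open>s\<close>. Its length suffices for every prefix inspected.
    \<open>J\<close> occurs only positively, so \<open>L\<close> is c.e.\<close>
  define L where "L = {z :: nat \<times> nat \<times> nat. \<exists>y. y < 2 ^ (fst z + fst (snd z) + n0) \<and>
    take_bit (fst (snd z)) y = snd (snd z) \<and> take_bit n0 y = seg A n0 \<and>
    (\<forall>m\<le>fst z. \<forall>k<fst z. \<not> HQ ((m, k), fst z) \<or> (m, take_bit m y, k) \<in> J)}"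
  show ?thesis
  proof (rule that)
    show "sigma1 empty_oracle (\<lambda>X z. z \<in> L)"
      unfolding L_def mem_Collect_eq
      by (intro sigma1_ex sigma1_conj sigma1_ball_le sigma1_ball_less sigma1_disj sigma1_comp[OF J(1)] sigma1_decp comp_intros
          decidable_comp[OF HQ(1)])
    show "(s, n, seg A n) \<in> L" for s n
    proof -
      have "(m, take_bit m (seg A (s + n + n0)), k) \<in> J" if "m \<le> s" "HQ ((m, k), s)" for m k
        using that \<open>A \<in> Paths\<close> HQ(2) unfolding Paths_def by (auto simp: min_def)
      then show ?thesis
        unfolding L_def by (auto intro!: exI[of _ "seg A (s + n + n0)"] simp: seg_less)
    qed
    show "(s, n, x) \<in> L" if "(Suc s, n, x) \<in> L" for s n x
    proof -
      from that obtain y where y: "take_bit n y = x" "take_bit n0 y = seg A n0"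
        "\<And>m k. m \<le> Suc s \<Longrightarrow> k < Suc s \<Longrightarrow> HQ ((m, k), Suc s) \<Longrightarrow> (m, take_bit m y, k) \<in> J"
        unfolding L_def by auto
      have "(m, take_bit m y, k) \<in> J" if "m \<le> s" "k < s" "HQ ((m, k), s)" for m k
        using y(3)[of m k] that HQ(3)[of "(m, k)" s "Suc s"] by simp
      then show ?thesis
        unfolding L_def using y(1,2)
        by (auto intro!: exI[of _ "take_bit (s + n + n0) y"] simp: min_def)
    qed
    show "\<exists>s. (s, n, x) \<notin> L" if "x \<noteq> seg A n" for n x
    proof (rule ccontr)
      assume "\<not> ?thesis"
      then have all: "(s, n, x) \<in> L" for s by blast
      \<comment> \<open>Levels below \<open>n + n0\<close> cannot contain \<open>x\<close> and the
        isolating bits, so that demand starts at this level; this keeps \<open>C\<close> inherited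
        by shorter prefixes.\<close>
      define C where "C N z \<longleftrightarrow> (n + n0 \<le> N \<longrightarrow> take_bit n z = x \<and> take_bit n0 z = seg A n0) \<and>
        (\<forall>m\<le>N. \<forall>k<N. HQ ((m, k), N) \<longrightarrow> (m, take_bit m z, k) \<in> J)" for N z
      have "\<exists>X. \<forall>N. C N (seg X N)"
      proof (rule cantor_compact)
        fix N
        from all[of N] obtain y where "take_bit n y = x" "take_bit n0 y = seg A n0"
          "\<And>m k. m \<le> N \<Longrightarrow> k < N \<Longrightarrow> HQ ((m, k), N) \<Longrightarrow> (m, take_bit m y, k) \<in> J"
          unfolding L_def by auto
        then have "C N (seg (bit y) N)" unfolding C_def by (auto simp: min_def)
        then show "\<exists>X. C N (seg X N)" by blast
      next
        fix M N X assume MN: "M \<le> N" "C N (seg X N)"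
        then show "C M (seg X M)"
          unfolding C_def using HQ(3)[of _ M N] by (auto simp: min_def)
      qed
      then obtain X where X: "\<And>N. C N (seg X N)" by blast
      have "seg X n = x" "seg X n0 = seg A n0"
        using X[of "n + n0"] by (auto simp: C_def min_def)
      moreover have "X \<in> Paths"
        unfolding Paths_def
      proof (intro CollectI allI impI)
        fix m k assume "(m, k) \<in> Q"
        then obtain t where "HQ ((m, k), t)" using HQ(2) by blast
        then have "HQ ((m, k), t + m + Suc k)" using HQ(3) by auto
        with X[of "t + m + Suc k"] show "(m, seg X m, k) \<in> J"
          unfolding C_def by (auto simp: min_def dest!: spec[of _ m])
      qed
      ultimately have "X = A" using n0 \<open>A \<in> Paths\<close> by (auto dest: inj_onD)
      with \<open>seg X n = x\<close> that show False by simp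
    qed
  qed
qed

subsection \<open>Lowness for randomness gives lowness for tests\<close>

theorem low_for_tests_if_low:
  assumes low: "low_for_1_randomness A"
  shows "low_for_weak_2_random_tests A"
  unfolding low_for_weak_2_random_tests_def
proof (intro allI impI)
  fix V assume "generalized_Martin_Lof_test A V"
  then have V: "sigma1 A (\<lambda>X i. X \<in> V i)" "mu (\<Inter>i. V i) = 0"
    by (simp_all add: generalized_Martin_Lof_test_def uniformly_Sigma1_iff)
  obtain R where R: "decidable R" "\<And>X i. X \<in> V i \<longleftrightarrow> (\<exists>n. R (i, n, seg X n, seg A n))"
    using V(1) unfolding sigma1_def by blast
  \<comment> \<open>A quadruple \<open>(i, n, x, a)\<close> says that \<open>x\<close> is a minimal string of \<open>V i\<close>, of length \<open>n\<close>, and that \<open>a\<close>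
    is the part of the oracle used.\<close>
  define I where "I = {v :: nat \<times> nat \<times> nat \<times> nat. seg A (fst (snd v)) = snd (snd (snd v)) \<and>
    (R v \<and> fst (snd (snd v)) < 2 ^ fst (snd v) \<and>
    (\<forall>m<fst (snd v). \<not> R (fst v, m, take_bit m (fst (snd (snd v))), take_bit m (snd (snd (snd v))))))}"
  have sgI: "sigma1 A (\<lambda>X v. v \<in> I)"
  proof -
    have "sigma1 A (\<lambda>X v :: nat \<times> nat \<times> nat \<times> nat. (\<lambda>z. snd (snd z) = snd (snd (snd (fst z))))
        (v, seg X (fst (snd v)), seg A (fst (snd v))))"
      by (rule sigma1_seg) (intro comp_intros)+
    then have "sigma1 A (\<lambda>X v :: nat \<times> nat \<times> nat \<times> nat. seg A (fst (snd v)) = snd (snd (snd v)))" by simp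
    then show ?thesis
      unfolding I_def mem_Collect_eq
      by (rule sigma1_conj) (intro sigma1_decp comp_intros decidable_comp[OF R(1)])
  qed
  have I_iff: "(i, n, x, a) \<in> I \<longleftrightarrow> a = seg A n \<and> x < 2 ^ n \<and> R (i, n, x, a) \<and>
      (\<forall>m<n. \<not> R (i, m, take_bit m x, seg A m))" for i n x a
    by (auto simp: I_def min_def)
  \<comment> \<open>The length alone gives weight at most 1 for each component; the extra
    \<open>Suc (fst v)\<close> makes the sum over all components finite.\<close>
  define f where "f v = fst (snd v) + Suc (fst v)" for v :: "nat \<times> nat \<times> nat \<times> nat"
  have "computable f" unfolding f_def by (intro comp_intros)
  moreover have "bounded_weight f I 1"
  proof (rule bounded_weight_UN[where S = "\<lambda>i. {v \<in> I. fst v = i}" and f = "\<lambda>v. fst (snd v)"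
        and d = "\<lambda>_. 0" and h = "\<lambda>_ v. v"])
    \<comment> \<open>Minimal strings of one component have disjoint cylinders, and the recorded use
      is determined by the length; so the weight is the measure of a union.\<close>
    show "bounded_weight (\<lambda>v. fst (snd v)) {v \<in> I. fst v = i} (2 ^ 0)" for i
      unfolding bounded_weight_def
    proof (intro allI impI)
      fix F assume F: "finite F" "F \<subseteq> {v \<in> I. fst v = i}"
      let ?E = "\<lambda>v :: nat \<times> nat \<times> nat \<times> nat. {X. seg X (fst (snd v)) = fst (snd (snd v))}"
      have "disjoint_family_on ?E F"
        unfolding disjoint_family_on_def
      proof (intro ballI impI)
        fix v w assume vw: "v \<in> F" "w \<in> F" "v \<noteq> w"
        obtain n x where v: "v = (i, n, x, seg A n)" "(i, n, x, seg A n) \<in> I"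
          using F(2) vw(1) I_iff by (cases v) auto
        obtain m y where w: "w = (i, m, y, seg A m)" "(i, m, y, seg A m) \<in> I"
          using F(2) vw(2) I_iff by (cases w) auto
        have False if X: "seg X n = x" "seg X m = y" for X
        proof (cases n m rule: linorder_cases)
          case less
          then have "\<not> R (i, n, take_bit n y, seg A n)" using w(2) unfolding I_iff by blast
          moreover have "take_bit n y = x" using X less by auto
          ultimately show False using v(2) unfolding I_iff by simp
        next
          case equal
          with X vw(3) v(1) w(1) show False by simp
        next
          case greater
          then have "\<not> R (i, m, take_bit m x, seg A m)" using v(2) unfolding I_iff by blast
          moreover have "take_bit m x = y" using X greater by auto
          ultimately show False using w(2) unfolding I_iff by simp
        qed
        then show "?E v \<inter> ?E w = {}" unfolding v(1) w(1) by auto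
      qed
      then have "mu (\<Union>v\<in>F. ?E v) = (\<Sum>v\<in>F. mu (?E v))"
        using F(1) by (intro coin_prob.finite_measure_finite_Union) (auto simp: sets_seg_eq)
      also have "\<dots> = (\<Sum>v\<in>F. (1 / 2) ^ fst (snd v))"
      proof (rule sum.cong[OF refl])
        fix v assume "v \<in> F"
        then have "fst (snd (snd v)) < 2 ^ fst (snd v)" using F(2) by (auto simp: I_def)
        then show "mu (?E v) = (1 / 2) ^ fst (snd v)" by (simp add: mu_seg_eq power_divide)
      qed
      finally have "(\<Sum>v\<in>F. (1 / 2) ^ fst (snd v)) = mu (\<Union>v\<in>F. ?E v)" by simp
      then show "(\<Sum>v\<in>F. (1 / 2 :: real) ^ fst (snd v)) \<le> 2 ^ 0" by simp
    qed
  qed (auto simp: f_def)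
  ultimately obtain J M where J: "sigma1 empty_oracle (\<lambda>X v. v \<in> J)" "I \<subseteq> J" "bounded_weight f J M"
    using low_weight_cover[OF low sgI] by metis
  obtain L :: "(nat \<times> nat \<times> nat) set" where L: "sigma1 empty_oracle (\<lambda>X z. z \<in> L)"
    "\<And>s n. (s, n, seg A n) \<in> L" "\<And>s n x. (Suc s, n, x) \<in> L \<Longrightarrow> (s, n, x) \<in> L"
    "\<And>n x. x \<noteq> seg A n \<Longrightarrow> \<exists>s. (s, n, x) \<notin> L"
    using low_prefix_approx[OF low] by blast
  have L_anti: "(s, n, x) \<in> L" if "(t, n, x) \<in> L" "s \<le> t" for s t n x
    using that(2,1) by (induction t rule: dec_induct) (auto dest: L(3))
  \<comment> \<open>\<open>R v\<close> is evaluated with the recorded use. A member of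
    \<open>J\<close> whose use is an initial segment of \<open>A\<close> thus describes a genuine
    string of \<open>V i\<close>, and wrong uses are the only source of error.\<close>
  define G where "G i s = {X. \<exists>v. v \<in> J \<and> (fst v = i \<and> R v) \<and> (s, fst (snd v), snd (snd (snd v))) \<in> L \<and>
    seg X (fst (snd v)) = fst (snd (snd v))}" for i s
  have sgG: "sigma1 empty_oracle (\<lambda>X z. X \<in> G (fst z) (snd z))"
    unfolding G_def mem_Collect_eq
    by (intro sigma1_ex sigma1_conj sigma1_comp[OF J(1)] sigma1_comp[OF L(1)] sigma1_decp sigma1_seg_eq comp_intros
        decidable_comp[OF R(1)])
  have G_anti: "G i t \<subseteq> G i s" if "s \<le> t" for i s t
    using that L_anti unfolding G_def by blast
  have VG: "V i \<subseteq> G i s" for i s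
  proof
    fix X assume "X \<in> V i"
    then obtain n where n: "R (i, n, seg X n, seg A n)" "\<forall>m<n. \<not> R (i, m, seg X m, seg A m)"
      unfolding R(2) using exists_least_iff[of "\<lambda>n. R (i, n, seg X n, seg A n)"] by blast
    then have "(i, n, seg X n, seg A n) \<in> I" unfolding I_iff by (auto simp: seg_less min_def)
    with J(2) n(1) show "X \<in> G i s"
      unfolding G_def using L(2) by (intro CollectI exI[of _ "(i, n, seg X n, seg A n)"]) auto
  qed
  have null: "mu ((\<Inter>s. G i s) - V i) = 0" for i
  proof -
    have small: "mu ((\<Inter>s. G i s) - V i) \<le> e" if "e > 0" for e
    proof -
      define n :: "nat \<times> nat \<times> nat \<times> nat \<Rightarrow> nat" where "n v = fst (snd v)" for v
      \<comment> \<open>On component \<open>i\<close> the exponent \<open>f\<close> exceeds the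
        length by \<open>Suc i\<close>; the divisor compensates for this.\<close>
      obtain N where N: "bounded_weight f {v \<in> J. N \<le> enc v} (e / 2 ^ Suc i)"
        using bounded_weight_tail[OF J(3), of "e / 2 ^ Suc i"] \<open>e > 0\<close> by auto
      let ?T = "{v \<in> J. fst v = i \<and> N \<le> enc v}"
      have "bounded_weight n ?T e"
        unfolding bounded_weight_def
      proof (intro allI impI)
        fix F assume F: "finite F" "F \<subseteq> ?T"
        have "(\<Sum>v\<in>F. (1 / 2 :: real) ^ f v) = (\<Sum>v\<in>F. (1 / 2) ^ n v / 2 ^ Suc i)"
          by (rule sum.cong) (use F(2) in \<open>auto simp: f_def n_def power_add power_divide\<close>)
        also have "\<dots> = (\<Sum>v\<in>F. (1 / 2) ^ n v) / 2 ^ Suc i" by (rule sum_divide_distrib[symmetric])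
        finally have "(\<Sum>v\<in>F. (1 / 2 :: real) ^ n v) / 2 ^ Suc i \<le> e / 2 ^ Suc i"
          using bounded_weightD[OF N F(1)] F(2) by auto
        then show "(\<Sum>v\<in>F. (1 / 2 :: real) ^ n v) \<le> e" by (simp add: divide_le_cancel)
      qed
      then have "mu (\<Union>v\<in>?T. {X. seg X (n v) = fst (snd (snd v))}) \<le> e"
      proof (rule mu_UN_weight[rotated 2])
        show "mu {X. seg X (n v) = fst (snd (snd v))} \<le> (1 / 2) ^ n v" for v
        proof (cases "fst (snd (snd v)) < 2 ^ n v")
          case False
          then have "seg X (n v) \<noteq> fst (snd (snd v))" for X using seg_less[of X "n v"] by auto
          then show ?thesis by simp
        qed (simp add: mu_seg_eq power_divide)
      qed (rule sets_seg_eq)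
      moreover have "(\<Inter>s. G i s) - V i \<subseteq> (\<Union>v\<in>?T. {X. seg X (n v) = fst (snd (snd v))})"
      proof
        fix X assume X: "X \<in> (\<Inter>s. G i s) - V i"
        let ?B = "{v :: nat \<times> nat \<times> nat \<times> nat. enc v < N}"
        have "\<forall>v. \<exists>s. snd (snd (snd v)) \<noteq> seg A (n v) \<longrightarrow> (s, n v, snd (snd (snd v))) \<notin> L"
          using L(4) by blast
        then obtain s where s: "\<And>v. snd (snd (snd v)) \<noteq> seg A (n v) \<Longrightarrow> (s v, n v, snd (snd (snd v))) \<notin> L"
          by metis
        \<comment> \<open>A stage by which every wrong use among the finitely many codes below
          \<open>N\<close> has been rejected.\<close>
        define t where "t = (\<Sum>v\<in>?B. s v)"
        from X obtain v where v: "v \<in> J" "fst v = i" "R v" "(t, n v, snd (snd (snd v))) \<in> L"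
          "seg X (n v) = fst (snd (snd v))"
          unfolding G_def n_def by blast
        have "snd (snd (snd v)) \<noteq> seg A (n v)"
        proof
          assume "snd (snd (snd v)) = seg A (n v)"
          with v(2,5) have "v = (i, n v, seg X (n v), seg A (n v))"
            by (simp add: prod_eq_iff n_def)
          with v(3) have "X \<in> V i" unfolding R(2) by metis
          with X show False by blast
        qed
        from s[OF this] v(4) have "\<not> s v \<le> t" using L_anti by blast
        moreover have "s v \<le> t" if "enc v < N"
          unfolding t_def using that finite_enc_less by (intro member_le_sum) auto
        ultimately have "N \<le> enc v" by force
        with v show "X \<in> (\<Union>v\<in>?T. {X. seg X (n v) = fst (snd (snd v))})" by blast
      qed
      moreover have "(\<Union>v\<in>?T. {X. seg X (n v) = fst (snd (snd v))}) \<in> sets coin_measure"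
        by (rule sets.countable_UN') (auto simp: sets_seg_eq)
      ultimately show ?thesis using mu_mono by (meson order_trans)
    qed
    have "mu ((\<Inter>s. G i s) - V i) \<le> 0" by (rule field_le_epsilon) (use small in simp)
    then show ?thesis by (simp add: measure_le_0_iff)
  qed
  \<comment> \<open>Flattens the double sequence into a nested one; the intersection is unchanged
    because \<open>G i s\<close> decreases in \<open>s\<close>.\<close>
  define U where "U s = {X. \<forall>i\<le>s. X \<in> G i s}" for s
  have U: "(\<Inter>s. U s) = (\<Inter>i. \<Inter>s. G i s)"
  proof
    show "(\<Inter>s. U s) \<subseteq> (\<Inter>i. \<Inter>s. G i s)"
    proof (intro subsetI INT_I)
      fix X i s assume "X \<in> (\<Inter>s. U s)"
      then have "X \<in> G i (max i s)" unfolding U_def by auto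
      then show "X \<in> G i s" using G_anti[of s "max i s" i] by auto
    qed
  qed (auto simp: U_def)
  have "sigma1 empty_oracle (\<lambda>X s. X \<in> U s)"
    unfolding U_def mem_Collect_eq
    by (intro sigma1_ball_le comp_intros sigma1_comp[OF sgG, of "\<lambda>z. (snd z, fst z)", simplified])
  moreover have "decseq U"
    unfolding decseq_def
  proof (intro allI impI subsetI)
    fix m n X assume "m \<le> n" "X \<in> U n"
    then have "X \<in> G i n" if "i \<le> m" for i using that unfolding U_def by simp
    then show "X \<in> U m" using G_anti[OF \<open>m \<le> n\<close>] unfolding U_def by blast
  qed
  moreover have "mu (\<Inter>s. U s) = 0"
  proof -
    have sV: "V i \<in> sets coin_measure" for i using sigma1_sets[OF V(1), of i] by simp
    have sG: "G i s \<in> sets coin_measure" for i s using sigma1_sets[OF sgG, of "(i, s)"] by simp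
    have sD: "(\<Inter>s. G i s) - V i \<in> sets coin_measure" for i
      using sV sG by (intro sets.Diff sets.countable_INT) auto
    have "(\<Inter>i. V i) \<in> null_sets coin_measure"
      using V(2) sV by (auto simp: null_sets_def coin_prob.emeasure_eq_measure)
    moreover have "(\<Union>i. (\<Inter>s. G i s) - V i) \<in> null_sets coin_measure"
      using null sD by (intro null_sets_UN) (simp add: null_sets_def coin_prob.emeasure_eq_measure)
    ultimately have n: "(\<Inter>i. V i) \<union> (\<Union>i. (\<Inter>s. G i s) - V i) \<in> null_sets coin_measure"
      by (rule null_sets.Un)
    moreover have "(\<Inter>s. U s) \<in> sets coin_measure"
      unfolding U using sG by (intro sets.countable_INT) auto
    moreover have "(\<Inter>s. U s) \<subseteq> (\<Inter>i. V i) \<union> (\<Union>i. (\<Inter>s. G i s) - V i)" unfolding U by auto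
    ultimately have "(\<Inter>s. U s) \<in> null_sets coin_measure" by (rule null_sets_subset)
    then show ?thesis by (simp add: null_sets_def coin_prob.emeasure_eq_measure)
  qed
  ultimately have "generalized_Martin_Lof_test empty_oracle U"
    by (simp add: generalized_Martin_Lof_test_def uniformly_Sigma1_iff)
  moreover have "(\<Inter>i. V i) \<subseteq> (\<Inter>i. U i)" unfolding U using VG by blast
  ultimately show "\<exists>U. generalized_Martin_Lof_test empty_oracle U \<and> (\<Inter>i. V i) \<subseteq> (\<Inter>i. U i)" by blast
qed

subsection \<open>Lowness for weak 2-randomness gives lowness for randomness\<close>

lemma weakly_2_random_imp_random: "weakly_2_random_rel A X \<Longrightarrow> random_rel A X"
proof -
  assume w: "weakly_2_random_rel A X"
  have "generalized_Martin_Lof_test A U" if "Martin_Lof_test A U" for U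
  proof -
    have U: "sigma1 A (\<lambda>X n. X \<in> U n)" "decseq U" "\<And>n. mu (U n) \<le> (1 / 2) ^ n"
      using that by (auto simp: Martin_Lof_test_def uniformly_Sigma1_iff)
    have s: "U n \<in> sets coin_measure" for n using sigma1_sets[OF U(1), of n] by simp
    have "mu (\<Inter>i. U i) \<le> (1 / 2) ^ n" for n
      using mu_mono[of "\<Inter>i. U i" "U n"] s[of n] U(3)[of n] by force
    moreover have "(\<lambda>n. (1 / 2 :: real) ^ n) \<longlonglongrightarrow> 0" by (rule LIMSEQ_power_zero) simp
    ultimately have "mu (\<Inter>i. U i) \<le> 0" by (intro LIMSEQ_le_const) auto
    with that show ?thesis
      by (simp add: generalized_Martin_Lof_test_def Martin_Lof_test_def measure_le_0_iff)
  qed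
  with w show ?thesis unfolding weakly_2_random_rel_def random_rel_def by blast
qed

text \<open>Later only some unspecified tail is known to avoid a given open class, so all tails must
  be in the test. The new test collects the sequences that enter the old one when a finite string is
  put in front.\<close>

lemma tail_closed_test:
  assumes U: "sigma1 A (\<lambda>X n. X \<in> U n)" "\<And>n. mu (U n) \<le> (1 / 2) ^ n" and R: "\<And>n. R \<in> U n"
  obtains V where "sigma1 A (\<lambda>X n. X \<in> V n)" "\<And>n. mu (V n) \<le> (1 / 2) ^ n" "\<And>k n. shift k R \<in> V n"
proof
  \<comment> \<open>There are \<open>2 ^ l\<close> strings of length \<open>l\<close>, and deleting one of them multiplies the measure by at most
    \<open>2 ^ l\<close>; this accounts for two of the three \<open>l\<close>.\<close>
  define V where "V n = {X. \<exists>l. \<exists>r. r < (2::nat) ^ l \<and> comb_seq l (bit r) X \<in> U (n + 3 * l + 1)}" for n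
  have s: "U n \<in> sets coin_measure" for n using sigma1_sets[OF U(1), of n] by simp
  have "sigma1 A (\<lambda>X z :: (nat \<times> nat) \<times> nat. X \<in> U (fst (fst z) + 3 * snd (fst z) + 1))"
    by (intro sigma1_comp[OF U(1)] comp_intros)
  from sigma1_comb_seq[OF this computable_snd[OF computable_fst[OF computable_id]] computable_snd[OF computable_id]]
  show "sigma1 A (\<lambda>X n. X \<in> V n)"
    unfolding V_def mem_Collect_eq by (intro sigma1_ex sigma1_conj sigma1_decp comp_intros)
  show "shift k R \<in> V n" for k n
    unfolding V_def using R by (intro CollectI exI[of _ k] exI[of _ "seg R k"]) (simp add: seg_less comb_seq_shift)
  show "mu (V n) \<le> (1 / 2) ^ n" for n
  proof -
    let ?B = "\<lambda>l r. {X. comb_seq l (bit r) X \<in> U (n + 3 * l + 1)}"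
    have sB: "?B l r \<in> sets coin_measure" for l r by (rule comb_seq_vimage(1)[OF s])
    have B: "mu (?B l r) \<le> 2 ^ l * (1 / 2) ^ (n + 3 * l + 1)" for l r
    proof -
      have "{X. seg X l = seg (bit r) l \<and> X \<in> U (n + 3 * l + 1)} \<subseteq> U (n + 3 * l + 1)" by auto
      then have "mu {X. seg X l = seg (bit r) l \<and> X \<in> U (n + 3 * l + 1)} \<le> (1 / 2) ^ (n + 3 * l + 1)"
        using mu_mono[OF _ s] U(2) order_trans by blast
      then have "mu (?B l r) / 2 ^ l \<le> (1 / 2) ^ (n + 3 * l + 1)"
        unfolding comb_seq_vimage(2)[OF s, of l "bit r"] .
      then show ?thesis by (simp add: field_simps)
    qed
    have C: "mu (\<Union>r\<in>{..<(2::nat) ^ l}. ?B l r) \<le> (1 / 2) ^ n * (1 / 2) ^ Suc l" for l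
    proof -
      have "mu (\<Union>r\<in>{..<(2::nat) ^ l}. ?B l r) \<le> (\<Sum>r\<in>{..<(2::nat) ^ l}. mu (?B l r))"
        by (rule coin_prob.finite_measure_subadditive_finite) (use sB in auto)
      also have "\<dots> \<le> (\<Sum>r\<in>{..<(2::nat) ^ l}. 2 ^ l * (1 / 2) ^ (n + 3 * l + 1))"
        by (rule sum_mono[OF B])
      also have "\<dots> = (1 / 2) ^ n * (1 / 2) ^ Suc l"
        by (simp add: power_add power_divide field_simps power3_eq_cube mult.commute[of 3] power_mult)
      finally show ?thesis .
    qed
    have "V n = (\<Union>l. \<Union>r\<in>{..<(2::nat) ^ l}. ?B l r)" unfolding V_def by auto
    moreover have "mu (\<Union>l. \<Union>r\<in>{..<(2::nat) ^ l}. ?B l r) \<le> (1 / 2) ^ n * 1"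
    proof (rule mu_UN_le[OF _ C])
      show "(\<Union>r\<in>{..<(2::nat) ^ l}. ?B l r) \<in> sets coin_measure" for l
        using sB by (intro sets.finite_UN) auto
    qed (intro sums_mult power_half_series)
    ultimately show ?thesis by simp
  qed
qed

text \<open>Shifting preserves measure, and the index \<open>k + l + 1\<close> for position
  \<open>l\<close> makes the measures over all positions add up to \<open>2^-k\<close>.\<close>

lemma not_random_if_tails:
  assumes V: "sigma1 A (\<lambda>X n. X \<in> V n)" "\<And>n. mu (V n) \<le> (1 / 2) ^ n"
    and X: "\<And>k. \<exists>l. shift l X \<in> V (k + l + 1)"
  shows "\<not> random_rel A X"
proof (rule not_random_if)
  define H where "H n = {X. \<exists>l. shift l X \<in> V (n + l + 1)}" for n
  have "sigma1 A (\<lambda>X z :: nat \<times> nat. X \<in> V (fst z + snd z + 1))"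
    by (intro sigma1_comp[OF V(1)] comp_intros)
  from sigma1_shift[OF this computable_snd[OF computable_id]] show "sigma1 A (\<lambda>X n. X \<in> H n)"
    unfolding H_def mem_Collect_eq by (rule sigma1_ex)
  show "X \<in> H n" for n using X unfolding H_def by blast
  show "mu (H n) \<le> (1 / 2) ^ n" for n
  proof -
    have s: "V n \<in> sets coin_measure" for n using sigma1_sets[OF V(1), of n] by simp
    have le: "mu {X. shift l X \<in> V (n + l + 1)} \<le> (1 / 2) ^ n * (1 / 2) ^ Suc l" for l
      unfolding mu_shift[OF s] using V(2)[of "n + l + 1"] by (simp add: power_add)
    have "H n = (\<Union>l. {X. shift l X \<in> V (n + l + 1)})" unfolding H_def by auto
    moreover have "mu (\<Union>l. {X. shift l X \<in> V (n + l + 1)}) \<le> (1 / 2) ^ n * 1"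
      by (rule mu_UN_le[OF sets_shift[OF s] le]) (intro sums_mult power_half_series)
    ultimately show ?thesis by simp
  qed
qed

text \<open>A condition \<open>(Z, l, W)\<close> consists of a stem, the first \<open>l\<close> bits
  of \<open>Z\<close>, and the closed class outside \<open>W\<close>. Step \<open>k\<close> shrinks
  the closed class to avoid the generalized test with index \<open>k\<close>, then lengthens the
  stem by part of a tail of \<open>T\<close> that witnesses membership in a component of
  \<open>V\<close>.\<close>

theorem low_if_low_for_weak_2:
  assumes low: "low_for_weak_2_randomness A"
  shows "low_for_1_randomness A"
  unfolding low_for_1_randomness_def
proof (intro allI impI, rule ccontr)
  fix T assume T: "random_rel empty_oracle T" "\<not> random_rel A T"
  obtain U where U: "sigma1 A (\<lambda>X n. X \<in> U n)" "\<And>n. mu (U n) \<le> (1 / 2) ^ n" "\<And>n. T \<in> U n"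
    using not_randomE[OF T(2)] by metis
  obtain V where V: "sigma1 A (\<lambda>X n. X \<in> V n)" "\<And>n. mu (V n) \<le> (1 / 2) ^ n" "\<And>k n. shift k T \<in> V n"
    using tail_closed_test[OF U] by metis
  obtain R where R: "decidable R" "\<And>X m. X \<in> V m \<longleftrightarrow> (\<exists>n. R (m, n, seg X n, seg A n))" "upward R"
    using sigma1_mono[OF V(1)] by metis
  obtain W0 where W0: "sigma1_class empty_oracle W0" "mu W0 \<le> 1 / 2"
    "\<And>X. X \<notin> W0 \<Longrightarrow> random_rel empty_oracle X"
    using universal_class by metis
  \<comment> \<open>Every number counts as an index. The construction is not effective and may ask
    whether the index yields a generalized test.\<close>
  define test where "test c = pclass empty_oracle c" for c
  define cond where "cond s \<longleftrightarrow> fst s \<notin> snd (snd s) \<and> sigma1_class empty_oracle (snd (snd s)) \<and> W0 \<subseteq> snd (snd s)"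
    for s :: "cantor \<times> nat \<times> cantor set"
  \<comment> \<open>The index \<open>k + fst (snd s) + 1\<close> is the one that
    \<open>not_random_if_tails\<close> demands for a tail starting at the end of the stem.\<close>
  define ext where "ext k s t \<longleftrightarrow> seg (fst t) (fst (snd s)) = seg (fst s) (fst (snd s)) \<and>
      fst (snd s) < fst (snd t) \<and> snd (snd s) \<subseteq> snd (snd t) \<and>
      (generalized_Martin_Lof_test empty_oracle (test k) \<longrightarrow> (\<exists>i. test k i \<subseteq> snd (snd t))) \<and>
      R (k + fst (snd s) + 1, fst (snd t) - fst (snd s),
        seg (shift (fst (snd s)) (fst t)) (fst (snd t) - fst (snd s)), seg A (fst (snd t) - fst (snd s)))"
    for k and s t :: "cantor \<times> nat \<times> cantor set"
  have "\<exists>f. \<forall>k. cond (f k) \<and> ext k (f k) (f (Suc k))"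
  proof (rule dependent_nat_choice)
    have "W0 \<noteq> UNIV" using W0(2) by auto
    then obtain Z where "Z \<notin> W0" by blast
    with W0(1) show "\<exists>s. cond s" by (intro exI[of _ "(Z, 0, W0)"]) (simp add: cond_def)
  next
    fix s :: "cantor \<times> nat \<times> cantor set" and k :: nat
    assume s: "cond s"
    obtain Z l W where sZ: "s = (Z, l, W)" by (cases s)
    have Z: "Z \<notin> W" "sigma1_class empty_oracle W" "W0 \<subseteq> W" using s unfolding cond_def sZ by auto
    then have pos: "mu {X. seg X l = seg Z l \<and> X \<notin> W} > 0"
      using random_positive[OF Z(2,1)] W0(3) by blast
    have "\<exists>W'. sigma1_class empty_oracle W' \<and> W \<subseteq> W' \<and> mu {X. seg X l = seg Z l \<and> X \<notin> W'} > 0 \<and>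
      (generalized_Martin_Lof_test empty_oracle (test k) \<longrightarrow> (\<exists>i. test k i \<subseteq> W'))"
    proof (cases "generalized_Martin_Lof_test empty_oracle (test k)")
      case True
      then have t: "sigma1 empty_oracle (\<lambda>X i. X \<in> test k i)" "decseq (test k)" "mu (\<Inter>i. test k i) = 0"
        by (simp_all add: generalized_Martin_Lof_test_def uniformly_Sigma1_iff)
      have st: "test k i \<in> sets coin_measure" for i using sigma1_sets[OF t(1), of i] by simp
      \<comment> \<open>The components shrink to measure 0, so one of them is smaller than what
        remains of the cylinder outside \<open>W\<close>; adding it to \<open>W\<close> leaves
        positive measure.\<close>
      have "(\<lambda>i. mu (test k i)) \<longlonglongrightarrow> mu (\<Inter>i. test k i)"
        using st t(2) by (intro coin_prob.finite_Lim_measure_decseq) auto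
      then have "eventually (\<lambda>i. mu (test k i) < mu {X. seg X l = seg Z l \<and> X \<notin> W}) sequentially"
        using pos unfolding t(3) by (rule order_tendstoD(2))
      then obtain i where i: "mu (test k i) < mu {X. seg X l = seg Z l \<and> X \<notin> W}"
        by (auto simp: eventually_sequentially)
      have sC: "{X. seg X l = seg Z l \<and> X \<notin> W'} \<in> sets coin_measure" if "W' \<in> sets coin_measure" for W'
      proof -
        have "{X. seg X l = seg Z l \<and> X \<notin> W'} = {X. seg X l = seg Z l} - W'" by auto
        then show ?thesis using that sets_seg_eq by auto
      qed
      have sW: "W \<union> test k i \<in> sets coin_measure" using sigma1_class_sets[OF Z(2)] st by blast
      have "mu {X. seg X l = seg Z l \<and> X \<notin> W} \<le>
          mu ({X. seg X l = seg Z l \<and> X \<notin> W \<union> test k i} \<union> test k i)"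
        by (rule mu_mono) (use sC[OF sW] st in auto)
      also have "\<dots> \<le> mu {X. seg X l = seg Z l \<and> X \<notin> W \<union> test k i} + mu (test k i)"
        by (rule measure_Un_le[OF sC[OF sW] st])
      finally have "mu {X. seg X l = seg Z l \<and> X \<notin> W \<union> test k i} > 0" using i by linarith
      moreover have "sigma1_class empty_oracle (W \<union> test k i)"
        unfolding Un_iff by (intro sigma1_disj Z(2) sigma1_comp[OF t(1)] comp_intros)
      ultimately show ?thesis by (intro exI[of _ "W \<union> test k i"]) auto
    qed (use Z pos in blast)
    then obtain W' where W': "sigma1_class empty_oracle W'" "W \<subseteq> W'" "mu {X. seg X l = seg Z l \<and> X \<notin> W'} > 0"
      "generalized_Martin_Lof_test empty_oracle (test k) \<Longrightarrow> \<exists>i. test k i \<subseteq> W'" by blast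
    \<comment> \<open>The slice of \<open>W'\<close> above the stem has measure below 1, so some
      tail of the 1-random \<open>T\<close> avoids it; that tail, placed after the stem, stays in
      the closed class.\<close>
    obtain j where j: "shift j T \<notin> {Y. comb_seq l Z Y \<in> W'}"
      by (rule kucera_tail[OF mu_slice_less_1[OF W'(1,3)] T(1)])
    define Y where "Y = shift j T"
    from V(3)[of j "k + l + 1"] obtain n where "R (k + l + 1, n, seg Y n, seg A n)"
      unfolding R(2) Y_def by blast
    \<comment> \<open>Passing to \<open>Suc n\<close> makes the stem grow strictly even if the
      witness found has length 0.\<close>
    then have n: "R (k + l + 1, Suc n, seg Y (Suc n), seg A (Suc n))"
      by (rule upward_seg[OF R(3)]) simp
    have "cond (comb_seq l Z Y, l + Suc n, W')"
      unfolding cond_def using j W'(1,2) Z(3) by (auto simp: Y_def)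
    moreover have "ext k s (comb_seq l Z Y, l + Suc n, W')"
      unfolding ext_def sZ using W'(2,4) n by (simp add: seg_comb_seq_le)
    ultimately show "\<exists>t. cond t \<and> ext k s t" by blast
  qed
  then obtain f where f: "\<And>k. cond (f k)" "\<And>k. ext k (f k) (f (Suc k))" by blast
  define Z l W where "Z k = fst (f k)" and "l k = fst (snd (f k))" and "W k = snd (snd (f k))" for k
  have Z: "Z k \<notin> W k" "sigma1_class empty_oracle (W k)" for k
    using f(1)[of k] unfolding cond_def Z_def W_def by blast+
  have E: "seg (Z (Suc k)) (l k) = seg (Z k) (l k)" "l k < l (Suc k)" "W k \<subseteq> W (Suc k)"
    "generalized_Martin_Lof_test empty_oracle (test k) \<Longrightarrow> \<exists>i. test k i \<subseteq> W (Suc k)"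
    "R (k + l k + 1, l (Suc k) - l k, seg (shift (l k) (Z (Suc k))) (l (Suc k) - l k),
      seg A (l (Suc k) - l k))" for k
    using f(2)[of k] unfolding ext_def Z_def l_def W_def by blast+
  obtain X where X: "\<And>k. seg X (l k) = seg (Z k) (l k)"
    using limit_point[of Z l, OF E(1,2)] by metis
  have ge: "k \<le> l k" for k by (induction k) (use E(2) le_less_trans Suc_leI in blast)+
  have W_mono: "W k \<subseteq> W m" if "k \<le> m" for k m
    by (rule lift_Suc_mono_le[of W, OF E(3) that])
  have XW: "X \<notin> W k" for k
  proof
    assume "X \<in> W k"
    obtain S where S: "\<And>X. X \<in> W k \<longleftrightarrow> (\<exists>n. S (n, seg X n, seg empty_oracle n))"
      using sigma1_classE[OF Z(2)[of k]] by metis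
    with \<open>X \<in> W k\<close> obtain n where n: "S (n, seg X n, seg empty_oracle n)" by blast
    let ?m = "max k n"
    have "n \<le> l ?m" using ge[of ?m] by simp
    then have "seg X n = seg (Z ?m) n" by (rule seg_eq_mono[OF X])
    with n have "Z ?m \<in> W k" unfolding S by metis
    with W_mono[of k ?m] Z(1)[of ?m] show False by auto
  qed
  have "weakly_2_random_rel empty_oracle X"
    unfolding weakly_2_random_rel_def
  proof (intro allI impI)
    fix G assume G: "generalized_Martin_Lof_test empty_oracle G"
    then obtain p where "\<And>n. G n = pclass empty_oracle (pcode p) n"
      unfolding generalized_Martin_Lof_test_def uniformly_Sigma1_def pclass_pcode by blast
    then have "G = test (pcode p)" unfolding test_def by blast
    with G E(4)[of "pcode p"] obtain i where "G i \<subseteq> W (Suc (pcode p))" by blast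
    with XW show "X \<notin> (\<Inter>i. G i)" by blast
  qed
  with low have "weakly_2_random_rel A X" unfolding low_for_weak_2_randomness_def by blast
  then have "random_rel A X" by (rule weakly_2_random_imp_random)
  moreover have "\<exists>j. shift j X \<in> V (k + j + 1)" for k
  proof -
    let ?n = "l (Suc k) - l k"
    have "?n + l k = l (Suc k)" using E(2)[of k] by simp
    then have "seg (shift (l k) X) ?n = seg (shift (l k) (Z (Suc k))) ?n"
      using X[of "Suc k"] by (simp add: seg_shift)
    with E(5)[of k] have "shift (l k) X \<in> V (k + l k + 1)" unfolding R(2) by metis
    then show ?thesis ..
  qed
  then have "\<not> random_rel A X" by (rule not_random_if_tails[OF V(1,2)])
  ultimately show False by simp
qed

theorem corollary3p6:
  fixes A :: cantor
  shows "(low_for_1_randomness A \<longleftrightarrow> low_for_weak_2_random_tests A) \<and>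
    (low_for_weak_2_random_tests A \<longleftrightarrow> low_for_weak_2_randomness A)"
proof -
  have "low_for_weak_2_randomness A" if tests: "low_for_weak_2_random_tests A"
    unfolding low_for_weak_2_randomness_def
  proof (intro allI impI)
    fix X assume X: "weakly_2_random_rel empty_oracle X"
    have "X \<notin> (\<Inter>i. V i)" if V: "generalized_Martin_Lof_test A V" for V
    proof -
      obtain U where "generalized_Martin_Lof_test empty_oracle U" "(\<Inter>i. V i) \<subseteq> (\<Inter>i. U i)"
        using tests V unfolding low_for_weak_2_random_tests_def by meson
      with X show ?thesis unfolding weakly_2_random_rel_def by (meson subsetD)
    qed
    then show "weakly_2_random_rel A X" unfolding weakly_2_random_rel_def by simp
  qed
  with low_for_tests_if_low[of A] low_if_low_for_weak_2[of A] show ?thesis by argo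
qed

end
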